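(* Let $\mathcal G$ be a separable complex Hilbert space, let $N:\mathbb C\setminus\mathbb R\to\mathcal L(\mathcal G)$ be a Nevanlinna function and assume that $N(z)^{-1}\in\mathcal L(\mathcal G)$ for some, and hence for all $z\in\mathbb C\setminus\mathbb R$. Then there exists a weakly Lebesgue measurable operator-valued function $\lambda\mapsto\Xi(\lambda)\in\mathcal L(\mathcal G)$ on $\mathbb R$ such that $$\Xi(\lambda)=\Xi(\lambda)^*\quad\text{and}\quad0\le\Xi(\lambda)\le I_{\mathcal G}\quad\text{for a.e. }\lambda\in\mathbb R,$$ and the Nevanlinna function $\log(N):\mathbb C\setminus\mathbb R\to\mathcal L(\mathcal G)$ admits an integral representation of the form $$\log(N(z))=C+\int_{\mathbb R}\Big(\frac1{\lambda-z}-\frac{\lambda}{1+\lambda^2}\Big)\Xi(\lambda)\,d\lambda,\qquad(\ast)$$ where $C=\mathrm{Re}(\log(N(i)))\in\mathcal L(\mathcal G)$ is a self-adjoint operator and the integral is understood in the weak sense. If, in addition, $N$ admits an analytic continuation by reflection with respect to an open interval $I\subset\mathbb R$ such that $\sigma(N(z))\subset(\varepsilon,\infty)$ for some $\varepsilon>0$ and all $z\in I$, then also $\log(N)$ admits an analytic continuation by reflection with respect to $I$, $\Xi(\lambda)=0$ for a.e. $\lambda\in I$, and $(\ast)$ remains valid for $z\in I$.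
   Context: $\mathcal L(\mathcal G)$ is the space of bounded operators on $\mathcal G$; $\mathrm{Re}(K)=(K+K^* )/2$, $\mathrm{Im}(K)=(K-K^* )/(2i)$; $\mathbb C_\pm=\{z\mid\pm\mathrm{Im}(z)>0\}$. A function $N:\mathbb C_+\to\mathcal L(\mathcal G)$ is a Nevanlinna function if it is holomorphic and $\mathrm{Im}(N(z))\ge0$ for all $z\in\mathbb C_+$; it is extended to $\mathbb C_-$ by $N(z):=N(\overline z)^*$. It admits an analytic continuation by reflection with respect to an open subset $I\subset\mathbb R$ if $N$ can be continued analytically from $\mathbb C_+$ onto an open set $\mathcal O\subset\mathbb C$ containing $I$ such that the values of the continuation in $\mathcal O\cap\mathbb C_-$ coincide with the values $N(z)=N(\overline z)^*$ there; $N(z)$, $z\in I$, denotes the values of this continuation. If $N(z)^{-1}\in\mathcal L(\mathcal G)$ for $z\in\mathbb C\setminus\mathbb R$, then for $z\in\mathbb C_+$ $$\log(N(z)):=-i\int_0^\infty\big[(N(z)+i\lambda I_{\mathcal G})^{-1}-(1+i\lambda)^{-1}I_{\mathcal G}\big]\,d\lambda\in\mathcal L(\mathcal G),$$ and $\log(N(z)):=(\log(N(\overline z)))^*$ for $z\in\mathbb C_-$; this is again an $\mathcal L(\mathcal G)$-valued Nevanlinna function. *)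

theory Defs
  imports "HOL-Analysis.Analysis"
begin

section \<open>Complex Hilbert spaces\<close>

class complex_vector = real_vector +
  fixes scaleC :: "complex \<Rightarrow> 'a \<Rightarrow> 'a" (infixr "*\<^sub>C" 75)
  assumes scaleC_add_right: "a *\<^sub>C (x + y) = a *\<^sub>C x + a *\<^sub>C y"
    and scaleC_add_left: "(a + b) *\<^sub>C x = a *\<^sub>C x + b *\<^sub>C x"
    and scaleC_scaleC: "a *\<^sub>C b *\<^sub>C x = (a * b) *\<^sub>C x"
    and scaleC_of_real: "complex_of_real r *\<^sub>C x = r *\<^sub>R x"

class complex_normed_vector = complex_vector + real_normed_vector +
  assumes norm_scaleC: "norm (a *\<^sub>C x) = cmod a * norm x"

class complex_inner = complex_normed_vector +
  fixes cinner :: "'a \<Rightarrow> 'a \<Rightarrow> complex"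
  assumes cinner_commute: "cinner x y = cnj (cinner y x)"
    and cinner_add_left: "cinner (x + y) z = cinner x z + cinner y z"
    and cinner_scaleC_left: "cinner (a *\<^sub>C x) y = a * cinner x y"
    and cinner_self: "cinner x x = complex_of_real ((norm x)\<^sup>2)"

class chilbert_space = complex_inner + complete_space

subclass (in chilbert_space) banach ..

instantiation complex :: chilbert_space
begin

definition scaleC_complex :: "complex \<Rightarrow> complex \<Rightarrow> complex"
  where "scaleC_complex a x = a * x"

definition cinner_complex :: "complex \<Rightarrow> complex \<Rightarrow> complex"
  where "cinner_complex x y = x * cnj y"

instance
proof
  fix x y z a b :: complex and r :: real
  show "cinner x x = complex_of_real ((norm x)\<^sup>2)"
    unfolding cinner_complex_def by (rule complex_norm_square[symmetric])
qed (simp_all add: scaleC_complex_def cinner_complex_def algebra_simps norm_mult scaleR_conv_of_real)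

end

lemma scaleC_one [simp]: "1 *\<^sub>C (x::'a::complex_vector) = x"
  using scaleC_of_real[of 1 x] by simp

lemma scaleC_zero_left [simp]: "0 *\<^sub>C (x::'a::complex_vector) = 0"
  using scaleC_of_real[of 0 x] by simp

lemma scaleC_zero_right [simp]: "a *\<^sub>C (0::'a::complex_vector) = 0"
  using scaleC_add_right[of a 0 "0::'a"] by simp

lemma scaleC_minus_right: "a *\<^sub>C (- x) = - (a *\<^sub>C (x::'a::complex_vector))"
  using scaleC_add_right[of a x "- x"] by (simp add: minus_unique)

lemma scaleC_minus_left: "(- a) *\<^sub>C x = - (a *\<^sub>C (x::'a::complex_vector))"
  using scaleC_add_left[of a "- a" x] by (simp add: minus_unique)

lemma scaleC_diff_right: "a *\<^sub>C (x - y) = a *\<^sub>C x - a *\<^sub>C (y::'a::complex_vector)"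
  using scaleC_add_right[of a x "- y"] by (simp add: scaleC_minus_right)

lemma scaleC_scaleR: "a *\<^sub>C (r *\<^sub>R x) = r *\<^sub>R (a *\<^sub>C (x::'a::complex_vector))"
  by (metis mult.commute scaleC_of_real scaleC_scaleC)

lemma bounded_linear_scaleC: "bounded_linear (\<lambda>x::'a::complex_normed_vector. a *\<^sub>C x)"
  by (rule bounded_linear_intro[where K = "cmod a"])
    (simp_all add: scaleC_add_right scaleC_scaleR norm_scaleC mult.commute)

lemma cinner_add_right: "cinner x (y + z) = cinner x y + cinner x (z::'a::complex_inner)"
  by (metis cinner_add_left cinner_commute complex_cnj_add)

lemma cinner_scaleC_right: "cinner x (a *\<^sub>C y) = cnj a * cinner x (y::'a::complex_inner)"
  by (metis cinner_commute cinner_scaleC_left complex_cnj_mult)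

lemma cinner_zero_left [simp]: "cinner 0 (y::'a::complex_inner) = 0"
  using cinner_add_left[of 0 0 y] by simp

lemma cinner_minus_left: "cinner (- x) y = - cinner x (y::'a::complex_inner)"
  using cinner_add_left[of x "- x" y] by (simp add: minus_unique)

lemma cinner_diff_left: "cinner (x - y) z = cinner x z - cinner y (z::'a::complex_inner)"
  using cinner_add_left[of x "- y" z] by (simp add: cinner_minus_left)


section \<open>The Banach algebra of bounded complex-linear operators\<close>

typedef (overloaded) 'a bop =
  "{T :: 'a::complex_normed_vector \<Rightarrow>\<^sub>L 'a. \<forall>c x. blinfun_apply T (c *\<^sub>C x) = c *\<^sub>C blinfun_apply T x}"
  morphisms blinfun_of_bop Bop
  by (rule exI[of _ 0]) simp

setup_lifting type_definition_bop

lift_definition bop_apply :: "'a::complex_normed_vector bop \<Rightarrow> 'a \<Rightarrow> 'a" is blinfun_apply .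

lemma bop_eqI: "(\<And>x. bop_apply S x = bop_apply T x) \<Longrightarrow> S = T"
  by transfer (rule blinfun_eqI)

instantiation bop :: (complex_normed_vector) complex_normed_vector
begin

lift_definition norm_bop :: "'a bop \<Rightarrow> real" is norm .

lift_definition zero_bop :: "'a bop" is 0 by simp

lift_definition plus_bop :: "'a bop \<Rightarrow> 'a bop \<Rightarrow> 'a bop" is "(+)"
  by (simp add: blinfun.add_left scaleC_add_right)

lift_definition minus_bop :: "'a bop \<Rightarrow> 'a bop \<Rightarrow> 'a bop" is "(-)"
  by (simp add: blinfun.diff_left scaleC_diff_right)

lift_definition uminus_bop :: "'a bop \<Rightarrow> 'a bop" is uminus
  by (simp add: blinfun.minus_left scaleC_minus_right)

lift_definition scaleR_bop :: "real \<Rightarrow> 'a bop \<Rightarrow> 'a bop" is scaleR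
  by (simp add: blinfun.scaleR_left scaleC_scaleR)

lift_definition scaleC_bop :: "complex \<Rightarrow> 'a bop \<Rightarrow> 'a bop"
  is "\<lambda>c T. Blinfun (\<lambda>x. c *\<^sub>C blinfun_apply T x)"
  by (subst (1 2) bounded_linear_Blinfun_apply)
    (auto intro!: bounded_linear_compose[OF bounded_linear_scaleC]
      simp: blinfun.bounded_linear_right scaleC_scaleC mult.commute)

definition dist_bop :: "'a bop \<Rightarrow> 'a bop \<Rightarrow> real"
  where "dist_bop S T = norm (S - T)"

definition [code del]:
  "(uniformity :: ('a bop \<times> 'a bop) filter) = (INF e\<in>{0 <..}. principal {(x, y). dist x y < e})"

definition open_bop :: "'a bop set \<Rightarrow> bool"
  where [code del]: "open_bop S = (\<forall>x\<in>S. \<forall>\<^sub>F (x', y) in uniformity. x' = x \<longrightarrow> y \<in> S)"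

definition sgn_bop :: "'a bop \<Rightarrow> 'a bop"
  where "sgn_bop T = inverse (norm T) *\<^sub>R T"

instance
proof
  fix S T U :: "'a bop" and r s :: real and a b :: complex
  show "S + T + U = S + (T + U)" "S + T = T + S" "0 + S = S" "- S + S = 0" "S - T = S + - T"
    by (transfer, simp)+
  show "r *\<^sub>R (S + T) = r *\<^sub>R S + r *\<^sub>R T" "(r + s) *\<^sub>R S = r *\<^sub>R S + s *\<^sub>R S"
    "r *\<^sub>R s *\<^sub>R S = (r * s) *\<^sub>R S" "1 *\<^sub>R S = S"
    by (transfer, simp add: scaleR_add_right scaleR_add_left)+
  show "dist S T = norm (S - T)" by (rule dist_bop_def)
  show "sgn S = inverse (norm S) *\<^sub>R S" by (rule sgn_bop_def)
  show "(uniformity :: ('a bop \<times> 'a bop) filter) = (INF e\<in>{0 <..}. principal {(x, y). dist x y < e})"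
    by (rule uniformity_bop_def)
  show "open A = (\<forall>x\<in>A. \<forall>\<^sub>F (x', y) in uniformity. x' = x \<longrightarrow> y \<in> A)" for A :: "'a bop set"
    by (rule open_bop_def)
  show "(norm S = 0) = (S = 0)" by transfer simp
  show "norm (S + T) \<le> norm S + norm T" by transfer (rule norm_triangle_ineq)
  show "norm (r *\<^sub>R S) = \<bar>r\<bar> * norm S" by transfer simp
  have bl: "bounded_linear (\<lambda>x. c *\<^sub>C blinfun_apply B x)" for c and B :: "'a \<Rightarrow>\<^sub>L 'a"
    by (rule bounded_linear_compose[OF bounded_linear_scaleC blinfun.bounded_linear_right])
  note Bl = bounded_linear_Blinfun_apply[OF bl]
  have app: "bop_apply (c *\<^sub>C V) x = c *\<^sub>C bop_apply V x" for c x and V :: "'a bop"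
    by transfer (simp add: Bl)
  have add: "bop_apply (V + W) x = bop_apply V x + bop_apply W x" for x and V W :: "'a bop"
    by transfer (simp add: blinfun.add_left)
  have scR: "bop_apply (r *\<^sub>R V) x = r *\<^sub>R bop_apply V x" for r x and V :: "'a bop"
    by transfer (simp add: blinfun.scaleR_left)
  show "a *\<^sub>C (S + T) = a *\<^sub>C S + a *\<^sub>C T" "(a + b) *\<^sub>C S = a *\<^sub>C S + b *\<^sub>C S"
    "a *\<^sub>C b *\<^sub>C S = (a * b) *\<^sub>C S" "complex_of_real r *\<^sub>C S = r *\<^sub>R S"
    by (rule bop_eqI,
        simp add: app add scR scaleC_add_right scaleC_add_left scaleC_scaleC scaleC_of_real)+
  show "norm (a *\<^sub>C S) = cmod a * norm S"
  proof transfer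
    fix a :: complex and S :: "'a \<Rightarrow>\<^sub>L 'a"
    have le: "norm (Blinfun (\<lambda>x. c *\<^sub>C blinfun_apply B x)) \<le> cmod c * norm B"
      for c and B :: "'a \<Rightarrow>\<^sub>L 'a"
      by (rule norm_blinfun_bound)
        (simp_all add: Bl norm_scaleC mult.assoc mult_left_mono norm_blinfun)
    show "norm (Blinfun (\<lambda>x. a *\<^sub>C blinfun_apply S x)) = cmod a * norm S"
    proof (cases "a = 0")
      case True
      then show ?thesis using le[of a S] by simp
    next
      case False
      define B where "B = Blinfun (\<lambda>x. a *\<^sub>C blinfun_apply S x)"
      have "S = Blinfun (\<lambda>x. inverse a *\<^sub>C blinfun_apply B x)"
        by (rule blinfun_eqI) (simp add: Bl B_def scaleC_scaleC False blinfun_apply_inverse)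
      then have "norm S \<le> cmod (inverse a) * norm B" by (metis le)
      then have "cmod a * norm S \<le> norm B"
        using False by (simp add: norm_inverse divide_inverse[symmetric] pos_le_divide_eq mult.commute)
      then show ?thesis using le[of a S] by (simp add: B_def)
    qed
  qed
qed

end

lemma bop_apply_simps [simp]:
  fixes S T :: "'a::complex_normed_vector bop"
  shows "bop_apply 0 x = 0"
    and "bop_apply (S + T) x = bop_apply S x + bop_apply T x"
    and "bop_apply (S - T) x = bop_apply S x - bop_apply T x"
    and "bop_apply (- S) x = - bop_apply S x"
    and "bop_apply (r *\<^sub>R S) x = r *\<^sub>R bop_apply S x"
    and "bop_apply (c *\<^sub>C S) x = c *\<^sub>C bop_apply S x"
  by (transfer, simp add: blinfun.bilinear_simps bounded_linear_Blinfun_apply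
      bounded_linear_compose[OF bounded_linear_scaleC blinfun.bounded_linear_right])+

lemma bop_apply_add: "bop_apply T (x + y) = bop_apply T x + bop_apply T y"
  by transfer (simp add: blinfun.add_right)

lemma bop_apply_scaleC: "bop_apply T (c *\<^sub>C x) = c *\<^sub>C bop_apply T x"
  by transfer simp

lemma norm_bop_apply: "norm (bop_apply T x) \<le> norm T * norm x"
  by transfer (rule norm_blinfun)

instance bop :: (chilbert_space) banach
proof
  fix X :: "nat \<Rightarrow> 'a bop"
  assume "Cauchy X"
  have dist_eq: "dist S T = dist (blinfun_of_bop S) (blinfun_of_bop T)" for S T :: "'a bop"
    by (simp add: dist_norm norm_bop.rep_eq minus_bop.rep_eq)
  have "Cauchy (\<lambda>n. blinfun_of_bop (X n))"
    using \<open>Cauchy X\<close> by (simp add: Cauchy_def dist_eq)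
  then obtain L where L: "(\<lambda>n. blinfun_of_bop (X n)) \<longlonglongrightarrow> L"
    using Cauchy_convergent_iff convergent_def by blast
  have ptw: "(\<lambda>n. blinfun_apply (blinfun_of_bop (X n)) x) \<longlonglongrightarrow> blinfun_apply L x" for x
    by (rule blinfun.tendsto[OF L tendsto_const])
  have "blinfun_apply L (c *\<^sub>C x) = c *\<^sub>C blinfun_apply L x" for c x
  proof (rule LIMSEQ_unique[OF ptw])
    have "(\<lambda>n. c *\<^sub>C blinfun_apply (blinfun_of_bop (X n)) x) \<longlonglongrightarrow> c *\<^sub>C blinfun_apply L x"
      by (rule bounded_linear.tendsto[OF bounded_linear_scaleC ptw])
    then show "(\<lambda>n. blinfun_apply (blinfun_of_bop (X n)) (c *\<^sub>C x)) \<longlonglongrightarrow> c *\<^sub>C blinfun_apply L x"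
      by (simp add: blinfun_of_bop[simplified])
  qed
  then have "blinfun_of_bop (Bop L) = L" by (simp add: Bop_inverse)
  then have "X \<longlonglongrightarrow> Bop L" using L by (simp add: tendsto_iff dist_eq)
  then show "convergent X" by (rule convergentI)
qed

instantiation bop :: (complex_normed_vector) "{real_normed_algebra, monoid_mult}"
begin

lift_definition one_bop :: "'a bop" is id_blinfun by simp

lift_definition times_bop :: "'a bop \<Rightarrow> 'a bop \<Rightarrow> 'a bop" is blinfun_compose by simp

instance
proof
  fix S T U :: "'a bop" and r :: real
  show "S * T * U = S * (T * U)" "1 * S = S" "S * 1 = S"
    by (transfer, rule blinfun_eqI, simp)+
  show "(S + T) * U = S * U + T * U" "S * (T + U) = S * T + S * U"
    "r *\<^sub>R S * T = r *\<^sub>R (S * T)" "S * r *\<^sub>R T = r *\<^sub>R (S * T)"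
    by (transfer, rule blinfun_eqI, simp add: blinfun.bilinear_simps)+
  show "norm (S * T) \<le> norm S * norm T" by transfer (rule norm_blinfun_compose)
qed

end

lemma bop_apply_one [simp]: "bop_apply 1 x = x"
  by transfer simp

lemma bop_apply_times [simp]: "bop_apply (S * T) x = bop_apply S (bop_apply T x)"
  by transfer simp

definition bop_invertible :: "'a::complex_normed_vector bop \<Rightarrow> bool"
  where "bop_invertible T \<longleftrightarrow> (\<exists>S. S * T = 1 \<and> T * S = 1)"

definition bop_inv :: "'a::complex_normed_vector bop \<Rightarrow> 'a bop"
  where "bop_inv T = (THE S. S * T = 1 \<and> T * S = 1)"

definition spectrum :: "'a::complex_normed_vector bop \<Rightarrow> complex set"
  where "spectrum T = {c. \<not> bop_invertible (T - c *\<^sub>C 1)}"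

lemma bop_inv_eqI: "S * T = 1 \<Longrightarrow> T * S = 1 \<Longrightarrow> bop_inv T = S"
  unfolding bop_inv_def
  by (rule the_equality) (auto, metis mult.assoc mult_1_left mult_1_right)


section \<open>Adjoints and the order on operators\<close>

text \<open>The adjoint exists on every \<open>chilbert_space\<close> by the Riesz representation theorem.\<close>

definition adj :: "'a::chilbert_space bop \<Rightarrow> 'a bop"
  where "adj T = (THE S. \<forall>x y. cinner (bop_apply T x) y = cinner x (bop_apply S y))"

definition self_adjoint :: "'a::chilbert_space bop \<Rightarrow> bool"
  where "self_adjoint T \<longleftrightarrow> T = adj T"

definition Re_bop :: "'a::chilbert_space bop \<Rightarrow> 'a bop"
  where "Re_bop T = (1 / 2) *\<^sub>C (T + adj T)"

definition Im_bop :: "'a::chilbert_space bop \<Rightarrow> 'a bop"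
  where "Im_bop T = (1 / (2 * \<i>)) *\<^sub>C (T - adj T)"

lemma cinner_bop_eq_0_imp_0:
  fixes T :: "'a::complex_inner bop"
  assumes "\<And>x. cinner (bop_apply T x) x = 0"
  shows "T = 0"
proof (rule bop_eqI)
  have sym: "cinner (bop_apply T x) y + cinner (bop_apply T y) x = 0" for x y
    using assms[of "x + y"] assms[of x] assms[of y]
    by (simp add: bop_apply_add cinner_add_left cinner_add_right add.commute)
  have anti: "cinner (bop_apply T x) y - cinner (bop_apply T y) x = 0" for x y
  proof -
    have "\<i> * (cinner (bop_apply T x) y - cinner (bop_apply T y) x) = 0"
      using sym[of "\<i> *\<^sub>C x" y]
      by (simp add: bop_apply_scaleC cinner_scaleC_left cinner_scaleC_right algebra_simps)
    then show ?thesis by simp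
  qed
  fix x
  have "cinner (bop_apply T x) (bop_apply T x) = 0"
    using sym[of x "bop_apply T x"] anti[of x "bop_apply T x"] by simp
  then show "bop_apply T x = bop_apply 0 x" by (simp add: cinner_self)
qed

instantiation bop :: (complex_inner) order
begin

definition less_eq_bop :: "'a bop \<Rightarrow> 'a bop \<Rightarrow> bool"
  where "S \<le> T \<longleftrightarrow> (\<forall>x. cinner (bop_apply (T - S) x) x \<in> \<real>\<^sub>\<ge>\<^sub>0)"

definition less_bop :: "'a bop \<Rightarrow> 'a bop \<Rightarrow> bool"
  where "S < T \<longleftrightarrow> S \<le> T \<and> \<not> T \<le> (S::'a bop)"

instance
proof
  fix S T U :: "'a bop"
  show "(S < T) = (S \<le> T \<and> \<not> T \<le> S)" by (rule less_bop_def)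
  show "S \<le> S" by (simp add: less_eq_bop_def)
  show "S \<le> U" if "S \<le> T" "T \<le> U"
  proof -
    have "cinner (bop_apply (U - S) x) x = cinner (bop_apply (U - T) x) x + cinner (bop_apply (T - S) x) x" for x
      by (simp add: cinner_diff_left)
    then show ?thesis using that by (auto simp: less_eq_bop_def intro: nonneg_Reals_add_I)
  qed
  show "S = T" if "S \<le> T" "T \<le> S"
  proof -
    have "cinner (bop_apply (T - S) x) x = 0" for x
    proof -
      have "cinner (bop_apply (T - S) x) x = - cinner (bop_apply (S - T) x) x"
        by (simp add: cinner_diff_left)
      moreover have "cinner (bop_apply (T - S) x) x \<in> \<real>\<^sub>\<ge>\<^sub>0" "cinner (bop_apply (S - T) x) x \<in> \<real>\<^sub>\<ge>\<^sub>0"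
        using that by (auto simp only: less_eq_bop_def)
      ultimately show ?thesis
        by (auto simp: complex_nonneg_Reals_iff complex_eq_iff)
    qed
    then have "T - S = 0" by (rule cinner_bop_eq_0_imp_0)
    then show ?thesis by simp
  qed
qed

end


section \<open>Operator-valued Nevanlinna functions\<close>

text \<open>Complex differentiability with respect to the norm of the (complex) codomain.\<close>

definition vholomorphic_on :: "(complex \<Rightarrow> 'b::complex_normed_vector) \<Rightarrow> complex set \<Rightarrow> bool"
    (infix "vholomorphic'_on" 50)
  where "f vholomorphic_on S \<longleftrightarrow>
    (\<forall>z\<in>S. \<exists>D. (f has_derivative (\<lambda>h. h *\<^sub>C D)) (at z within S))"

definition upper_half :: "complex set" ("\<complex>\<^sub>+")
  where "\<complex>\<^sub>+ = {z. Im z > 0}"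

definition lower_half :: "complex set" ("\<complex>\<^sub>-")
  where "\<complex>\<^sub>- = {z. Im z < 0}"

text \<open>Functions on \<open>\<complex> - \<real>\<close> are total functions on \<open>complex\<close> whose values on the real
  axis are never used.\<close>

definition nevanlinna :: "(complex \<Rightarrow> 'a::chilbert_space bop) \<Rightarrow> bool"
  where "nevanlinna N \<longleftrightarrow>
    N vholomorphic_on \<complex>\<^sub>+ \<and> (\<forall>z\<in>\<complex>\<^sub>+. 0 \<le> Im_bop (N z)) \<and>
    (\<forall>z\<in>\<complex>\<^sub>-. N z = adj (N (cnj z)))"

text \<open>\<open>M\<close> is an analytic continuation of \<open>N\<close> by reflection with respect to the open set \<open>I\<close>;
  its values on \<open>I\<close>, the boundary values of \<open>N\<close> from \<open>\<complex>\<^sub>+\<close>, are uniquely determined.\<close>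

definition continuation_by_reflection ::
  "(complex \<Rightarrow> 'a::chilbert_space bop) \<Rightarrow> real set \<Rightarrow> (complex \<Rightarrow> 'a bop) \<Rightarrow> bool"
  where "continuation_by_reflection N I M \<longleftrightarrow>
    (\<exists>\<O>. open \<O> \<and> complex_of_real ` I \<subseteq> \<O> \<and> M vholomorphic_on (\<complex>\<^sub>+ \<union> \<O>) \<and>
      (\<forall>z\<in>\<complex>\<^sub>+. M z = N z) \<and> (\<forall>z\<in>\<O> \<inter> \<complex>\<^sub>-. M z = N z))"

definition log_bop :: "'a::chilbert_space bop \<Rightarrow> 'a bop"
  where "log_bop T = (- \<i>) *\<^sub>C integral {0..}
    (\<lambda>t::real. bop_inv (T + (\<i> * of_real t) *\<^sub>C 1) - (1 / (1 + \<i> * of_real t)) *\<^sub>C 1)"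

definition nevanlinna_log :: "(complex \<Rightarrow> 'a::chilbert_space bop) \<Rightarrow> complex \<Rightarrow> 'a bop"
  where "nevanlinna_log N z =
    (if z \<in> \<complex>\<^sub>+ then log_bop (N z)
     else if z \<in> \<complex>\<^sub>- then adj (log_bop (N (cnj z)))
     else 0)"


section \<open>Weak measurability and weak integrals\<close>

definition weakly_measurable :: "'s measure \<Rightarrow> ('s \<Rightarrow> 'a::complex_inner bop) \<Rightarrow> bool"
  where "weakly_measurable M F \<longleftrightarrow> (\<forall>x y. (\<lambda>t. cinner (bop_apply (F t) x) y) \<in> borel_measurable M)"

definition has_weak_integral ::
    "'s measure \<Rightarrow> ('s \<Rightarrow> 'a::complex_inner bop) \<Rightarrow> 'a bop \<Rightarrow> bool"
  where "has_weak_integral M F J \<longleftrightarrow>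
    (\<forall>x y. has_bochner_integral M (\<lambda>t. cinner (bop_apply (F t) x) y) (cinner (bop_apply J x) y))"

definition herglotz_kernel :: "complex \<Rightarrow> real \<Rightarrow> complex"
  where "herglotz_kernel z t = 1 / (of_real t - z) - of_real (t / (1 + t\<^sup>2))"

end

theory Submission
  imports Defs "HOL-Complex_Analysis.Complex_Analysis"
begin

text \<open>
  For a dissipative invertible operator \<open>T\<close> the imaginary part of \<open>log T\<close> lies between \<open>0\<close> and \<open>\<pi>\<close>:
  the path of integration in the definition of \<open>log T\<close>, which runs along the imaginary axis, can be
  rotated to the positive or to the negative half-line, where the sign of \<open>Im ((T + l)\<^sup>-\<^sup>1)\<close> is known
  (\<open>Im_log_bop_bounds\<close>). Hence \<open>log N\<close> is a Nevanlinna function with \<open>0 \<le> Im (log N) \<le> \<pi>\<close>, and the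
  Herglotz measure of such a function has a density with values between \<open>0\<close> and \<open>1\<close>, namely the
  boundary value \<open>\<Xi>\<close> of \<open>Im (log N)/\<pi>\<close>.

  The boundary value is constructed on the unit disc, which \<open>half_plane_map \<i>\<close> carries to the upper
  half-plane. For a vector \<open>x\<close> the function \<open>\<langle>log N x, x\<rangle>\<close> becomes a power series whose imaginary part is
  bounded. By Parseval's identity its coefficients are square summable, so the dilations of the
  imaginary part are Cauchy in \<open>L\<^sup>2\<close> (\<open>disc_Im_L2_cauchy\<close>) and converge almost everywhere along a suitable
  sequence of radii. Separability provides one sequence of radii for a dense sequence of vectors, and as
  the operators are uniformly bounded, this gives weak operator convergence at almost every point
  (\<open>nevanlinna_log_boundary_values\<close>). The Schwarz integral formula passes to the limit by dominated
  convergence. On the line \<open>i\<close> times the Schwarz kernel is \<open>(1 + tz)/(t - z)\<close>, and arc length is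
  \<open>2 dt/(1 + t\<^sup>2)\<close>, which produces the kernel \<open>1/(t - z) - t/(1 + t\<^sup>2)\<close> (\<open>disc_herglotz_representation\<close>).

  That one invertible value forces all values to be invertible is an instance of Harnack's inequality
  (\<open>nevanlinna_invertible_upper\<close>).

  For the continuation: at a point \<open>t\<close> of the interval, \<open>N\<close> has a self-adjoint limit with spectrum in
  \<open>(\<epsilon>, \<infinity>)\<close>, hence a strictly positive one. Close to such an operator \<open>Im (log T)\<close> is controlled by
  \<open>\<parallel>Im T\<parallel>\<close>, so \<open>Im (log N)\<close> tends to \<open>0\<close> at \<open>t\<close> and \<open>\<Xi>\<close> vanishes on the interval. The integral over
  the complement of the interval, together with the constant \<open>C\<close>, is then the continuation of \<open>log N\<close>.
\<close>

section \<open>Complex Hilbert spaces\<close>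

lemma cinner_minus_right: "cinner x (- y) = - cinner x (y::'a::complex_inner)"
  by (metis cinner_commute cinner_minus_left complex_cnj_minus)

lemma cinner_diff_right: "cinner x (y - z) = cinner x y - cinner x (z::'a::complex_inner)"
  by (metis cinner_commute cinner_diff_left complex_cnj_diff)

lemma cinner_zero_right [simp]: "cinner x (0::'a::complex_inner) = 0"
  by (metis cinner_commute cinner_zero_left complex_cnj_zero)

lemma cinner_scaleR_left: "cinner (r *\<^sub>R x) y = of_real r * cinner x (y::'a::complex_inner)"
  by (metis cinner_scaleC_left scaleC_of_real)

lemma cinner_scaleR_right: "cinner x (r *\<^sub>R y) = of_real r * cinner x (y::'a::complex_inner)"
  by (metis cinner_scaleC_right scaleC_of_real complex_cnj_complex_of_real)

lemmas cinner_simps = cinner_add_left cinner_add_right cinner_diff_left cinner_diff_right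
  cinner_minus_left cinner_minus_right cinner_scaleC_left cinner_scaleC_right
  cinner_scaleR_left cinner_scaleR_right

lemma Re_cinner_self [simp]: "Re (cinner x x) = (norm (x::'a::complex_inner))\<^sup>2"
  by (simp add: cinner_self)

lemma Im_cinner_self [simp]: "Im (cinner x (x::'a::complex_inner)) = 0"
  by (simp add: cinner_self)

lemma norm_add_sq:
  "(norm (x + y))\<^sup>2 = (norm x)\<^sup>2 + (norm y)\<^sup>2 + 2 * Re (cinner x (y::'a::complex_inner))"
proof -
  have "Re (cinner y x) = Re (cinner x y)" by (subst cinner_commute) simp
  then show ?thesis
    by (simp flip: Re_cinner_self add: cinner_simps)
qed

lemma parallelogram_law:
  "(norm (x + y))\<^sup>2 + (norm (x - y))\<^sup>2 = 2 * (norm x)\<^sup>2 + 2 * (norm (y::'a::complex_inner))\<^sup>2"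
  using norm_add_sq[of x y] norm_add_sq[of x "- y"] by (simp add: cinner_minus_right)

text \<open>Expanding \<open>\<parallel>ax - by\<parallel>\<^sup>2 \<ge> 0\<close> with \<open>a = \<parallel>y\<parallel>\<^sup>2\<close> and \<open>b = \<langle>x,y\<rangle>\<close>.\<close>

lemma cauchy_schwarz: "cmod (cinner x y) \<le> norm x * norm (y::'a::complex_inner)"
proof (cases "y = 0")
  case False
  define b where "b = cinner x y"
  define s where "s = (norm y)\<^sup>2"
  have s: "s > 0" using False by (simp add: s_def)
  have R: "cinner (of_real s *\<^sub>C x) ((- b) *\<^sub>C y) = - of_real (s * (cmod b)\<^sup>2)"
    using complex_norm_square[of b] by (simp add: cinner_simps b_def[symmetric])
  have e: "(norm (of_real s *\<^sub>C x + (- b) *\<^sub>C y))\<^sup>2 = s\<^sup>2 * (norm x)\<^sup>2 + (cmod b)\<^sup>2 * s - 2 * s * (cmod b)\<^sup>2"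
    unfolding norm_add_sq R by (simp add: norm_scaleC power_mult_distrib s_def[symmetric])
  have "0 \<le> s\<^sup>2 * (norm x)\<^sup>2 + (cmod b)\<^sup>2 * s - 2 * s * (cmod b)\<^sup>2"
    unfolding e[symmetric] by simp
  then have "s * (cmod b)\<^sup>2 \<le> s * (s * (norm x)\<^sup>2)"
    by (simp add: power2_eq_square algebra_simps)
  then have "(cmod b)\<^sup>2 \<le> s * (norm x)\<^sup>2"
    using s by simp
  then have "(cmod b)\<^sup>2 \<le> (norm x * norm y)\<^sup>2"
    by (simp add: s_def power_mult_distrib mult.commute)
  then show ?thesis unfolding b_def by (rule power2_le_imp_le) simp
qed simp

lemma bounded_linear_cinner_left: "bounded_linear (\<lambda>x. cinner x (y::'a::complex_inner))"
  by (rule bounded_linear_intro[where K = "norm y"])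
    (simp_all add: cinner_simps cauchy_schwarz scaleR_conv_of_real)

lemma cinner_eqI: "(\<And>y. cinner x y = cinner z (y::'a::complex_inner)) \<Longrightarrow> x = z"
  using cinner_self[of "x - z"] by (simp add: cinner_diff_left)

text \<open>The Riesz representation theorem. A minimising sequence for the norm on the affine hyperplane
  \<open>\<phi> = 1\<close> is Cauchy by the parallelogram law; its limit is orthogonal to the kernel of \<open>\<phi>\<close>.\<close>

lemma riesz_representation:
  fixes \<phi> :: "'a::chilbert_space \<Rightarrow> complex"
  assumes add: "\<And>x y. \<phi> (x + y) = \<phi> x + \<phi> y" and scal: "\<And>c x. \<phi> (c *\<^sub>C x) = c * \<phi> x"
    and bd: "\<And>x. cmod (\<phi> x) \<le> K * norm x"
  shows "\<exists>v. \<forall>x. \<phi> x = cinner x v"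
proof (cases "\<forall>x. \<phi> x = 0")
  case True
  then show ?thesis by (intro exI[of _ 0]) simp
next
  case False
  then obtain x0 where x0: "\<phi> x0 \<noteq> 0" by blast
  have diff: "\<phi> (x - y) = \<phi> x - \<phi> y" for x y
    using add[of "x - y" y] by simp
  define A where "A = {x. \<phi> x = 1}"
  have Ane: "inverse (\<phi> x0) *\<^sub>C x0 \<in> A" using x0 by (simp add: A_def scal)
  define d where "d = Inf ((\<lambda>x. (norm x)\<^sup>2) ` A)"
  have bb: "bdd_below ((\<lambda>x. (norm x)\<^sup>2) ` A)" by (intro bdd_belowI[of _ 0]) auto
  have dle: "d \<le> (norm x)\<^sup>2" if "x \<in> A" for x
    unfolding d_def using bb that by (intro cInf_lower) auto
  have "\<exists>x\<in>A. (norm x)\<^sup>2 < d + 1 / real (Suc n)" for n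
    using cInf_lessD[of "(\<lambda>x. (norm x)\<^sup>2) ` A" "d + 1 / real (Suc n)"] Ane
    by (auto simp: d_def)
  then obtain X where X: "\<And>n. X n \<in> A" "\<And>n. (norm (X n))\<^sup>2 < d + 1 / real (Suc n)" by metis
  have mid: "(norm (x - y))\<^sup>2 \<le> 2 * (norm x)\<^sup>2 + 2 * (norm y)\<^sup>2 - 4 * d" if "x \<in> A" "y \<in> A" for x y
  proof -
    have "(1/2) *\<^sub>C (x + y) \<in> A" using that by (simp add: A_def scal add)
    then have "d \<le> (norm ((1/2) *\<^sub>C (x + y)))\<^sup>2" by (rule dle)
    also have "\<dots> = (norm (x + y))\<^sup>2 / 4"
      by (simp add: norm_scaleC power_mult_distrib power_divide norm_divide)
    finally show ?thesis using parallelogram_law[of x y] by simp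
  qed
  have "Cauchy X"
  proof (rule metric_CauchyI)
    fix e :: real assume e: "e > 0"
    obtain M where M: "real M > 4 / e\<^sup>2" using reals_Archimedean2 by blast
    have "dist (X m) (X n) < e" if "m \<ge> M" "n \<ge> M" for m n
    proof -
      have Mp: "real M > 0" using M e by (meson divide_pos_pos less_trans zero_less_numeral zero_less_power)
      have s: "1 / real (Suc k) \<le> 1 / real M" if "k \<ge> M" for k
        using that Mp by (intro divide_left_mono) auto
      have "(norm (X m - X n))\<^sup>2 \<le> 2 * (norm (X m))\<^sup>2 + 2 * (norm (X n))\<^sup>2 - 4 * d"
        by (rule mid) (rule X)+
      also have "\<dots> < 4 * (1 / real M)"
        using X(2)[of m] X(2)[of n] s[OF that(1)] s[OF that(2)] by linarith
      also have "\<dots> < e\<^sup>2"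
        using M Mp e by (simp add: field_simps)
      finally show ?thesis unfolding dist_norm using e by (simp add: power2_less_imp_less)
    qed
    then show "\<exists>M. \<forall>m\<ge>M. \<forall>n\<ge>M. dist (X m) (X n) < e" by blast
  qed
  then obtain u where u: "X \<longlonglongrightarrow> u" using Cauchy_convergent convergent_def by blast
  have "bounded_linear \<phi>"
    by (rule bounded_linear_intro[where K = K])
      (use add scal[of "of_real _"] bd in \<open>auto simp: scaleC_of_real scaleR_conv_of_real mult.commute\<close>)
  then have "(\<lambda>n. \<phi> (X n)) \<longlonglongrightarrow> \<phi> u" using u by (rule bounded_linear.tendsto)
  then have uA: "u \<in> A" using X(1) by (simp add: A_def LIMSEQ_const_iff)
  have "(norm u)\<^sup>2 \<le> d"
  proof (rule LIMSEQ_le)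
    show "(\<lambda>n. (norm (X n))\<^sup>2) \<longlonglongrightarrow> (norm u)\<^sup>2" by (intro tendsto_intros u)
    show "(\<lambda>n. d + 1 / real (Suc n)) \<longlonglongrightarrow> d"
      using tendsto_add[OF tendsto_const LIMSEQ_inverse_real_of_nat, of d] by (simp add: inverse_eq_divide)
    show "\<exists>N. \<forall>n\<ge>N. (norm (X n))\<^sup>2 \<le> d + 1 / real (Suc n)" using X(2) less_imp_le by blast
  qed
  then have ud: "(norm u)\<^sup>2 = d" using dle[OF uA] by simp
  have orth: "cinner x u = 0" if "\<phi> x = 0" for x
  proof (cases "x = 0")
    case False
    define c where "c = - cinner u x / of_real ((norm x)\<^sup>2)"
    have "u + c *\<^sub>C x \<in> A" using uA that by (simp add: A_def add scal)
    then have "d \<le> (norm (u + c *\<^sub>C x))\<^sup>2" by (rule dle)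
    also have "\<dots> = d + (cmod c)\<^sup>2 * (norm x)\<^sup>2 + 2 * Re (cnj c * cinner u x)"
      by (simp add: norm_add_sq ud norm_scaleC power_mult_distrib cinner_simps)
    also have "cnj c * cinner u x = - of_real ((cmod (cinner u x))\<^sup>2 / (norm x)\<^sup>2)"
      using complex_norm_square[of "cinner u x"] by (simp add: c_def mult.commute)
    also have "(cmod c)\<^sup>2 * (norm x)\<^sup>2 = (cmod (cinner u x))\<^sup>2 / (norm x)\<^sup>2"
      using False by (simp add: c_def norm_divide power_divide power2_eq_square norm_mult)
    finally have "(cmod (cinner u x))\<^sup>2 / (norm x)\<^sup>2 \<le> 0" by simp
    then have "cinner u x = 0" using False by (simp add: divide_le_0_iff)
    then show ?thesis by (metis cinner_commute complex_cnj_zero)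
  qed simp
  have un: "u \<noteq> 0" using uA add[of 0 0] by (auto simp: A_def)
  have "\<phi> x = cinner x ((1 / of_real ((norm u)\<^sup>2)) *\<^sub>C u)" for x
  proof -
    have "\<phi> (x - \<phi> x *\<^sub>C u) = 0" using uA by (simp add: A_def diff scal)
    then have "cinner (x - \<phi> x *\<^sub>C u) u = 0" by (rule orth)
    then have "cinner x u = \<phi> x * of_real ((norm u)\<^sup>2)" by (simp add: cinner_simps cinner_self)
    then show ?thesis using un by (simp add: cinner_simps)
  qed
  then show ?thesis by blast
qed


section \<open>Bounded operators and their quadratic forms\<close>

lemma norm_bop_le:
  assumes "K \<ge> 0" "\<And>x. norm (bop_apply T x) \<le> K * norm x"
  shows "norm T \<le> K"
  using assms by transfer (rule norm_blinfun_bound)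

lemma bop_apply_zero [simp]: "bop_apply T 0 = 0"
  using norm_bop_apply[of T 0] by simp

lemma bop_apply_diff: "bop_apply T (x - y) = bop_apply T x - bop_apply T y"
  using bop_apply_add[of T "x - y" y] by simp

lemma bop_apply_scaleR: "bop_apply T (r *\<^sub>R y) = r *\<^sub>R bop_apply T y"
  using bop_apply_scaleC[of T "of_real r" y] by (simp add: scaleC_of_real)

lemma ex_bop:
  assumes add: "\<And>x y. f (x + y) = f x + f y" and scal: "\<And>c x. f (c *\<^sub>C x) = c *\<^sub>C f x"
    and bd: "\<And>x. norm (f x) \<le> K * norm (x::'a::complex_normed_vector)"
  shows "\<exists>T. \<forall>x. bop_apply T x = f x"
proof -
  have bl: "bounded_linear f"
    by (rule bounded_linear_intro[where K = K])
      (use add scal[of "of_real _"] bd in \<open>auto simp: scaleC_of_real mult.commute\<close>)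
  have "blinfun_apply (blinfun_of_bop (Bop (Blinfun f))) = f"
    using bl scal by (subst Bop_inverse) (auto simp: bounded_linear_Blinfun_apply)
  then show ?thesis by (metis bop_apply.rep_eq)
qed

text \<open>For fixed \<open>x\<close> the value \<open>Tx\<close> is the Riesz representative of \<open>y \<mapsto> cnj (b(x, y))\<close>. Adjoints, weak limits
  and weak integrals are all obtained in this way.\<close>

lemma ex_bop_of_form:
  fixes b :: "'a::chilbert_space \<Rightarrow> 'a \<Rightarrow> complex"
  assumes addl: "\<And>x y z. b (x + y) z = b x z + b y z" and scall: "\<And>c x z. b (c *\<^sub>C x) z = c * b x z"
    and addr: "\<And>x y z. b x (y + z) = b x y + b x z" and scalr: "\<And>c x z. b x (c *\<^sub>C z) = cnj c * b x z"
    and bd: "\<And>x y. cmod (b x y) \<le> K * norm x * norm y"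
  shows "\<exists>T. \<forall>x y. cinner (bop_apply T x) y = b x y"
proof -
  have "\<exists>v. \<forall>y. cnj (b x y) = cinner y v" for x
    by (rule riesz_representation[where K = "K * norm x"]) (simp_all add: addr scalr bd)
  then obtain f where f: "\<And>x y. cnj (b x y) = cinner y (f x)" by metis
  have f': "cinner (f x) y = b x y" for x y
    by (metis f cinner_commute complex_cnj_cnj)
  have "\<exists>T. \<forall>x. bop_apply T x = f x"
  proof (rule ex_bop[where K = K])
    show "f (x + y) = f x + f y" for x y by (rule cinner_eqI) (simp add: cinner_simps f' addl)
    show "f (c *\<^sub>C x) = c *\<^sub>C f x" for c x by (rule cinner_eqI) (simp add: cinner_simps f' scall)
    show "norm (f x) \<le> K * norm x" for x
    proof (cases "f x = 0")
      case True
      have "0 \<le> K * norm x * norm x" using bd[of x x] norm_ge_zero order_trans by blast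
      then show ?thesis using True by (cases "x = 0") (auto simp: zero_le_mult_iff)
    next
      case False
      have "norm (f x) * norm (f x) = cmod (b x (f x))"
        using cinner_self[of "f x"] by (simp add: f' power2_eq_square norm_mult)
      also have "\<dots> \<le> K * norm x * norm (f x)" by (rule bd)
      finally show ?thesis using False by simp
    qed
  qed
  then obtain T where "\<And>x. bop_apply T x = f x" by blast
  then show ?thesis using f' by (intro exI[of _ T]) simp
qed

lemma bop_eq_formI:
  "(\<And>x y. cinner (bop_apply S x) y = cinner (bop_apply T x) (y::'a::complex_inner)) \<Longrightarrow> S = T"
  by (rule bop_eqI, rule cinner_eqI)

lemma bop_eq_quadI:
  "(\<And>x. cinner (bop_apply S x) x = cinner (bop_apply T x) (x::'a::complex_inner)) \<Longrightarrow> S = T"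
  using cinner_bop_eq_0_imp_0[of "S - T"] by (simp add: cinner_diff_left)

lemma polarization:
  fixes T :: "'a::complex_inner bop"
  shows "4 * cinner (bop_apply T x) y =
    cinner (bop_apply T (x + y)) (x + y) - cinner (bop_apply T (x - y)) (x - y)
    + \<i> * cinner (bop_apply T (x + \<i> *\<^sub>C y)) (x + \<i> *\<^sub>C y)
    - \<i> * cinner (bop_apply T (x - \<i> *\<^sub>C y)) (x - \<i> *\<^sub>C y)"
  by (simp add: bop_apply_add bop_apply_diff bop_apply_scaleC cinner_simps algebra_simps)

lemma cmod_form_le: "cmod (cinner (bop_apply T x) y) \<le> norm T * norm x * norm y"
  by (rule order_trans[OF cauchy_schwarz]) (intro mult_right_mono norm_bop_apply norm_ge_zero)

text \<open>The numerical radius controls the norm up to the factor \<open>2\<close>, by polarisation.\<close>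

lemma norm_bop_le_numerical_radius:
  fixes T :: "'a::complex_inner bop"
  assumes q: "\<And>x. cmod (cinner (bop_apply T x) x) \<le> K * (norm x)\<^sup>2"
  shows "norm T \<le> 2 * \<bar>K\<bar>"
proof (rule norm_bop_le)
  have q': "cmod (cinner (bop_apply T x) x) \<le> \<bar>K\<bar> * (norm x)\<^sup>2" for x
    using q[of x] by (smt (verit) mult_right_mono zero_le_power2)
  have form: "cmod (cinner (bop_apply T x) y) \<le> \<bar>K\<bar> * ((norm x)\<^sup>2 + (norm y)\<^sup>2)" for x y
  proof -
    have "4 * cmod (cinner (bop_apply T x) y) = cmod (4 * cinner (bop_apply T x) y)"
      by (simp add: norm_mult)
    also have "\<dots> \<le> cmod (cinner (bop_apply T (x + y)) (x + y)) + cmod (cinner (bop_apply T (x - y)) (x - y))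
      + cmod (cinner (bop_apply T (x + \<i> *\<^sub>C y)) (x + \<i> *\<^sub>C y))
      + cmod (cinner (bop_apply T (x - \<i> *\<^sub>C y)) (x - \<i> *\<^sub>C y))"
      unfolding polarization
      by (intro order_trans[OF norm_triangle_ineq4] order_trans[OF norm_triangle_ineq] add_mono) (simp_all add: norm_mult)
    also have "\<dots> \<le> \<bar>K\<bar> * (norm (x + y))\<^sup>2 + \<bar>K\<bar> * (norm (x - y))\<^sup>2
      + \<bar>K\<bar> * (norm (x + \<i> *\<^sub>C y))\<^sup>2 + \<bar>K\<bar> * (norm (x - \<i> *\<^sub>C y))\<^sup>2"
      by (intro add_mono q')
    also have "\<dots> = \<bar>K\<bar> * ((norm (x + y))\<^sup>2 + (norm (x - y))\<^sup>2) + \<bar>K\<bar> * ((norm (x + \<i> *\<^sub>C y))\<^sup>2 + (norm (x - \<i> *\<^sub>C y))\<^sup>2)"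
      by (simp add: distrib_left)
    also have "\<dots> = 4 * (\<bar>K\<bar> * ((norm x)\<^sup>2 + (norm y)\<^sup>2))"
      unfolding parallelogram_law by (simp add: norm_scaleC algebra_simps)
    finally show ?thesis by simp
  qed
  fix x
  show "norm (bop_apply T x) \<le> 2 * \<bar>K\<bar> * norm x"
  proof (cases "x = 0 \<or> bop_apply T x = 0")
    case False
    define s where "s = norm x / norm (bop_apply T x)"
    have s: "s > 0" using False by (simp add: s_def)
    have "s * (norm (bop_apply T x))\<^sup>2 \<le> \<bar>K\<bar> * ((norm x)\<^sup>2 + (norm (s *\<^sub>R bop_apply T x))\<^sup>2)"
      using form[of x "s *\<^sub>R bop_apply T x"] s
      by (simp add: cinner_simps cinner_self norm_mult norm_power)
    also have "norm (s *\<^sub>R bop_apply T x) = norm x" using False by (simp add: s_def)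
    finally have "norm x * norm (bop_apply T x) \<le> norm x * (2 * \<bar>K\<bar> * norm x)"
      using False by (simp add: s_def power2_eq_square algebra_simps)
    then show ?thesis using False by simp
  qed auto
qed simp

lemma adj_works: "cinner (bop_apply T x) y = cinner x (bop_apply (adj T) (y::'a::chilbert_space))"
proof -
  have "\<exists>S. \<forall>x y. cinner (bop_apply S x) y = cinner x (bop_apply T y)"
    by (rule ex_bop_of_form[where K = "norm T"])
      (use cmod_form_le[of T] in \<open>simp_all add: cinner_simps bop_apply_add bop_apply_scaleC,
       metis cinner_commute complex_mod_cnj mult.commute mult.assoc\<close>)
  then obtain S where S: "\<And>x y. cinner (bop_apply S x) y = cinner x (bop_apply T y)" by blast
  have S': "cinner (bop_apply T x) y = cinner x (bop_apply S y)" for x y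
    using arg_cong[OF S[of y x], of cnj] by (simp flip: cinner_commute)
  have "adj T = S"
    unfolding adj_def
  proof (rule the_equality)
    fix S' assume "\<forall>x y. cinner (bop_apply T x) y = cinner x (bop_apply S' y)"
    then have "cinner x (bop_apply S' y) = cinner x (bop_apply S y)" for x y by (simp flip: S')
    then have "cinner (bop_apply S' y) x = cinner (bop_apply S y) x" for x y
      by (metis cinner_commute)
    then show "S' = S" by (rule bop_eq_formI)
  qed (simp add: S')
  then show ?thesis using S' by simp
qed

lemma adj_works': "cinner (bop_apply (adj T) x) y = cinner x (bop_apply T (y::'a::chilbert_space))"
proof -
  have "cinner (bop_apply (adj T) x) y = cnj (cinner y (bop_apply (adj T) x))" by (rule cinner_commute)
  also have "\<dots> = cnj (cinner (bop_apply T y) x)" by (simp only: adj_works)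
  also have "\<dots> = cinner x (bop_apply T y)" by (rule cinner_commute[symmetric])
  finally show ?thesis .
qed

lemma adj_quad: "cinner (bop_apply (adj T) x) x = cnj (cinner (bop_apply T x) (x::'a::chilbert_space))"
  unfolding adj_works' by (rule cinner_commute)

lemma adj_eqI:
  assumes "\<And>x y. cinner (bop_apply T x) y = cinner x (bop_apply S (y::'a::chilbert_space))"
  shows "adj T = S"
proof (rule bop_eq_formI)
  fix x y
  have "cinner (bop_apply (adj T) x) y = cinner x (bop_apply T y)" by (rule adj_works')
  also have "\<dots> = cnj (cinner (bop_apply T y) x)" by (rule cinner_commute)
  also have "\<dots> = cinner (bop_apply S x) y" unfolding assms by (rule cinner_commute[symmetric])
  finally show "cinner (bop_apply (adj T) x) y = cinner (bop_apply S x) y" .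
qed

lemma adj_adj [simp]: "adj (adj T) = T"
  by (rule adj_eqI) (rule adj_works')

lemma adj_one [simp]: "adj 1 = 1"
  by (rule adj_eqI) simp

lemma adj_add: "adj (S + T) = adj S + adj T"
  by (rule adj_eqI) (simp add: cinner_simps adj_works)

lemma adj_diff: "adj (S - T) = adj S - adj T"
  by (rule adj_eqI) (simp add: cinner_simps adj_works)

lemma adj_scaleC: "adj (c *\<^sub>C T) = cnj c *\<^sub>C adj T"
  by (rule adj_eqI) (simp add: cinner_simps adj_works)

lemma adj_times: "adj (S * T) = adj T * adj S"
  by (rule adj_eqI) (simp add: adj_works)

lemma norm_adj_le: "norm (adj T) \<le> norm T"
proof (rule norm_bop_le)
  fix x
  show "norm (bop_apply (adj T) x) \<le> norm T * norm x"
  proof (cases "bop_apply (adj T) x = 0")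
    case False
    have "norm (bop_apply (adj T) x) * norm (bop_apply (adj T) x)
        = cmod (cinner (bop_apply (adj T) x) (bop_apply (adj T) x))"
      by (simp add: cinner_self power2_eq_square norm_mult)
    also have "\<dots> = cmod (cinner (bop_apply T (bop_apply (adj T) x)) x)"
      by (simp add: adj_works)
    also have "\<dots> \<le> norm T * norm (bop_apply (adj T) x) * norm x" by (rule cmod_form_le)
    finally show ?thesis using False by (simp add: mult.commute)
  qed auto
qed simp

lemma bounded_linear_adj: "bounded_linear (adj :: 'a::chilbert_space bop \<Rightarrow> _)"
  by (rule bounded_linear_intro[where K = 1])
    (use adj_scaleC[of "of_real _"] in \<open>auto simp: adj_add scaleC_of_real norm_adj_le\<close>)

lemma self_adjoint_iff_quad: "T = adj T \<longleftrightarrow> (\<forall>x. Im (cinner (bop_apply T x) (x::'a::chilbert_space)) = 0)"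
proof
  assume "T = adj T"
  then have "cinner (bop_apply T x) x = cnj (cinner (bop_apply T x) x)" for x
    using adj_quad[of T x] by simp
  then show "\<forall>x. Im (cinner (bop_apply T x) x) = 0"
    by (simp add: complex_eq_iff)
next
  assume "\<forall>x. Im (cinner (bop_apply T x) x) = 0"
  then show "T = adj T"
    by (intro bop_eq_quadI) (simp add: adj_quad complex_eq_iff)
qed

lemma Re_bop_quad: "cinner (bop_apply (Re_bop T) x) x = of_real (Re (cinner (bop_apply T x) x))"
  by (simp add: Re_bop_def cinner_simps adj_quad complex_eq_iff)

lemma Im_bop_quad: "cinner (bop_apply (Im_bop T) x) x = of_real (Im (cinner (bop_apply T x) x))"
proof -
  have "1 / (2 * \<i>) * (z - cnj z) = of_real (Im z)" for z
    by (simp add: complex_eq_iff Re_divide Im_divide)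
  then show ?thesis by (simp add: Im_bop_def cinner_simps adj_quad)
qed

lemma bop_ge_0_iff: "0 \<le> T \<longleftrightarrow> (\<forall>x. cinner (bop_apply T x) (x::'a::complex_inner) \<in> \<real>\<^sub>\<ge>\<^sub>0)"
  by (simp add: less_eq_bop_def)

lemma Im_bop_ge_0_iff: "0 \<le> Im_bop T \<longleftrightarrow> (\<forall>x. 0 \<le> Im (cinner (bop_apply T x) x))"
  by (simp add: bop_ge_0_iff Im_bop_quad)

section \<open>Invertibility\<close>

lemma scaleC_times_left: "(a *\<^sub>C S) * T = a *\<^sub>C (S * (T::'a::complex_normed_vector bop))"
  by (rule bop_eqI) simp

lemma scaleC_times_right: "S * (a *\<^sub>C T) = a *\<^sub>C (S * (T::'a::complex_normed_vector bop))"
  by (rule bop_eqI) (simp add: bop_apply_scaleC)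

lemma norm_bop_times: "norm (S * T) \<le> norm S * norm (T::'a::complex_normed_vector bop)"
  by (rule norm_mult_ineq)

lemma norm_bop_one_le: "norm (1::'a::complex_normed_vector bop) \<le> 1"
  by (rule norm_bop_le) auto

lemma bop_invertibleI: "S * T = 1 \<Longrightarrow> T * S = 1 \<Longrightarrow> bop_invertible T"
  unfolding bop_invertible_def by blast

lemma
  assumes "bop_invertible T"
  shows bop_inv_left: "bop_inv T * T = 1" and bop_inv_right: "T * bop_inv T = 1"
  using assms bop_inv_eqI unfolding bop_invertible_def by auto

lemma bop_inv_right_apply: "bop_invertible T \<Longrightarrow> bop_apply T (bop_apply (bop_inv T) x) = x"
  by (metis bop_apply_one bop_apply_times bop_inv_right)

lemma bop_inv_left_apply: "bop_invertible T \<Longrightarrow> bop_apply (bop_inv T) (bop_apply T x) = x"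
  by (metis bop_apply_one bop_apply_times bop_inv_left)

lemma bop_invertible_times:
  assumes "bop_invertible S" "bop_invertible T"
  shows "bop_invertible (S * T)"
proof (rule bop_invertibleI)
  show "(bop_inv T * bop_inv S) * (S * T) = 1" "(S * T) * (bop_inv T * bop_inv S) = 1"
    by (rule bop_eqI, simp add: bop_inv_left_apply bop_inv_right_apply assms)+
qed

lemma bop_invertible_scaleC:
  assumes "bop_invertible T" "c \<noteq> 0"
  shows "bop_invertible (c *\<^sub>C T)"
  by (rule bop_invertibleI[of "inverse c *\<^sub>C bop_inv T"]; rule bop_eqI)
    (simp_all add: assms bop_apply_scaleC scaleC_scaleC bop_inv_left_apply bop_inv_right_apply)

lemma bop_invertible_adj:
  assumes "bop_invertible (T::'a::chilbert_space bop)"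
  shows "bop_invertible (adj T)"
  by (rule bop_invertibleI[of "adj (bop_inv T)"])
    (simp_all add: assms bop_inv_left bop_inv_right flip: adj_times)

lemma bop_invertible_bounded_below:
  assumes "bop_invertible T" "norm (bop_inv T) \<le> K"
  shows "norm x \<le> K * norm (bop_apply T x)"
  by (metis assms bop_inv_left_apply mult_right_mono norm_bop_apply norm_ge_zero order_trans)

lemma norm_bop_inv_le:
  assumes "bop_invertible T" "K \<ge> 0" "\<And>x. norm x \<le> K * norm (bop_apply T x)"
  shows "norm (bop_inv T) \<le> K"
  by (rule norm_bop_le) (use assms(2) assms(3)[of "bop_apply (bop_inv T) _"] in
      \<open>simp_all add: bop_inv_right_apply[OF assms(1)]\<close>)

text \<open>The inverse is the norm limit of the Neumann series \<open>1 + S + S\<^sup>2 + \<dots>\<close>.\<close>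

lemma bop_invertible_one_minus:
  fixes S :: "'a::chilbert_space bop"
  assumes "norm S < 1"
  shows "bop_invertible (1 - S)"
proof -
  have pow: "norm (S ^ n) \<le> norm S ^ n" for n
  proof (induction n)
    case (Suc n)
    have "norm (S * S ^ n) \<le> norm S * norm (S ^ n)" by (rule norm_bop_times)
    also have "\<dots> \<le> norm S * norm S ^ n" by (intro mult_left_mono Suc) auto
    finally show ?case by simp
  qed (simp add: norm_bop_one_le)
  have sm: "summable (\<lambda>n. S ^ n)"
    by (rule summable_comparison_test'[where g = "\<lambda>n. norm S ^ n" and N = 0])
      (use assms pow in \<open>auto intro: summable_geometric\<close>)
  have bl: "bounded_linear (\<lambda>X. S * X)" "bounded_linear (\<lambda>X. X * S)"
    by (rule bounded_linear_mult_right, rule bounded_linear_mult_left)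
  have split: "suminf (\<lambda>n. S ^ n) = 1 + suminf (\<lambda>n. S ^ Suc n)"
    using suminf_split_head[OF sm] by simp
  have "S * suminf (\<lambda>n. S ^ n) = suminf (\<lambda>n. S ^ Suc n)"
    using bounded_linear.suminf[OF bl(1) sm] by simp
  moreover have "suminf (\<lambda>n. S ^ n) * S = suminf (\<lambda>n. S ^ Suc n)"
    using bounded_linear.suminf[OF bl(2) sm] by (simp add: power_commutes)
  ultimately show ?thesis
    by (intro bop_invertibleI[of "suminf (\<lambda>n. S ^ n)"]) (simp_all add: algebra_simps split)
qed

lemma bop_invertible_perturb:
  fixes T :: "'a::chilbert_space bop"
  assumes T: "bop_invertible T" and H: "norm H * norm (bop_inv T) < 1"
  shows "bop_invertible (T + H)"
proof -
  have "norm (- (H * bop_inv T)) < 1"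
    using norm_bop_times[of H "bop_inv T"] H by simp
  from bop_invertible_one_minus[OF this] have "bop_invertible ((1 + H * bop_inv T) * T)"
    by (intro bop_invertible_times T) simp
  also have "(1 + H * bop_inv T) * T = T + H"
    by (simp add: distrib_right mult.assoc bop_inv_left[OF T])
  finally show ?thesis .
qed

lemma bop_inv_diff:
  assumes "bop_invertible S" "bop_invertible T"
  shows "bop_inv S - bop_inv T = bop_inv S * (T - S) * bop_inv T"
  using assms by (simp add: right_diff_distrib left_diff_distrib mult.assoc bop_inv_left bop_inv_right)

text \<open>The bound on the inverse comes from \<open>\<parallel>x\<parallel> \<le> K \<parallel>Tx\<parallel> \<le> K \<parallel>Sx\<parallel> + \<parallel>x\<parallel>/2\<close>.\<close>

lemma bop_inv_near:
  fixes T :: "'a::chilbert_space bop"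
  assumes T: "bop_invertible T" and K: "norm (bop_inv T) \<le> K" "0 < K" and H: "norm (S - T) \<le> 1 / (2 * K)"
  shows "bop_invertible S" "norm (bop_inv S) \<le> 2 * K"
proof -
  have KH: "norm (S - T) * K \<le> 1 / 2" using H K by (simp add: field_simps)
  have "norm (S - T) * norm (bop_inv T) \<le> norm (S - T) * K"
    by (intro mult_left_mono K) auto
  then have "bop_invertible (T + (S - T))"
    using KH by (intro bop_invertible_perturb T) linarith
  then show S: "bop_invertible S" by simp
  show "norm (bop_inv S) \<le> 2 * K"
  proof (rule norm_bop_inv_le[OF S])
    fix x
    have "norm x \<le> K * norm (bop_apply T x)" by (rule bop_invertible_bounded_below[OF T K(1)])
    also have "bop_apply T x = bop_apply S x - bop_apply (S - T) x" by simp
    also have "norm \<dots> \<le> norm (bop_apply S x) + norm (S - T) * norm x"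
      by (rule order_trans[OF norm_triangle_ineq4]) (intro add_mono order_refl norm_bop_apply)
    also have "K * \<dots> = K * norm (bop_apply S x) + (norm (S - T) * K) * norm x"
      by (simp add: algebra_simps)
    also have "\<dots> \<le> K * norm (bop_apply S x) + 1 / 2 * norm x"
      by (intro add_mono mult_right_mono KH) auto
    finally show "norm x \<le> 2 * K * norm (bop_apply S x)" using K(2) by simp
  qed (use K in auto)
qed


section \<open>Dissipative operators\<close>

definition dissipative :: "'a::complex_inner bop \<Rightarrow> bool"
  where "dissipative T \<longleftrightarrow> (\<forall>x. 0 \<le> Im (cinner (bop_apply T x) x))"

lemma dissipative_add_scalar:
  "dissipative T \<Longrightarrow> Im c \<ge> 0 \<Longrightarrow> dissipative (T + c *\<^sub>C 1)"
  by (auto simp: dissipative_def cinner_simps cinner_self)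

text \<open>The cross term of \<open>\<parallel>Tx + i\<eta>x\<parallel>\<^sup>2\<close> is \<open>2\<eta> Im \<langle>Tx, x\<rangle> \<ge> 0\<close>.\<close>

lemma dissipative_norm_add:
  assumes "dissipative T" "\<eta> \<ge> 0"
  shows "(norm (bop_apply T x))\<^sup>2 + \<eta>\<^sup>2 * (norm x)\<^sup>2 \<le> (norm (bop_apply (T + (\<i> * of_real \<eta>) *\<^sub>C 1) x))\<^sup>2"
proof -
  have "0 \<le> \<eta> * Im (cinner (bop_apply T x) x)"
    using assms by (simp add: dissipative_def)
  then show ?thesis
    by (simp add: norm_add_sq norm_scaleC norm_mult power_mult_distrib cinner_simps)
qed

lemma dissipative_lower:
  assumes "dissipative T" "\<eta> \<ge> 0"
  shows "norm (bop_apply T x) \<le> norm (bop_apply (T + (\<i> * of_real \<eta>) *\<^sub>C 1) x)"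
    and "\<eta> * norm x \<le> norm (bop_apply (T + (\<i> * of_real \<eta>) *\<^sub>C 1) x)"
proof -
  have "(norm (bop_apply T x))\<^sup>2 \<le> (norm (bop_apply (T + (\<i> * of_real \<eta>) *\<^sub>C 1) x))\<^sup>2"
    using dissipative_norm_add[OF assms, of x] zero_le_power2[of "\<eta> * norm x"] unfolding power_mult_distrib by linarith
  then show "norm (bop_apply T x) \<le> norm (bop_apply (T + (\<i> * of_real \<eta>) *\<^sub>C 1) x)"
    by (rule power2_le_imp_le) simp
  have "(\<eta> * norm x)\<^sup>2 \<le> (norm (bop_apply (T + (\<i> * of_real \<eta>) *\<^sub>C 1) x))\<^sup>2"
    using dissipative_norm_add[OF assms, of x] zero_le_power2[of "norm (bop_apply T x)"] unfolding power_mult_distrib by linarith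
  then show "\<eta> * norm x \<le> norm (bop_apply (T + (\<i> * of_real \<eta>) *\<^sub>C 1) x)"
    by (rule power2_le_imp_le) simp
qed

text \<open>For large \<open>s\<close> the operator \<open>T + is\<close> is invertible by a Neumann series. As the norm of its
  inverse is at most \<open>1/s\<close>, a single further Neumann series reaches every \<open>\<eta> \<in> (0, 2s)\<close>.\<close>

lemma dissipative_shift_invertible:
  fixes T :: "'a::chilbert_space bop"
  assumes T: "dissipative T" and \<eta>: "\<eta> > 0"
  shows "bop_invertible (T + (\<i> * of_real \<eta>) *\<^sub>C 1)"
proof -
  define s where "s = norm T + \<eta>"
  have s: "s > 0" "s \<ge> \<eta>" "norm T < s" using \<eta> by (auto simp: s_def add_nonneg_pos)
  have one: "bop_invertible (1 :: 'a bop)" by (rule bop_invertibleI[of 1]) auto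
  have "norm (- ((1 / (\<i> * of_real s)) *\<^sub>C T)) < 1"
    using s by (simp add: norm_scaleC norm_mult norm_divide)
  from bop_invertible_one_minus[OF this]
  have "bop_invertible ((\<i> * of_real s) *\<^sub>C (1 + (1 / (\<i> * of_real s)) *\<^sub>C T))"
    using s by (intro bop_invertible_scaleC) auto
  also have "(\<i> * of_real s) *\<^sub>C (1 + (1 / (\<i> * of_real s)) *\<^sub>C T) = T + (\<i> * of_real s) *\<^sub>C 1"
    using s by (simp add: scaleC_add_right scaleC_scaleC)
  finally have I: "bop_invertible (T + (\<i> * of_real s) *\<^sub>C 1)" .
  have "norm (bop_inv (T + (\<i> * of_real s) *\<^sub>C 1)) \<le> 1 / s"
    by (rule norm_bop_inv_le[OF I])
      (use s dissipative_lower(2)[OF T, of s] in \<open>auto simp: field_simps\<close>)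
  moreover have "norm ((\<i> * of_real (\<eta> - s)) *\<^sub>C (1::'a bop)) \<le> s - \<eta>"
  proof -
    have "norm ((\<i> * of_real (\<eta> - s)) *\<^sub>C (1::'a bop)) = (s - \<eta>) * norm (1::'a bop)"
      using s(2) by (simp add: norm_scaleC norm_mult del: of_real_diff)
    also have "\<dots> \<le> (s - \<eta>) * 1" using s by (intro mult_left_mono norm_bop_one_le) auto
    finally show ?thesis by simp
  qed
  ultimately have "norm ((\<i> * of_real (\<eta> - s)) *\<^sub>C (1::'a bop)) * norm (bop_inv (T + (\<i> * of_real s) *\<^sub>C 1)) \<le> (s - \<eta>) * (1 / s)"
    using s by (intro mult_mono) auto
  also have "\<dots> < 1" using s \<eta> by simp
  finally have "bop_invertible (T + (\<i> * of_real s) *\<^sub>C 1 + (\<i> * of_real (\<eta> - s)) *\<^sub>C 1)"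
    by (intro bop_invertible_perturb I)
  then show ?thesis
    by (simp add: add.assoc right_diff_distrib flip: scaleC_add_left)
qed

lemma dissipative_resolvent:
  fixes T :: "'a::chilbert_space bop"
  assumes T: "dissipative T" and l: "Im l > 0"
  shows "bop_invertible (T + l *\<^sub>C 1)" "norm (bop_inv (T + l *\<^sub>C 1)) \<le> 1 / Im l"
proof -
  define S where "S = T + of_real (Re l) *\<^sub>C 1"
  have S: "dissipative S" unfolding S_def by (rule dissipative_add_scalar[OF T]) simp
  have e: "T + l *\<^sub>C 1 = S + (\<i> * of_real (Im l)) *\<^sub>C 1"
    unfolding S_def add.assoc scaleC_add_left[symmetric] by (simp add: complex_eq[symmetric])
  show I: "bop_invertible (T + l *\<^sub>C 1)"
    unfolding e by (rule dissipative_shift_invertible[OF S l])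
  show "norm (bop_inv (T + l *\<^sub>C 1)) \<le> 1 / Im l"
    by (rule norm_bop_inv_le[OF I])
      (use l dissipative_lower(2)[OF S, of "Im l"] in \<open>auto simp: field_simps e\<close>)
qed

lemma dissipative_bounded_below_invertible:
  fixes T :: "'a::chilbert_space bop"
  assumes T: "dissipative T" and c: "c > 0" and lower: "\<And>x. c * norm x \<le> norm (bop_apply T x)"
  shows "bop_invertible T"
proof -
  \<comment> \<open>Invert \<open>T + ic\<close> and step back by \<open>ic\<close>: the inverse has norm at most \<open>1/(c\<surd>2)\<close>.\<close>
  let ?S = "T + (\<i> * of_real c) *\<^sub>C 1"
  have I: "bop_invertible ?S" by (rule dissipative_shift_invertible[OF T c])
  have "norm (bop_inv ?S) \<le> 1 / (sqrt 2 * c)"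
  proof (rule norm_bop_inv_le[OF I])
    fix x
    have "(c * norm x)\<^sup>2 \<le> (norm (bop_apply T x))\<^sup>2"
      by (intro power_mono lower) (use c in auto)
    then have "(sqrt 2 * c * norm x)\<^sup>2 \<le> (norm (bop_apply ?S x))\<^sup>2"
      using dissipative_norm_add[OF T, of c x] c by (simp add: power_mult_distrib)
    then have "sqrt 2 * c * norm x \<le> norm (bop_apply ?S x)"
      by (rule power2_le_imp_le) simp
    then show "norm x \<le> 1 / (sqrt 2 * c) * norm (bop_apply ?S x)"
      using c by (simp add: field_simps)
  qed (use c in auto)
  then have "norm ((- (\<i> * of_real c)) *\<^sub>C (1::'a bop)) * norm (bop_inv ?S) \<le> (c * 1) * (1 / (sqrt 2 * c))"
    using norm_bop_one_le[where 'a = 'a] c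
    by (intro mult_mono) (auto simp: norm_scaleC norm_mult)
  also have "\<dots> < 1" using c by simp
  finally have "bop_invertible (?S + (- (\<i> * of_real c)) *\<^sub>C 1)"
    by (intro bop_invertible_perturb I)
  then show ?thesis by (simp add: scaleC_minus_left)
qed

section \<open>Complex differentiability\<close>

text \<open>The derivatives of the inversion, of the logarithm and of weak integrals with a parameter are
  all obtained from explicit remainders of second order.\<close>

lemma has_derivative_quadratic_remainder:
  assumes D: "bounded_linear D" and d: "d > 0"
    and q: "\<And>y. norm (y - x) < d \<Longrightarrow> norm (f y - f x - D (y - x)) \<le> C * (norm (y - x))\<^sup>2"
  shows "(f has_derivative D) (at x)"
  unfolding has_derivative_at_within
proof (intro conjI D tendstoI)
  fix e :: real assume e: "e > 0"
  define r where "r = min d (e / (\<bar>C\<bar> + 1))"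
  have r: "r > 0" using d e by (simp add: r_def)
  show "\<forall>\<^sub>F y in at x. dist ((f y - f x - D (y - x)) /\<^sub>R norm (y - x)) 0 < e"
    unfolding eventually_at
  proof (intro exI[of _ r] conjI r ballI impI)
    fix y assume "y \<noteq> x \<and> dist y x < r"
    then have y: "norm (y - x) > 0" "norm (y - x) < d" "norm (y - x) < e / (\<bar>C\<bar> + 1)"
      by (auto simp: dist_norm r_def)
    have "norm (f y - f x - D (y - x)) \<le> C * (norm (y - x))\<^sup>2" by (rule q[OF y(2)])
    also have "\<dots> \<le> (\<bar>C\<bar> + 1) * norm (y - x) * norm (y - x)"
      using y(1) by (simp add: power2_eq_square mult_right_mono)
    also have "\<dots> < e * norm (y - x)"
      using y by (intro mult_strict_right_mono) (simp_all add: field_simps)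
    finally have "norm (f y - f x - D (y - x)) / norm (y - x) < e"
      using y(1) by (simp only: pos_divide_less_eq)
    then show "dist ((f y - f x - D (y - x)) /\<^sub>R norm (y - x)) 0 < e"
      by (simp add: divide_inverse mult.commute)
  qed
qed

lemma bounded_linear_scaleC_left: "bounded_linear (\<lambda>h. h *\<^sub>C (D::'a::complex_normed_vector))"
  by (rule bounded_linear_intro[where K = "norm D"])
    (simp_all add: scaleC_add_left norm_scaleC flip: scaleC_scaleC scaleC_of_real scaleR_conv_of_real,
     metis scaleC_of_real scaleC_scaleC scaleR_conv_of_real)

lemma vholomorphic_on_imp_form_holomorphic:
  fixes N :: "complex \<Rightarrow> 'a::complex_inner bop"
  assumes "N vholomorphic_on S"
  shows "(\<lambda>z. cinner (bop_apply (N z) x) y) holomorphic_on S"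
  unfolding holomorphic_on_def field_differentiable_def
proof
  fix z assume "z \<in> S"
  then obtain D where D: "(N has_derivative (\<lambda>h. h *\<^sub>C D)) (at z within S)"
    using assms unfolding vholomorphic_on_def by blast
  have bl: "bounded_linear (\<lambda>T. cinner (bop_apply T x) y)"
    by (rule bounded_linear_intro[where K = "norm x * norm y"])
      (use cmod_form_le[of _ x y] in \<open>auto simp: cinner_simps scaleR_conv_of_real mult.assoc\<close>)
  have "((\<lambda>z. cinner (bop_apply (N z) x) y) has_derivative (\<lambda>h. h * cinner (bop_apply D x) y)) (at z within S)"
    using bounded_linear.has_derivative[OF bl D] by (simp add: cinner_simps)
  then show "\<exists>f'. ((\<lambda>z. cinner (bop_apply (N z) x) y) has_field_derivative f') (at z within S)"
    unfolding has_field_derivative_def by (metis (no_types, lifting) ext mult.commute)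
qed

lemma vholomorphic_on_compose:
  assumes N: "N vholomorphic_on S"
    and G: "\<And>z. z \<in> S \<Longrightarrow> \<exists>G'. (G has_derivative G') (at (N z)) \<and> (\<forall>c H. G' (c *\<^sub>C H) = c *\<^sub>C G' H)"
  shows "(\<lambda>z. G (N z)) vholomorphic_on S"
  unfolding vholomorphic_on_def
proof
  fix z assume z: "z \<in> S"
  obtain D where D: "(N has_derivative (\<lambda>h. h *\<^sub>C D)) (at z within S)"
    using N z unfolding vholomorphic_on_def by blast
  obtain G' where G': "(G has_derivative G') (at (N z))" "\<And>c H. G' (c *\<^sub>C H) = c *\<^sub>C G' H"
    using G[OF z] by blast
  show "\<exists>D. ((\<lambda>z. G (N z)) has_derivative (\<lambda>h. h *\<^sub>C D)) (at z within S)"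
    using has_derivative_compose[OF D G'(1)] by (auto simp: G'(2))
qed

lemma has_derivative_bop_inv:
  fixes T :: "'a::chilbert_space bop"
  assumes T: "bop_invertible T"
  shows "(bop_inv has_derivative (\<lambda>H. - (bop_inv T * H * bop_inv T))) (at T)"
proof -
  define K where "K = norm (bop_inv T) + 1"
  have K: "norm (bop_inv T) \<le> K" "K > 0" by (simp_all add: K_def add_nonneg_pos)
  show ?thesis
  proof (rule has_derivative_quadratic_remainder[where d = "1 / (2 * K)" and C = "2 * K * K * K"])
    show "bounded_linear (\<lambda>H. - (bop_inv T * H * bop_inv T))"
      by (intro bounded_linear_minus bounded_linear_compose[OF bounded_linear_mult_left bounded_linear_mult_right])
    fix S assume S: "norm (S - T) < 1 / (2 * K)"
    note nr = bop_inv_near[OF T K less_imp_le[OF S]]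
    have "bop_inv S - bop_inv T - - (bop_inv T * (S - T) * bop_inv T)
        = - ((bop_inv S - bop_inv T) * (S - T) * bop_inv T)"
      by (subst (1) bop_inv_diff[OF nr(1) T]) (simp add: algebra_simps)
    also have "\<dots> = bop_inv S * (S - T) * bop_inv T * (S - T) * bop_inv T"
      by (subst bop_inv_diff[OF nr(1) T]) (simp add: algebra_simps)
    also have "norm \<dots> \<le> 2 * K * norm (S - T) * K * norm (S - T) * K"
      by (intro order_trans[OF norm_bop_times] mult_mono nr(2) K(1) order_refl mult_nonneg_nonneg norm_ge_zero)
        (use K(2) in auto)
    finally show "norm (bop_inv S - bop_inv T - - (bop_inv T * (S - T) * bop_inv T)) \<le> 2 * K * K * K * (norm (S - T))\<^sup>2"
      by (simp add: power2_eq_square algebra_simps)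
  qed (use K in simp)
qed

lemma vholomorphic_on_bop_inv:
  fixes N :: "complex \<Rightarrow> 'a::chilbert_space bop"
  assumes "N vholomorphic_on S" "\<And>z. z \<in> S \<Longrightarrow> bop_invertible (N z)"
  shows "(\<lambda>z. bop_inv (N z)) vholomorphic_on S"
  using assms(1)
proof (rule vholomorphic_on_compose)
  fix z assume "z \<in> S"
  then show "\<exists>G'. (bop_inv has_derivative G') (at (N z)) \<and> (\<forall>c H. G' (c *\<^sub>C H) = c *\<^sub>C G' H)"
    using has_derivative_bop_inv[OF assms(2)]
    by (intro exI[of _ "\<lambda>H. - (bop_inv (N z) * H * bop_inv (N z))"] conjI)
      (auto simp: scaleC_times_left scaleC_times_right scaleC_minus_right)
qed

lemma vholomorphic_on_add_const:
  assumes "N vholomorphic_on S"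
  shows "(\<lambda>z. N z + T) vholomorphic_on S"
  unfolding vholomorphic_on_def
proof
  fix z assume "z \<in> S"
  then obtain D where "(N has_derivative (\<lambda>h. h *\<^sub>C D)) (at z within S)"
    using assms unfolding vholomorphic_on_def by blast
  from has_derivative_add[OF this has_derivative_const[of T]]
  show "\<exists>D. ((\<lambda>z. N z + T) has_derivative (\<lambda>h. h *\<^sub>C D)) (at z within S)" by auto
qed

lemma vholomorphic_on_scalar: "(\<lambda>z. T + z *\<^sub>C 1) vholomorphic_on S"
  unfolding vholomorphic_on_def
proof (intro ballI exI)
  show "((\<lambda>z. T + z *\<^sub>C 1) has_derivative (\<lambda>h. h *\<^sub>C 1)) (at z within S)" for z
    using has_derivative_add[OF has_derivative_const bounded_linear_imp_has_derivative[OF bounded_linear_scaleC_left]]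
    by simp
qed


section \<open>Invertibility is a property of the whole Nevanlinna function\<close>

text \<open>Harnack's inequality on the unit disc, from the Schwarz lemma applied to the Cayley transform
  \<open>(h - h(0)) / (h + cnj (h(0)))\<close>.\<close>

lemma harnack_disc:
  assumes h: "h holomorphic_on ball 0 1" and pos: "\<And>w. norm w < 1 \<Longrightarrow> 0 \<le> Re (h w)" and w: "norm w < 1"
  shows "(1 - norm w) / (1 + norm w) * Re (h 0) \<le> Re (h w)"
proof (cases "Re (h 0) = 0")
  case True
  then show ?thesis using pos[OF w] by simp
next
  case False
  define a where "a = h 0"
  have a: "Re a > 0" using False pos[of 0] by (simp add: a_def)
  have ne: "h v + cnj a \<noteq> 0" if "norm v < 1" for v
    using pos[OF that] a by (auto simp: complex_eq_iff)
  define s where "s = (\<lambda>v. (h v - a) / (h v + cnj a))"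
  have key: "(cmod (h v + cnj a))\<^sup>2 - (cmod (h v - a))\<^sup>2 = 4 * Re (h v) * Re a" for v
    unfolding cmod_power2 by (simp add: power2_eq_square algebra_simps)
  have sle: "cmod (s v) \<le> 1" if "norm v < 1" for v
  proof -
    have "(cmod (h v - a))\<^sup>2 \<le> (cmod (h v + cnj a))\<^sup>2"
      using key[of v] pos[OF that] a by (smt (verit) mult_nonneg_nonneg)
    then have "cmod (h v - a) \<le> cmod (h v + cnj a)" by (rule power2_le_imp_le) simp
    then show ?thesis using ne[OF that] by (simp add: s_def norm_divide)
  qed
  have hol: "s holomorphic_on ball 0 1"
    unfolding s_def using h ne by (intro holomorphic_intros) auto
  have s0: "s 0 = 0" by (simp add: s_def a_def)
  have slt: "cmod (s v) < 1" if "norm v < 1" for v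
  proof (rule ccontr)
    assume "\<not> cmod (s v) < 1"
    then have sv: "cmod (s v) = 1" using sle[OF that] by simp
    have "s constant_on ball 0 1"
      by (rule maximum_modulus_principle[OF hol, of "ball 0 1" v]) (use that sle sv in auto)
    then obtain c where "\<And>u. u \<in> ball 0 1 \<Longrightarrow> s u = c" unfolding constant_on_def by blast
    from this[of v] this[of 0] show False using that sv s0 by simp
  qed
  have sw: "cmod (s w) \<le> norm w"
    using Schwarz_Lemma(1)[OF hol s0 slt w] by simp
  have d: "cmod (h w - a) = cmod (s w) * cmod (h w + cnj a)"
    using ne[OF w] by (simp add: s_def norm_divide)
  have p: "cmod (h w + cnj a) \<ge> 2 * Re a / (1 + norm w)"
  proof -
    have "2 * Re a = Re ((h w + cnj a) - (h w - a))" by simp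
    also have "\<dots> \<le> cmod ((h w + cnj a) - (h w - a))" by (rule complex_Re_le_cmod)
    also have "\<dots> \<le> cmod (h w + cnj a) + cmod (s w) * cmod (h w + cnj a)"
      unfolding d[symmetric] by (rule norm_triangle_ineq4)
    also have "\<dots> \<le> cmod (h w + cnj a) + norm w * cmod (h w + cnj a)"
      by (intro add_left_mono mult_right_mono sw) auto
    finally show ?thesis by (simp add: field_simps add_pos_nonneg)
  qed
  have "4 * Re (h w) * Re a = (1 - (cmod (s w))\<^sup>2) * (cmod (h w + cnj a))\<^sup>2"
    using key[of w] by (simp add: d power_mult_distrib algebra_simps)
  also have "\<dots> \<ge> (1 - (norm w)\<^sup>2) * (2 * Re a / (1 + norm w))\<^sup>2"
    using sw p w a by (intro mult_mono power_mono diff_mono) (auto simp: power_le_one)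
  also have "(1 - (norm w)\<^sup>2) * (2 * Re a / (1 + norm w))\<^sup>2 = 4 * ((1 - norm w) / (1 + norm w) * Re a) * Re a"
  proof -
    have "1 + norm w \<noteq> 0" by (metis add_nonneg_pos less_irrefl add.commute norm_ge_zero zero_less_one)
    then show ?thesis by (simp add: divide_simps power2_eq_square) (simp add: algebra_simps)
  qed
  finally have "4 * ((1 - norm w) / (1 + norm w) * Re a) \<le> 4 * Re (h w)"
    using a by (rule mult_right_le_imp_le)
  then show ?thesis by (simp add: a_def)
qed

text \<open>The Moebius transformation of the unit disc onto the upper half-plane that maps \<open>0\<close> to \<open>c\<close>.\<close>

definition half_plane_map :: "complex \<Rightarrow> complex \<Rightarrow> complex"
  where "half_plane_map c w = (c - cnj c * w) / (1 - w)"

lemma Im_half_plane_map: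
  assumes "norm w < 1" "Im c > 0"
  shows "Im (half_plane_map c w) > 0"
proof -
  have w: "1 - w \<noteq> 0" using assms by auto
  have "half_plane_map c w = (c - cnj c * w) * cnj (1 - w) / of_real ((cmod (1 - w))\<^sup>2)"
    unfolding half_plane_map_def complex_norm_square using w by simp
  moreover have "Im ((c - cnj c * w) * cnj (1 - w)) = Im c * (1 - (cmod w)\<^sup>2)"
    unfolding cmod_power2 by (simp add: power2_eq_square algebra_simps)
  ultimately have "Im (half_plane_map c w) = Im c * (1 - (cmod w)\<^sup>2) / (cmod (1 - w))\<^sup>2"
    by (metis Im_divide_of_real)
  then show ?thesis using assms w by (simp add: power_less_one_iff)
qed

lemma half_plane_map_inverse:
  assumes "Im c > 0" "Im z > 0"
  shows "cmod ((z - c) / (z - cnj c)) < 1" "half_plane_map c ((z - c) / (z - cnj c)) = z"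
proof -
  have ne: "z - cnj c \<noteq> 0" "c - cnj c \<noteq> 0" using assms by (auto simp: complex_eq_iff)
  have "(cmod (z - cnj c))\<^sup>2 - (cmod (z - c))\<^sup>2 = 4 * Im z * Im c"
    unfolding cmod_power2 by (simp add: power2_eq_square algebra_simps)
  then have "(cmod (z - c))\<^sup>2 < (cmod (z - cnj c))\<^sup>2"
    using mult_pos_pos[OF assms(2,1)] by linarith
  then have "cmod (z - c) < cmod (z - cnj c)" by (rule power2_less_imp_less) simp
  then show "cmod ((z - c) / (z - cnj c)) < 1" using ne by (simp add: norm_divide)
  have "1 - (z - c) / (z - cnj c) = (c - cnj c) / (z - cnj c)" using ne by (simp add: field_simps)
  moreover have "c - cnj c * ((z - c) / (z - cnj c)) = z * (c - cnj c) / (z - cnj c)"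
    using ne by (simp add: field_simps)
  ultimately show "half_plane_map c ((z - c) / (z - cnj c)) = z"
    using ne by (simp add: half_plane_map_def)
qed

lemma holomorphic_half_plane_map: "half_plane_map c holomorphic_on ball 0 1"
  unfolding half_plane_map_def by (intro holomorphic_intros) auto

lemma harnack_half_plane:
  assumes h: "h holomorphic_on \<complex>\<^sub>+" and pos: "\<And>z. Im z > 0 \<Longrightarrow> 0 \<le> Re (h z)"
    and c: "Im c > 0" and z: "Im z > 0"
  shows "(1 - cmod ((z - c) / (z - cnj c))) / (1 + cmod ((z - c) / (z - cnj c))) * Re (h c) \<le> Re (h z)"
proof -
  have hol: "(h \<circ> half_plane_map c) holomorphic_on ball 0 1"
    by (rule holomorphic_on_compose_gen[OF holomorphic_half_plane_map h])
      (auto simp: upper_half_def intro!: Im_half_plane_map c)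
  note hi = half_plane_map_inverse[OF c z]
  have "half_plane_map c 0 = c" by (simp add: half_plane_map_def)
  then show ?thesis
    using harnack_disc[OF hol _ hi(1)] hi(2) pos Im_half_plane_map[OF _ c] by auto
qed

lemma nevanlinna_dissipative:
  assumes "nevanlinna N" "Im z > 0"
  shows "dissipative (N z)"
  using assms unfolding nevanlinna_def dissipative_def upper_half_def Im_bop_ge_0_iff by blast

text \<open>With \<open>R = (N + i)\<^sup>-\<^sup>1\<close> one has \<open>(1 - iR)x = Ny\<close> for \<open>y = Rx\<close>, and
  \<open>u(z) = Re \<langle>(1 - iR(z))x, x\<rangle> = \<parallel>Ny\<parallel>\<^sup>2 + Im \<langle>Ny, y\<rangle>\<close> is a nonnegative harmonic function which is
  bounded below by \<open>\<parallel>Ny\<parallel>\<^sup>2\<close> and above by \<open>\<parallel>Ny\<parallel> \<parallel>x\<parallel>\<close>. Harnack's inequality therefore carries a lower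
  bound for \<open>N\<close> from one point to every other point.\<close>

lemma nevanlinna_invertible_upper:
  fixes N :: "complex \<Rightarrow> 'a::chilbert_space bop"
  assumes N: "nevanlinna N" and z0: "Im z0 > 0" and inv: "bop_invertible (N z0)" and z: "Im z > 0"
  shows "bop_invertible (N z)"
proof -
  define R where "R = (\<lambda>z. bop_inv (N z + \<i> *\<^sub>C 1))"
  have I: "bop_invertible (N z + \<i> *\<^sub>C 1)" if "Im z > 0" for z
    using dissipative_resolvent(1)[OF nevanlinna_dissipative[OF N that], of \<i>] by simp
  have "(\<lambda>z. N z + \<i> *\<^sub>C 1) vholomorphic_on \<complex>\<^sub>+"
    using N by (intro vholomorphic_on_add_const) (simp add: nevanlinna_def)
  then have R: "R vholomorphic_on \<complex>\<^sub>+"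
    unfolding R_def by (rule vholomorphic_on_bop_inv) (simp add: upper_half_def I)
  have Rx: "bop_apply (N z) (bop_apply (R z) x) + \<i> *\<^sub>C bop_apply (R z) x = x" if "Im z > 0" for z x
    using bop_inv_right_apply[OF I[OF that], of x] by (simp add: R_def)
  define h where "h = (\<lambda>x z. of_real ((norm x)\<^sup>2) - \<i> * cinner (bop_apply (R z) x) x)"
  have h1: "h x z = cinner (bop_apply (N z) (bop_apply (R z) x)) x" if "Im z > 0" for x z
    using arg_cong[OF Rx[OF that, of x], of "\<lambda>u. cinner u x"]
    by (simp add: h_def cinner_simps cinner_self flip: of_real_power) (simp add: algebra_simps)
  have h2: "Re (h x z) \<ge> (norm (bop_apply (N z) (bop_apply (R z) x)))\<^sup>2" if "Im z > 0" for x z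
  proof -
    let ?y = "bop_apply (R z) x"
    have "h x z = cinner (bop_apply (N z) ?y) (bop_apply (N z) ?y + \<i> *\<^sub>C ?y)"
      using h1[OF that] Rx[OF that] by simp
    then have "Re (h x z) = (norm (bop_apply (N z) ?y))\<^sup>2 + Im (cinner (bop_apply (N z) ?y) ?y)"
      by (simp add: cinner_simps)
    then show ?thesis using nevanlinna_dissipative[OF N that] by (simp add: dissipative_def)
  qed
  have hhol: "h x holomorphic_on \<complex>\<^sub>+" for x
    unfolding h_def by (intro holomorphic_intros vholomorphic_on_imp_form_holomorphic[OF R])
  define \<theta> where "\<theta> = (1 - cmod ((z - z0) / (z - cnj z0))) / (1 + cmod ((z - z0) / (z - cnj z0)))"
  have \<theta>: "\<theta> > 0"
    using half_plane_map_inverse(1)[OF z0 z] unfolding \<theta>_def by (intro divide_pos_pos) (auto intro: add_pos_nonneg)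
  have hark: "\<theta> * Re (h x z0) \<le> Re (h x z)" for x
    unfolding \<theta>_def
    by (rule harnack_half_plane[OF hhol _ z0 z]) (use h2 zero_le_power2 order_trans in blast)
  define K where "K = (norm (bop_inv (N z0)) + 1) * (norm (N z0) + 1)"
  have K: "K > 0" by (simp add: K_def add_nonneg_pos)
  have low0: "norm x \<le> K * norm (bop_apply (N z0) (bop_apply (R z0) x))" for x
  proof -
    let ?y = "bop_apply (R z0) x"
    have y: "norm ?y \<le> norm (bop_inv (N z0)) * norm (bop_apply (N z0) ?y)"
      by (rule bop_invertible_bounded_below[OF inv order_refl])
    have "norm x \<le> norm (bop_apply (N z0) ?y) + norm (\<i> *\<^sub>C ?y)"
      by (metis Rx[OF z0] norm_triangle_ineq)
    also have "\<dots> \<le> (norm (bop_inv (N z0)) + 1) * norm (bop_apply (N z0) ?y)"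
      using y by (simp add: norm_scaleC algebra_simps)
    also have "\<dots> \<le> K * norm (bop_apply (N z0) ?y)"
      unfolding K_def by (intro mult_right_mono) (auto simp: algebra_simps add_increasing)
    finally show ?thesis .
  qed
  have low: "(\<theta> / K\<^sup>2) * norm y \<le> norm (bop_apply (N z) y)" for y
  proof -
    define x where "x = bop_apply (N z + \<i> *\<^sub>C 1) y"
    have yx: "bop_apply (R z) x = y" unfolding x_def R_def by (rule bop_inv_left_apply[OF I[OF z]])
    have xy: "norm y \<le> norm x"
      using dissipative_lower(2)[OF nevanlinna_dissipative[OF N z], of 1 y] by (simp add: x_def)
    have "(norm x)\<^sup>2 \<le> (K * norm (bop_apply (N z0) (bop_apply (R z0) x)))\<^sup>2"
      by (intro power_mono low0) simp
    also have "\<dots> \<le> K\<^sup>2 * Re (h x z0)"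
      unfolding power_mult_distrib by (intro mult_left_mono h2 z0) simp
    finally have "\<theta> * (norm x)\<^sup>2 \<le> K\<^sup>2 * (\<theta> * Re (h x z0))"
      using \<theta> by (simp add: mult.left_commute)
    also have "\<dots> \<le> K\<^sup>2 * Re (h x z)" by (intro mult_left_mono hark) simp
    also have "K\<^sup>2 * Re (h x z) \<le> K\<^sup>2 * (norm (bop_apply (N z) y) * norm x)"
      unfolding h1[OF z] yx by (intro mult_left_mono order_trans[OF complex_Re_le_cmod cauchy_schwarz]) simp
    finally have "\<theta> * (norm x)\<^sup>2 \<le> K\<^sup>2 * (norm (bop_apply (N z) y) * norm x)" by simp
    then have "(\<theta> / K\<^sup>2) * norm x * norm x \<le> norm (bop_apply (N z) y) * norm x"
      using K by (simp add: field_simps power2_eq_square)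
    then have "norm x = 0 \<or> (\<theta> / K\<^sup>2) * norm x \<le> norm (bop_apply (N z) y)"
      using mult_right_le_imp_le[of "(\<theta> / K\<^sup>2) * norm x" "norm x"] by (cases "x = 0") auto
    moreover have "(\<theta> / K\<^sup>2) * norm y \<le> (\<theta> / K\<^sup>2) * norm x"
      using \<theta> K xy by (intro mult_left_mono) auto
    ultimately show ?thesis using xy by auto
  qed
  show ?thesis
    by (rule dissipative_bounded_below_invertible[OF nevanlinna_dissipative[OF N z] _ low])
      (use \<theta> K in auto)
qed

lemma nevanlinna_invertible:
  fixes N :: "complex \<Rightarrow> 'a::chilbert_space bop"
  assumes N: "nevanlinna N" and z0: "z0 \<notin> \<real>" "bop_invertible (N z0)" and z: "z \<notin> \<real>"
  shows "bop_invertible (N z)"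
proof -
  have refl: "bop_invertible (N w) \<longleftrightarrow> bop_invertible (N (cnj w))" if "Im w < 0" for w
  proof -
    have "N w = adj (N (cnj w))" using N that by (simp add: nevanlinna_def lower_half_def)
    then show ?thesis by (metis adj_adj bop_invertible_adj)
  qed
  have *: "Im w < 0 \<or> Im w > 0" if "w \<notin> \<real>" for w
    using that by (auto simp: complex_is_Real_iff)
  obtain w0 where "Im w0 > 0" "bop_invertible (N w0)"
    using *[OF z0(1)] z0(2) refl[of z0] by (metis cnj.sel(2) neg_0_less_iff_less)
  then have "bop_invertible (N w)" if "Im w > 0" for w
    using nevanlinna_invertible_upper[OF N] that by blast
  then show ?thesis using *[OF z] refl[of z] by auto
qed

section \<open>The operator logarithm\<close>

text \<open>The truncated integrals form a Cauchy family, because those of the bound do. The limit of the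
  truncations is the form in which the integral over the half-line is used for \<open>log T\<close>.\<close>

lemma improper_integral:
  fixes f :: "real \<Rightarrow> 'a::banach"
  assumes cont: "continuous_on {0..} f" and bd: "\<And>t. t \<ge> 0 \<Longrightarrow> norm (f t) \<le> K / (1 + t)\<^sup>2"
  shows "f integrable_on {0..}"
    and "((\<lambda>A. integral {0..A} f) \<longlongrightarrow> integral {0..} f) at_top"
    and "norm (integral {0..} f) \<le> K"
proof -
  define F where "F = (\<lambda>A. integral {0..A} f)"
  have int: "f integrable_on {a..b}" if "0 \<le> a" for a b
    by (rule integrable_continuous_interval) (use that in \<open>auto intro: continuous_on_subset[OF cont]\<close>)
  have "0 \<le> norm (f 0)" by simp
  then have K: "K \<ge> 0" using bd[of 0] by (metis add_0_right div_by_1 le_zero_eq order_refl order_trans one_power2)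
  have step: "norm (F B - F A) \<le> K / (1 + A) - K / (1 + B)" if "0 \<le> A" "A \<le> B" for A B
  proof -
    have "F A + integral {A..B} f = F B"
      unfolding F_def by (rule Henstock_Kurzweil_Integration.integral_combine) (use that int in auto)
    then have "F B - F A = integral {A..B} f" by (simp add: algebra_simps)
    also have "norm \<dots> \<le> integral {A..B} (\<lambda>t. K / (1 + t)\<^sup>2)"
    proof (rule integral_norm_bound_integral)
      show "(\<lambda>t. K / (1 + t)\<^sup>2) integrable_on {A..B}"
        by (rule integrable_continuous_interval) (use that in \<open>auto intro!: continuous_intros\<close>)
    qed (use that int bd in auto)
    also have "\<dots> = - K / (1 + B) - (- K / (1 + A))"
      by (rule integral_unique, rule fundamental_theorem_of_calculus[OF that(2)])
        (use that in \<open>auto intro!: derivative_eq_intros simp: power2_eq_square divide_simps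
           simp flip: has_real_derivative_iff_has_vector_derivative\<close>)
    finally show ?thesis by simp
  qed
  have step': "norm (F B - F A) \<le> K / (1 + A)" if "0 \<le> A" "A \<le> B" for A B
    using step[OF that] that K by (smt (verit) divide_nonneg_nonneg)
  have tail: "(\<lambda>n. K / (1 + real n)) \<longlonglongrightarrow> 0" by real_asymp
  have "Cauchy (\<lambda>n. F (real n))"
  proof (rule metric_CauchyI)
    fix e :: real assume "e > 0"
    then obtain M where M: "\<And>n. n \<ge> M \<Longrightarrow> K / (1 + real n) < e"
      using order_tendstoD(2)[OF tail] unfolding eventually_sequentially by blast
    have "dist (F (real m)) (F (real n)) < e" if "M \<le> m" "M \<le> n" for m n
    proof (cases "m \<le> n")
      case True
      then show ?thesis using step'[of "real m" "real n"] M[OF that(1)] by (simp add: dist_norm norm_minus_commute)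
    next
      case False
      then show ?thesis using step'[of "real n" "real m"] M[OF that(2)] by (simp add: dist_norm)
    qed
    then show "\<exists>M. \<forall>m\<ge>M. \<forall>n\<ge>M. dist (F (real m)) (F (real n)) < e" by blast
  qed
  then obtain l where l: "(\<lambda>n. F (real n)) \<longlonglongrightarrow> l" using Cauchy_convergent convergent_def by blast
  have lA: "norm (l - F A) \<le> K / (1 + A)" if "0 \<le> A" for A
  proof (rule LIMSEQ_le_const2)
    show "(\<lambda>n. norm (F (real n) - F A)) \<longlonglongrightarrow> norm (l - F A)" by (intro tendsto_intros l)
    show "\<exists>N. \<forall>n\<ge>N. norm (F (real n) - F A) \<le> K / (1 + A)"
    proof (intro exI allI impI)
      fix n assume "nat \<lceil>A\<rceil> \<le> n"
      then have "A \<le> real n" by linarith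
      then show "norm (F (real n) - F A) \<le> K / (1 + A)" by (rule step'[OF that])
    qed
  qed
  have lim: "(F \<longlongrightarrow> l) at_top"
  proof (rule Lim_null_comparison[where g = "\<lambda>A. K / (1 + A)", THEN LIM_zero_cancel])
    show "\<forall>\<^sub>F A in at_top. norm (F A - l) \<le> K / (1 + A)"
      using eventually_ge_at_top[of 0] by eventually_elim (metis lA norm_minus_commute)
    show "((\<lambda>A::real. K / (1 + A)) \<longlongrightarrow> 0) at_top" by real_asymp
  qed
  have "(f has_integral l) {0..}"
    unfolding has_integral_alt'
  proof (intro conjI allI impI)
    fix a b :: real
    have eq: "{0..} \<inter> {a..b} = {max 0 a..b}" by auto
    show "(\<lambda>x. if x \<in> {0..} then f x else 0) integrable_on cbox a b"
      unfolding integrable_restrict_Int box_real eq by (rule int) simp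
  next
    fix e :: real assume e: "e > 0"
    have "\<forall>\<^sub>F A in at_top. norm (F A - l) < e"
      using tendstoD[OF lim e] by (simp add: dist_norm)
    then obtain B where B: "\<And>A. A \<ge> B \<Longrightarrow> norm (F A - l) < e"
      unfolding eventually_at_top_linorder by blast
    show "\<exists>B>0. \<forall>a b. ball 0 B \<subseteq> cbox a b \<longrightarrow>
      norm (integral (cbox a b) (\<lambda>x. if x \<in> {0..} then f x else 0) - l) < e"
    proof (intro exI[of _ "2 * (\<bar>B\<bar> + 1)"] conjI allI impI)
      fix a b :: real assume sub: "ball 0 (2 * (\<bar>B\<bar> + 1)) \<subseteq> cbox a b"
      have "\<bar>B\<bar> + 1 \<in> cbox a b" "- 1 \<in> cbox a b"
        by (rule subsetD[OF sub], simp)+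
      then have ab: "a \<le> 0" "b \<ge> B" by auto
      then have eq: "{0..} \<inter> {a..b} = {0..b}" by auto
      show "norm (integral (cbox a b) (\<lambda>x. if x \<in> {0..} then f x else 0) - l) < e"
        unfolding integral_restrict_Int box_real eq using B[OF ab(2)] by (simp add: F_def)
    qed auto
  qed
  then show "f integrable_on {0..}" and eq: "((\<lambda>A. integral {0..A} f) \<longlongrightarrow> integral {0..} f) at_top"
    and "norm (integral {0..} f) \<le> K"
    using lim lA[of 0] by (auto simp: integral_unique F_def)
qed

definition axis_resolvent :: "'a::complex_normed_vector bop \<Rightarrow> real \<Rightarrow> 'a bop"
  where "axis_resolvent T t = bop_inv (T + (\<i> * of_real t) *\<^sub>C 1)"

text \<open>This bound makes the integral of \<open>log T\<close> converge, and unlike dissipativity it is stable under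
  small perturbations of \<open>T\<close>, as differentiation of the logarithm requires.\<close>

definition axis_resolvent_bound :: "'a::complex_normed_vector bop \<Rightarrow> real \<Rightarrow> bool"
  where "axis_resolvent_bound T K \<longleftrightarrow> K > 0 \<and> (\<forall>t\<ge>0. bop_invertible (T + (\<i> * of_real t) *\<^sub>C 1) \<and>
    norm (axis_resolvent T t) \<le> K / (1 + t))"

text \<open>\<open>\<parallel>(T + it)x\<parallel>\<close> dominates both \<open>\<parallel>Tx\<parallel>\<close>, which settles small \<open>t\<close>, and \<open>t \<parallel>x\<parallel>\<close>, which settles large \<open>t\<close>.\<close>

lemma dissipative_axis_resolvent_bound:
  fixes T :: "'a::chilbert_space bop"
  assumes T: "dissipative T" and inv: "bop_invertible T"
  shows "axis_resolvent_bound T (norm (bop_inv T) + 1)"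
  unfolding axis_resolvent_bound_def
proof (intro conjI allI impI)
  fix t :: real assume t: "t \<ge> 0"
  show I: "bop_invertible (T + (\<i> * of_real t) *\<^sub>C 1)"
    using dissipative_shift_invertible[OF T] inv t by (cases "t = 0") auto
  show "norm (axis_resolvent T t) \<le> (norm (bop_inv T) + 1) / (1 + t)"
    unfolding axis_resolvent_def
  proof (rule norm_bop_inv_le[OF I])
    fix x
    have "norm x \<le> norm (bop_inv T) * norm (bop_apply T x)"
      by (rule bop_invertible_bounded_below[OF inv order_refl])
    also have "\<dots> \<le> norm (bop_inv T) * norm (bop_apply (T + (\<i> * of_real t) *\<^sub>C 1) x)"
      by (intro mult_left_mono dissipative_lower(1)[OF T t]) simp
    finally have "(1 + t) * norm x \<le> (norm (bop_inv T) + 1) * norm (bop_apply (T + (\<i> * of_real t) *\<^sub>C 1) x)"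
      using dissipative_lower(2)[OF T t, of x] unfolding distrib_right by linarith
    then show "norm x \<le> (norm (bop_inv T) + 1) / (1 + t) * norm (bop_apply (T + (\<i> * of_real t) *\<^sub>C 1) x)"
      using t by (simp add: field_simps)
  qed (use t in auto)
qed (simp add: add_nonneg_pos)

lemma axis_resolvent_bound_near:
  fixes T :: "'a::chilbert_space bop"
  assumes T: "axis_resolvent_bound T K" and H: "norm (S - T) \<le> 1 / (2 * K)"
  shows "axis_resolvent_bound S (2 * K)"
  unfolding axis_resolvent_bound_def
proof (intro conjI allI impI)
  have K: "K > 0" using T by (simp add: axis_resolvent_bound_def)
  then show "2 * K > 0" by simp
  fix t :: real assume t: "t \<ge> 0"
  have "1 / (2 * K) \<le> 1 / (2 * (K / (1 + t)))" using K t by (simp add: field_simps)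
  then have "norm (S + (\<i> * of_real t) *\<^sub>C 1 - (T + (\<i> * of_real t) *\<^sub>C 1)) \<le> 1 / (2 * (K / (1 + t)))"
    using H by simp
  moreover have "bop_invertible (T + (\<i> * of_real t) *\<^sub>C 1)"
    "norm (bop_inv (T + (\<i> * of_real t) *\<^sub>C 1)) \<le> K / (1 + t)" "0 < K / (1 + t)"
    using T t by (auto simp: axis_resolvent_bound_def axis_resolvent_def)
  ultimately show "bop_invertible (S + (\<i> * of_real t) *\<^sub>C 1)" "norm (axis_resolvent S t) \<le> 2 * K / (1 + t)"
    unfolding axis_resolvent_def times_divide_eq_right[symmetric] by - (rule bop_inv_near; assumption)+
qed

lemma continuous_on_axis_resolvent:
  fixes T :: "'a::chilbert_space bop"
  assumes T: "axis_resolvent_bound T K"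
  shows "continuous_on {0..} (axis_resolvent T)"
  unfolding axis_resolvent_def
proof (rule continuous_on_compose2[where g = bop_inv and t = "{T. bop_invertible T}"])
  show "continuous_on {T. bop_invertible T} (bop_inv :: 'a bop \<Rightarrow> _)"
    by (intro continuous_at_imp_continuous_on ballI has_derivative_continuous[OF has_derivative_bop_inv]) simp
  have "continuous_on {0..} (\<lambda>t. (\<i> * of_real t) *\<^sub>C (1 :: 'a bop))"
    by (rule bounded_linear.continuous_on[OF bounded_linear_scaleC_left]) (intro continuous_intros)
  then show "continuous_on {0..} (\<lambda>t. T + (\<i> * of_real t) *\<^sub>C 1)" by (intro continuous_intros)
qed (use T in \<open>auto simp: axis_resolvent_bound_def\<close>)

lemma cmod_one_plus_i_times_ge: "t \<ge> 0 \<Longrightarrow> (1 + t) / 2 \<le> cmod (1 + \<i> * of_real t)"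
  using abs_Re_le_cmod[of "1 + \<i> * of_real t"] abs_Im_le_cmod[of "1 + \<i> * of_real t"] by simp

definition log_integrand :: "'a::complex_normed_vector bop \<Rightarrow> real \<Rightarrow> 'a bop"
  where "log_integrand T t = axis_resolvent T t - (1 / (1 + \<i> * of_real t)) *\<^sub>C 1"

lemma log_bop_eq: "log_bop T = (- \<i>) *\<^sub>C integral {0..} (log_integrand T)"
  unfolding log_bop_def log_integrand_def axis_resolvent_def ..

text \<open>The integrand equals \<open>(1 + it)\<^sup>-\<^sup>1 (T + it)\<^sup>-\<^sup>1 (1 - T)\<close>.\<close>

lemma log_integrand_bound:
  fixes T :: "'a::chilbert_space bop"
  assumes T: "axis_resolvent_bound T K" and t: "t \<ge> 0"
  shows "norm (log_integrand T t) \<le> 2 * K * norm (1 - T) / (1 + t)\<^sup>2"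
proof -
  let ?c = "1 + \<i> * complex_of_real t"
  have c: "?c \<noteq> 0" by (auto simp: complex_eq_iff)
  have I: "axis_resolvent T t * (T + (\<i> * of_real t) *\<^sub>C 1) = 1"
    unfolding axis_resolvent_def using T t by (intro bop_inv_left) (auto simp: axis_resolvent_bound_def)
  have "axis_resolvent T t * (1 - T) = axis_resolvent T t * (?c *\<^sub>C 1 - (T + (\<i> * of_real t) *\<^sub>C 1))"
    by (simp add: scaleC_add_left)
  also have "\<dots> = ?c *\<^sub>C axis_resolvent T t - 1"
    by (simp add: right_diff_distrib I scaleC_times_right)
  finally have "log_integrand T t = (1 / ?c) *\<^sub>C (axis_resolvent T t * (1 - T))"
    using c by (simp add: log_integrand_def scaleC_diff_right scaleC_scaleC)
  also have "norm \<dots> \<le> (2 / (1 + t)) * ((K / (1 + t)) * norm (1 - T))"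
    unfolding norm_scaleC
  proof (intro mult_mono order_trans[OF norm_bop_times])
    have "0 < cmod ?c" using c by simp
    then show "cmod (1 / ?c) \<le> 2 / (1 + t)"
      using cmod_one_plus_i_times_ge[OF t] t by (simp add: norm_divide field_simps)
  qed (use T t in \<open>auto simp: axis_resolvent_bound_def\<close>)
  finally show ?thesis by (simp add: power2_eq_square)
qed

lemma
  fixes T :: "'a::chilbert_space bop"
  assumes T: "axis_resolvent_bound T K"
  shows log_integrand_integrable: "log_integrand T integrable_on {0..}"
    and log_integrand_limit: "((\<lambda>A. integral {0..A} (log_integrand T)) \<longlongrightarrow> integral {0..} (log_integrand T)) at_top"
    and continuous_on_log_integrand: "continuous_on {0..} (log_integrand T)"
proof -
  have "continuous_on {0..} (\<lambda>t. (1 / (1 + \<i> * of_real t)) *\<^sub>C (1 :: 'a bop))"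
    by (rule bounded_linear.continuous_on[OF bounded_linear_scaleC_left])
      (intro continuous_intros, auto simp: complex_eq_iff)
  then show *: "continuous_on {0..} (log_integrand T)"
    unfolding log_integrand_def by (intro continuous_intros continuous_on_axis_resolvent[OF T])
  show "log_integrand T integrable_on {0..}"
    "((\<lambda>A. integral {0..A} (log_integrand T)) \<longlongrightarrow> integral {0..} (log_integrand T)) at_top"
    by (rule improper_integral[OF * log_integrand_bound[OF T]], assumption)+
qed

text \<open>The derivative of the logarithm at \<open>T\<close> in the direction \<open>H\<close> is
  \<open>i \<integral>\<^sub>0\<^sup>\<infinity> (T + it)\<^sup>-\<^sup>1 H (T + it)\<^sup>-\<^sup>1 dt\<close>; applying the resolvent identity twice exhibits the remainder
  as an integral of order \<open>\<parallel>H\<parallel>\<^sup>2\<close>.\<close>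

lemma has_derivative_log_bop:
  fixes T :: "'a::chilbert_space bop"
  assumes T: "axis_resolvent_bound T K"
  shows "\<exists>D. (log_bop has_derivative D) (at T) \<and> (\<forall>c H. D (c *\<^sub>C H) = c *\<^sub>C D H)"
proof -
  have K: "K > 0" using T by (simp add: axis_resolvent_bound_def)
  let ?R = "axis_resolvent"
  have Rb: "norm (?R T t) \<le> K / (1 + t)" if "t \<ge> 0" for t
    using T that by (simp add: axis_resolvent_bound_def)
  define G where "G = (\<lambda>H t. ?R T t * H * ?R T t)"
  have Gc: "continuous_on {0..} (G H)" for H
    unfolding G_def by (intro continuous_intros continuous_on_axis_resolvent[OF T])
  have Gb: "norm (G H t) \<le> (K\<^sup>2 * norm H) / (1 + t)\<^sup>2" if "t \<ge> 0" for H t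
  proof -
    have "norm (G H t) \<le> (K / (1 + t)) * norm H * (K / (1 + t))"
      unfolding G_def
      by (intro order_trans[OF norm_bop_times] mult_mono Rb that order_refl mult_nonneg_nonneg norm_ge_zero)
        (use K that in auto)
    then show ?thesis by (simp add: power2_eq_square mult_ac)
  qed
  note Gi = improper_integral[OF Gc Gb]
  define D where "D = (\<lambda>H. \<i> *\<^sub>C integral {0..} (G H))"
  have Dc: "D (c *\<^sub>C H) = c *\<^sub>C D H" for c H
  proof -
    have "G (c *\<^sub>C H) = (\<lambda>t. c *\<^sub>C G H t)"
      by (simp add: G_def scaleC_times_left scaleC_times_right)
    then show ?thesis
      using integral_linear[OF Gi(1)[of H] bounded_linear_scaleC[of c]]
      by (simp add: D_def o_def scaleC_scaleC mult.commute)
  qed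
  have "bounded_linear D"
  proof (rule bounded_linear_intro[where K = "K\<^sup>2"])
    fix H H'
    have "G (H + H') = (\<lambda>t. G H t + G H' t)" by (simp add: G_def algebra_simps)
    then show "D (H + H') = D H + D H'"
      by (simp add: D_def integral_add[OF Gi(1) Gi(1)] scaleC_add_right)
    show "D (r *\<^sub>R H) = r *\<^sub>R D H" for r using Dc[of "of_real r" H] by (simp add: scaleC_of_real)
    show "norm (D H) \<le> norm H * K\<^sup>2" using Gi(3)[of H] by (simp add: D_def norm_scaleC mult.commute)
  qed
  then have "(log_bop has_derivative D) (at T)"
  proof (rule has_derivative_quadratic_remainder[where d = "1 / (2 * K)" and C = "2 * K * K * K"])
    fix S assume "norm (S - T) < 1 / (2 * K)"
    then have S: "axis_resolvent_bound S (2 * K)"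
      by (intro axis_resolvent_bound_near[OF T]) simp
    define H where "H = S - T"
    define E where "E = (\<lambda>t. ?R S t * H * ?R T t * H * ?R T t)"
    have RSb: "norm (?R S t) \<le> 2 * K / (1 + t)" if "t \<ge> 0" for t
      using S that by (simp add: axis_resolvent_bound_def)
    have Rdiff: "?R S t - ?R T t = - (?R S t * H * ?R T t)" if "t \<ge> 0" for t
      unfolding axis_resolvent_def H_def using S T that
      by (subst bop_inv_diff) (auto simp: axis_resolvent_bound_def algebra_simps)
    have eqE: "log_integrand S t - log_integrand T t + G H t = E t" if "t \<ge> 0" for t
    proof -
      have "log_integrand S t - log_integrand T t + G H t = - (?R S t * H * ?R T t) + G H t"
        using Rdiff[OF that] by (simp add: log_integrand_def)
      also have "\<dots> = - ((?R S t - ?R T t) * H * ?R T t)" by (simp add: G_def algebra_simps)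
      finally show ?thesis by (simp add: Rdiff[OF that] E_def mult.assoc)
    qed
    have Eb: "norm (E t) \<le> (2 * K * K * K * (norm H)\<^sup>2) / (1 + t)\<^sup>2" if t: "t \<ge> 0" for t
    proof -
      have "norm (E t) \<le> (2 * K / (1 + t)) * norm H * (K / (1 + t)) * norm H * K"
        unfolding E_def
      proof (intro order_trans[OF norm_bop_times] mult_mono Rb RSb t order_refl mult_nonneg_nonneg norm_ge_zero)
        have "K / (1 + t) \<le> K / 1" using K t by (intro divide_left_mono) auto
        then show "norm (?R T t) \<le> K" using Rb[OF t] by simp
      qed (use K t in auto)
      then show ?thesis by (simp add: power2_eq_square algebra_simps)
    qed
    have "continuous_on {0..} E"
      unfolding E_def by (intro continuous_intros continuous_on_axis_resolvent[OF T] continuous_on_axis_resolvent[OF S])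
    note Ei = improper_integral[OF this Eb]
    have "integral {0..} E = integral {0..} (\<lambda>t. log_integrand S t - log_integrand T t + G H t)"
      by (rule integral_cong) (simp add: eqE)
    also have "\<dots> = integral {0..} (log_integrand S) - integral {0..} (log_integrand T) + integral {0..} (G H)"
      by (simp add: integral_add integral_diff integrable_diff Gi(1) log_integrand_integrable[OF S] log_integrand_integrable[OF T])
    finally have "log_bop S - log_bop T - D H = (- \<i>) *\<^sub>C integral {0..} E"
      by (simp add: log_bop_eq D_def scaleC_add_right scaleC_diff_right scaleC_minus_left)
    then show "norm (log_bop S - log_bop T - D (S - T)) \<le> 2 * K * K * K * (norm (S - T))\<^sup>2"
      using Ei(3) by (simp add: norm_scaleC flip: H_def)
  qed (use K in simp)
  then show ?thesis using Dc by blast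
qed

lemma log_bop_form_limit:
  fixes T :: "'a::chilbert_space bop"
  assumes T: "axis_resolvent_bound T K"
  shows "((\<lambda>A. - \<i> * integral {0..A} (\<lambda>t. cinner (bop_apply (axis_resolvent T t) x) y
      - cinner x y / (1 + \<i> * of_real t))) \<longlongrightarrow> cinner (bop_apply (log_bop T) x) y) at_top"
proof -
  have bl: "bounded_linear (\<lambda>T. - \<i> * cinner (bop_apply T x) y)"
    by (rule bounded_linear_intro[where K = "norm x * norm y"])
      (use cmod_form_le[of _ x y] in \<open>auto simp: cinner_simps scaleR_conv_of_real mult.assoc norm_mult algebra_simps\<close>)
  have "((\<lambda>A. - \<i> * cinner (bop_apply (integral {0..A} (log_integrand T)) x) y) \<longlongrightarrow>
      - \<i> * cinner (bop_apply (integral {0..} (log_integrand T)) x) y) at_top"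
    by (rule bounded_linear.tendsto[OF bl log_integrand_limit[OF T]])
  moreover have "cinner (bop_apply (integral {0..A} (log_integrand T)) x) y =
     integral {0..A} (\<lambda>t. cinner (bop_apply (axis_resolvent T t) x) y - cinner x y / (1 + \<i> * of_real t))" for A
  proof -
    have bl: "bounded_linear (\<lambda>T. cinner (bop_apply T x) y)"
      by (rule bounded_linear_intro[where K = "norm x * norm y"])
        (use cmod_form_le[of _ x y] in \<open>auto simp: cinner_simps scaleR_conv_of_real mult.assoc\<close>)
    have "log_integrand T integrable_on {0..A}"
      by (intro integrable_continuous_interval continuous_on_subset[OF continuous_on_log_integrand[OF T]]) auto
    from integral_linear[OF this bl] show ?thesis
      by (simp add: o_def log_integrand_def cinner_simps)
  qed
  ultimately show ?thesis by (simp add: log_bop_eq cinner_simps)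
qed

section \<open>The imaginary part of the logarithm\<close>

lemma Im_Ln_upper:
  assumes "Im z > 0"
  shows "Im (Ln z) = pi / 2 - arctan (Re z / Im z)"
proof -
  have z: "z \<noteq> 0" using assms by auto
  have "Arg z = Arg2pi z"
    using Arg2pi_eq[of z] assms z arctan_lbound[of "Re z / Im z"] arctan_ubound[of "Re z / Im z"]
    by (intro Arg_unique[of "norm z"]) (auto simp: Arg2pi_arctan_upperhalf)
  then show ?thesis
    using Arg2pi_arctan_upperhalf[OF assms] Arg_eq_Im_Ln[OF z] by simp
qed

lemma resolvent_form:
  fixes T :: "'a::chilbert_space bop"
  assumes T: "dissipative T" and l: "Im l > 0"
  defines "y \<equiv> \<lambda>x. bop_apply (bop_inv (T + l *\<^sub>C 1)) x"
  shows "bop_apply T (y x) + l *\<^sub>C y x = x"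
    and "cinner (y x) x = cinner (y x) (bop_apply T (y x)) + cnj l * of_real ((norm (y x))\<^sup>2)"
proof -
  show 1: "bop_apply T (y x) + l *\<^sub>C y x = x"
    using bop_inv_right_apply[OF dissipative_resolvent(1)[OF T l]] by (simp add: y_def)
  have "cinner (y x) x = cinner (y x) (bop_apply T (y x) + l *\<^sub>C y x)" unfolding 1 ..
  then show "cinner (y x) x = cinner (y x) (bop_apply T (y x)) + cnj l * of_real ((norm (y x))\<^sup>2)"
    by (simp add: cinner_simps cinner_self)
qed

lemma Im_resolvent_form:
  fixes T :: "'a::chilbert_space bop" and x :: 'a
  assumes T: "dissipative T" and l: "Im l > 0"
  defines "y \<equiv> bop_apply (bop_inv (T + l *\<^sub>C 1)) x"
  shows "Im (cinner y x) = - Im (cinner (bop_apply T y) y) - Im l * (norm y)\<^sup>2"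
  unfolding y_def resolvent_form(2)[OF assms(1,2)]
  by (subst cinner_commute) (simp flip: of_real_power)

text \<open>\<open>(T + l)\<^sup>-\<^sup>1 - l\<^sup>-\<^sup>1 = - l\<^sup>-\<^sup>1 (T + l)\<^sup>-\<^sup>1 T\<close>, and the resolvent has norm at most \<open>2/\<bar>l\<bar>\<close> for large \<open>l\<close>.\<close>

lemma resolvent_form_asymptotics:
  fixes T :: "'a::chilbert_space bop"
  assumes T: "dissipative T" and l: "Im l > 0" and large: "2 * norm T \<le> cmod l"
  shows "cmod (cinner (bop_apply (bop_inv (T + l *\<^sub>C 1)) x) x - of_real ((norm x)\<^sup>2) / l)
    \<le> 2 * norm T * (norm x)\<^sup>2 / (cmod l)\<^sup>2"
proof -
  define y where "y = bop_apply (bop_inv (T + l *\<^sub>C 1)) x"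
  have l0: "l \<noteq> 0" "cmod l > 0" using l by auto
  have yx: "bop_apply T y + l *\<^sub>C y = x" unfolding y_def by (rule resolvent_form(1)[OF T l])
  have "cmod l * norm y = norm (x - bop_apply T y)"
    using yx by (metis add_diff_cancel_left' norm_scaleC)
  also have "\<dots> \<le> norm x + norm T * norm y"
    by (rule order_trans[OF norm_triangle_ineq4]) (intro add_left_mono norm_bop_apply)
  also have "norm T * norm y \<le> cmod l / 2 * norm y"
    using large by (intro mult_right_mono) auto
  finally have ny: "norm y \<le> 2 * norm x / cmod l" using l0 by (simp add: field_simps)
  have "l * cinner y x - of_real ((norm x)\<^sup>2) = - cinner (bop_apply T y) x"
    using arg_cong[OF yx, of "\<lambda>u. cinner u x"] by (simp add: cinner_simps cinner_self algebra_simps)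
  moreover have "cinner y x - of_real ((norm x)\<^sup>2) / l = (l * cinner y x - of_real ((norm x)\<^sup>2)) / l"
    using l0 by (simp add: diff_divide_distrib)
  ultimately have "cinner y x - of_real ((norm x)\<^sup>2) / l = - cinner (bop_apply T y) x / l"
    by simp
  also have "cmod \<dots> \<le> norm T * norm y * norm x / cmod l"
    using cmod_form_le[of T y x] by (simp add: norm_divide divide_right_mono)
  also have "\<dots> \<le> norm T * (2 * norm x / cmod l) * norm x / cmod l"
    by (intro divide_right_mono mult_right_mono mult_left_mono ny) auto
  finally show ?thesis unfolding y_def by (simp add: power2_eq_square mult_ac)
qed

text \<open>Rotating the path of integration. The form \<open>q(l) = \<langle>(T + l)\<^sup>-\<^sup>1 x, x\<rangle>\<close> of the resolvent is
  holomorphic on the convex set \<open>\<complex>\<^sub>+\<close>, so it has a primitive \<open>V\<close> there, and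
  \<open>\<langle>log T x, x\<rangle>\<close> is the renormalised increment of \<open>-V\<close> along the imaginary axis. Since
  \<open>q(l) - \<parallel>x\<parallel>\<^sup>2/l = O(\<bar>l\<bar>\<^sup>-\<^sup>2)\<close>, replacing the endpoint \<open>iA\<close> by \<open>\<plusminus>A + i/A\<close> only costs an increment of
  \<open>\<parallel>x\<parallel>\<^sup>2 Ln\<close>. Along the two horizontal paths that result the sign of \<open>Im q\<close> can be used.\<close>

lemma log_bop_rotated:
  fixes T :: "'a::chilbert_space bop"
  assumes T: "dissipative T" and inv: "bop_invertible T"
  obtains V where
    "\<And>l. Im l > 0 \<Longrightarrow> (V has_field_derivative cinner (bop_apply (bop_inv (T + l *\<^sub>C 1)) x) x) (at l)"
    "((\<lambda>A. Im (V (Complex 0 (1 / A))) - Im (V (Complex A (1 / A)))) \<longlongrightarrow> Im (cinner (bop_apply (log_bop T) x) x)) at_top"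
    "((\<lambda>A. Im (V (Complex 0 (1 / A))) - Im (V (Complex (- A) (1 / A)))) \<longlongrightarrow> Im (cinner (bop_apply (log_bop T) x) x) - pi * (norm x)\<^sup>2) at_top"
proof -
  define n where "n = (norm x)\<^sup>2"
  define q where "q = (\<lambda>l. cinner (bop_apply (bop_inv (T + l *\<^sub>C 1)) x) x)"
  have "(\<lambda>l. bop_inv (T + l *\<^sub>C 1)) vholomorphic_on \<complex>\<^sub>+"
    by (rule vholomorphic_on_bop_inv[OF vholomorphic_on_scalar])
      (auto simp: upper_half_def intro: dissipative_resolvent(1)[OF T])
  then have qhol: "q holomorphic_on \<complex>\<^sub>+"
    unfolding q_def by (rule vholomorphic_on_imp_form_holomorphic)
  have C: "convex \<complex>\<^sub>+" "open \<complex>\<^sub>+"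
    by (auto simp: upper_half_def convex_halfspace_Im_gt open_halfspace_Im_gt)
  have "(\<lambda>l. q l - of_real n / l) holomorphic_on \<complex>\<^sub>+"
    by (intro holomorphic_intros qhol) (auto simp: upper_half_def)
  from holomorphic_convex_primitive'[OF C this] obtain W
    where "\<And>l. l \<in> \<complex>\<^sub>+ \<Longrightarrow> (W has_field_derivative q l - of_real n / l) (at l within \<complex>\<^sub>+)" by blast
  then have W: "(W has_field_derivative q l - of_real n / l) (at l)" if "Im l > 0" for l
    using at_within_open[OF _ C(2)] that by (auto simp: upper_half_def)
  define V where "V = (\<lambda>l. W l + of_real n * Ln l)"
  have V: "(V has_field_derivative q l) (at l)" if "Im l > 0" for l
  proof -
    have "l \<notin> \<real>\<^sub>\<le>\<^sub>0" using that by (auto simp: complex_nonpos_Reals_iff)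
    then show ?thesis
      unfolding V_def by (auto intro!: derivative_eq_intros W[OF that] simp: divide_inverse)
  qed
  obtain K where K: "axis_resolvent_bound T K" using dissipative_axis_resolvent_bound[OF T inv] by blast
  define f where "f = (\<lambda>t. cinner (bop_apply (axis_resolvent T t) x) x - cinner x x / (1 + \<i> * of_real t))"
  define E where "E = (\<lambda>A. - \<i> * integral {0..A} f)"
  have Elim: "(E \<longlongrightarrow> cinner (bop_apply (log_bop T) x) x) at_top"
    unfolding E_def f_def by (rule log_bop_form_limit[OF K])
  have f_eq: "f t = cinner (bop_apply (log_integrand T t) x) x" for t
    by (simp add: f_def log_integrand_def cinner_simps)
  have fq: "f t = q (\<i> * of_real t) - of_real n / (1 + \<i> * of_real t)" for t
    by (simp add: f_def q_def axis_resolvent_def n_def cinner_self)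
  define M where "M = 2 * K * norm (1 - T) * n"
  have Kp: "K > 0" using K by (simp add: axis_resolvent_bound_def)
  have fb: "cmod (f t) \<le> M" if "t \<ge> 0" for t
  proof -
    have "1 \<le> (1 + t)\<^sup>2" using that by (simp add: one_le_power)
    then have "2 * K * norm (1 - T) / (1 + t)\<^sup>2 \<le> 2 * K * norm (1 - T) / 1"
      using Kp by (intro divide_left_mono) auto
    then have "norm (log_integrand T t) \<le> 2 * K * norm (1 - T)"
      using log_integrand_bound[OF K that] by simp
    then have "norm (log_integrand T t) * norm x * norm x \<le> 2 * K * norm (1 - T) * norm x * norm x"
      by (intro mult_right_mono) auto
    then show ?thesis
      unfolding f_eq M_def n_def using cmod_form_le[of "log_integrand T t" x x]
      by (simp add: power2_eq_square mult.assoc)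
  qed
  have fcont: "continuous_on {0..} f"
    unfolding f_def using continuous_on_axis_resolvent[OF K]
    by (intro continuous_intros bounded_linear.continuous_on[OF bounded_linear_cinner_left]
        bounded_linear.continuous_on[of "\<lambda>T. bop_apply T x"])
      (auto simp: complex_eq_iff intro!: bounded_linear_intro[where K = "norm x"] norm_bop_apply)
  have fint: "f integrable_on {a..b}" if "a \<ge> 0" for a b
    by (intro integrable_continuous_interval continuous_on_subset[OF fcont]) (use that in auto)
  have FTC: "- \<i> * integral {a..A} f = V (Complex 0 a) - V (Complex 0 A)
      + of_real n * (Ln (Complex 1 A) - Ln (Complex 1 a))" if "0 < a" "a \<le> A" for a A
  proof -
    have "(f has_integral (- \<i> * (V (\<i> * of_real A) - of_real n * Ln (1 + \<i> * of_real A))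
        - (- \<i> * (V (\<i> * of_real a) - of_real n * Ln (1 + \<i> * of_real a))))) {a..A}"
    proof (rule fundamental_theorem_of_calculus[OF that(2)])
      fix t assume "t \<in> {a..A}"
      then have t: "t > 0" using that by auto
      have "1 + \<i> * of_real t \<notin> \<real>\<^sub>\<le>\<^sub>0" by (auto simp: complex_nonpos_Reals_iff)
      then have d: "((\<lambda>z. - \<i> * (V (\<i> * z) - of_real n * Ln (1 + \<i> * z))) has_field_derivative f t) (at (of_real t))"
        using t by (auto intro!: derivative_eq_intros DERIV_chain2[OF V] simp: fq divide_inverse algebra_simps)
      have "((of_real :: real \<Rightarrow> complex) has_vector_derivative 1) (at t within {a..A})"
        using bounded_linear.has_vector_derivative[OF bounded_linear_of_real has_vector_derivative_id] by simp
      from field_vector_diff_chain_within[OF this has_field_derivative_at_within[OF d]]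
      show "((\<lambda>t. - \<i> * (V (\<i> * of_real t) - of_real n * Ln (1 + \<i> * of_real t))) has_vector_derivative f t)
          (at t within {a..A})" by (simp add: o_def)
    qed
    then show ?thesis
      by (simp add: integral_unique Complex_eq right_diff_distrib distrib_left)
  qed
  \<comment> \<open>On the convex set of all \<open>l\<close> in \<open>\<complex>\<^sub>+\<close> with \<open>s Re l + Im l \<ge> A\<close>, which contains \<open>iA\<close> and \<open>sA + i/A\<close>, the
    derivative of \<open>W\<close> is of order \<open>A\<^sup>-\<^sup>2\<close>.\<close>
  have Wb: "cmod (W (Complex (s * A) (1 / A)) - W (Complex 0 A)) \<le> 16 * norm T * n / A"
    if s: "s = 1 \<or> s = - 1" and A: "A \<ge> 1" "A \<ge> 4 * norm T" for s A :: real
  proof -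
    let ?S = "{l. Im l > 0 \<and> s * Re l + Im l \<ge> A}"
    have cs: "cmod (W (Complex (s * A) (1 / A)) - W (Complex 0 A))
      \<le> (2 * norm T * n / (A / 2)\<^sup>2) * cmod (Complex (s * A) (1 / A) - Complex 0 A)"
    proof (rule field_differentiable_bound[where S = ?S])
      have "?S = {l. Im l > 0} \<inter> {l. inner (Complex s 1) l \<ge> A}"
        by (auto simp: inner_complex_def)
      then show "convex ?S"
        by (simp add: convex_Int convex_halfspace_Im_gt convex_halfspace_ge)
      fix l assume l: "l \<in> ?S"
      then show "(W has_field_derivative q l - of_real n / l) (at l within ?S)"
        using W by (auto intro: has_field_derivative_at_within)
      have "A \<le> s * Re l + Im l" using l by auto
      also have "\<dots> \<le> cmod l + cmod l"
        using s abs_Re_le_cmod[of l] abs_Im_le_cmod[of l] by (intro add_mono) auto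
      finally have la: "A / 2 \<le> cmod l" by simp
      then have "cmod (q l - of_real n / l) \<le> 2 * norm T * n / (cmod l)\<^sup>2"
        unfolding q_def n_def using A l by (intro resolvent_form_asymptotics[OF T]) auto
      also have "\<dots> \<le> 2 * norm T * n / (A / 2)\<^sup>2"
        using la A by (intro divide_left_mono power_mono mult_pos_pos) (auto simp: n_def)
      finally show "cmod (q l - of_real n / l) \<le> 2 * norm T * n / (A / 2)\<^sup>2" .
    qed (use s A in \<open>auto simp: divide_simps\<close>)
    have "cmod (Complex (s * A) (1 / A) - Complex 0 A) \<le> \<bar>s * A\<bar> + \<bar>1 / A - A\<bar>"
      using cmod_le[of "Complex (s * A) (1 / A) - Complex 0 A"] by simp
    also have "\<dots> \<le> 2 * A"
    proof -
      have "1 / A \<le> A" using A mult_mono[of 1 A 1 A] by (simp add: field_simps)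
      then show ?thesis using s A by auto
    qed
    finally have "cmod (Complex (s * A) (1 / A) - Complex 0 A) \<le> 2 * A" .
    then have "(2 * norm T * n / (A / 2)\<^sup>2) * cmod (Complex (s * A) (1 / A) - Complex 0 A)
        \<le> (2 * norm T * n / (A / 2)\<^sup>2) * (2 * A)"
      by (intro mult_left_mono) (auto simp: n_def)
    also have "\<dots> = 16 * norm T * n / A" using A by (simp add: power2_eq_square field_simps)
    finally show ?thesis using cs by linarith
  qed
  have main: "((\<lambda>A. Im (V (Complex 0 (1 / A))) - Im (V (Complex (s * A) (1 / A)))) \<longlongrightarrow>
      Im (cinner (bop_apply (log_bop T) x) x) - L * n) at_top"
    if s: "s = 1 \<or> s = - 1" and L: "((\<lambda>A. Im (Ln (Complex (s * A) (1 / A)))) \<longlongrightarrow> L) at_top" for s L :: real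
  proof -
    define R where "R = (\<lambda>A. n * (Im (Ln (Complex (s * A) (1 / A))) - pi / 2
      + (Im (Ln (Complex 1 A)) - Im (Ln (Complex 1 (1 / A))))))"
    define D where "D = (\<lambda>A. Im (V (Complex 0 (1 / A))) - Im (V (Complex (s * A) (1 / A))))"
    have est: "\<bar>Im (E A) - (D A + R A)\<bar> \<le> (M + 16 * norm T * n) / A"
      if A: "A \<ge> 1" "A \<ge> 4 * norm T" for A
    proof -
      have a: "0 < 1 / A" "1 / A \<le> A" using A mult_mono[of 1 A 1 A] by (simp_all add: field_simps)
      have "integral {0..1 / A} f + integral {1 / A..A} f = integral {0..A} f"
        by (rule Henstock_Kurzweil_Integration.integral_combine) (use a fint in auto)
      then have "E A = - \<i> * integral {0..1 / A} f + - \<i> * integral {1 / A..A} f"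
        unfolding E_def distrib_left[symmetric] by simp
      then have EA: "Im (E A) = Im (- \<i> * integral {0..1 / A} f) + Im (V (Complex 0 (1 / A))) - Im (V (Complex 0 A))
         + n * (Im (Ln (Complex 1 A)) - Im (Ln (Complex 1 (1 / A))))"
        unfolding FTC[OF a] by (simp add: Im_complex_of_real)
      have "cmod (integral {0..1 / A} f) \<le> M * (1 / A - 0)"
        using a fb fcont by (intro integral_bound) (auto intro: continuous_on_subset)
      then have i: "\<bar>Im (- \<i> * integral {0..1 / A} f)\<bar> \<le> M / A"
        using abs_Im_le_cmod[of "- \<i> * integral {0..1 / A} f"] by (simp add: norm_mult)
      have v1: "Im (V (Complex 0 A)) = Im (W (Complex 0 A)) + n * (pi / 2)"
        using A by (simp add: V_def Im_Ln_upper)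
      have v2: "Im (V (Complex (s * A) (1 / A))) = Im (W (Complex (s * A) (1 / A))) + n * Im (Ln (Complex (s * A) (1 / A)))"
        by (simp add: V_def)
      have w: "\<bar>Im (W (Complex (s * A) (1 / A))) - Im (W (Complex 0 A))\<bar> \<le> 16 * norm T * n / A"
        using order_trans[OF abs_Im_le_cmod Wb[OF s A]] by simp
      have "Im (E A) - (D A + R A) = Im (- \<i> * integral {0..1 / A} f) + (Im (W (Complex (s * A) (1 / A))) - Im (W (Complex 0 A)))"
        unfolding EA D_def R_def v1 v2 by (simp add: algebra_simps)
      then show ?thesis using i w by (simp add: add_divide_distrib)
    qed
    have "((\<lambda>A. Im (E A) - (D A + R A)) \<longlongrightarrow> 0) at_top"
    proof (rule Lim_null_comparison)
      show "\<forall>\<^sub>F A in at_top. norm (Im (E A) - (D A + R A)) \<le> (M + 16 * norm T * n) / A"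
        using eventually_ge_at_top[of 1] eventually_ge_at_top[of "4 * norm T"]
        by eventually_elim (simp add: est)
      show "((\<lambda>A. (M + 16 * norm T * n) / A) \<longlongrightarrow> 0) at_top" by real_asymp
    qed
    moreover have "(R \<longlongrightarrow> n * (L - pi / 2 + (pi / 2 - 0))) at_top"
      unfolding R_def
    proof (intro tendsto_intros L)
      have "\<forall>\<^sub>F A in at_top. pi / 2 - arctan (1 / A) = Im (Ln (Complex 1 A))"
        using eventually_gt_at_top[of 0] by eventually_elim (simp add: Im_Ln_upper)
      moreover have "((\<lambda>A::real. pi / 2 - arctan (1 / A)) \<longlongrightarrow> pi / 2) at_top" by real_asymp
      ultimately show "((\<lambda>A. Im (Ln (Complex 1 A))) \<longlongrightarrow> pi / 2) at_top" by (rule Lim_transform_eventually[rotated])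
      have "\<forall>\<^sub>F A in at_top. pi / 2 - arctan A = Im (Ln (Complex 1 (1 / A)))"
        using eventually_gt_at_top[of 0] by eventually_elim (simp add: Im_Ln_upper)
      moreover have "((\<lambda>A::real. pi / 2 - arctan A) \<longlongrightarrow> 0) at_top" by real_asymp
      ultimately show "((\<lambda>A. Im (Ln (Complex 1 (1 / A)))) \<longlongrightarrow> 0) at_top" by (rule Lim_transform_eventually[rotated])
    qed
    ultimately have "((\<lambda>A. Im (E A) - (Im (E A) - (D A + R A)) - R A) \<longlongrightarrow>
      Im (cinner (bop_apply (log_bop T) x) x) - 0 - n * (L - pi / 2 + (pi / 2 - 0))) at_top"
      by (intro tendsto_intros Elim)
    then show ?thesis by (simp add: D_def mult.commute)
  qed
  have "\<forall>\<^sub>F A in at_top. pi / 2 - arctan (A * A) = Im (Ln (Complex (1 * A) (1 / A)))"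
    using eventually_gt_at_top[of 0] by eventually_elim (simp add: Im_Ln_upper)
  moreover have "((\<lambda>A::real. pi / 2 - arctan (A * A)) \<longlongrightarrow> 0) at_top" by real_asymp
  ultimately have L1: "((\<lambda>A. Im (Ln (Complex (1 * A) (1 / A)))) \<longlongrightarrow> 0) at_top" by (rule Lim_transform_eventually[rotated])
  have "\<forall>\<^sub>F A in at_top. pi / 2 - arctan (- (A * A)) = Im (Ln (Complex (- 1 * A) (1 / A)))"
    using eventually_gt_at_top[of 0] by eventually_elim (simp add: Im_Ln_upper)
  moreover have "((\<lambda>A::real. pi / 2 - arctan (- (A * A))) \<longlongrightarrow> pi) at_top" by real_asymp
  ultimately have L2: "((\<lambda>A. Im (Ln (Complex (- 1 * A) (1 / A)))) \<longlongrightarrow> pi) at_top" by (rule Lim_transform_eventually[rotated])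
  show thesis
    by (rule that[of V]) (use V main[OF _ L1] main[OF _ L2] in \<open>auto simp: q_def n_def\<close>)
qed

lemma Im_along_horizontal:
  assumes V: "\<And>l. Im l > 0 \<Longrightarrow> (V has_field_derivative V' l) (at l)" and a: "a > 0"
  shows "((\<lambda>s. Im (V (Complex s a))) has_real_derivative Im (V' (Complex s a))) (at s)"
proof -
  have "((\<lambda>s. Complex s a) has_vector_derivative 1) (at s)"
    unfolding Complex_eq by (auto intro!: derivative_eq_intros)
  from field_vector_diff_chain_at[OF this] V[of "Complex s a"] a
  have "((\<lambda>s. V (Complex s a)) has_vector_derivative V' (Complex s a)) (at s)"
    by (auto simp: o_def)
  then show ?thesis
    by (simp add: has_real_derivative_iff_has_vector_derivative has_vector_derivative_complex_iff)
qed

text \<open>\<open>Im V\<close> decreases along horizontal lines, because \<open>Im q \<le> 0\<close>.\<close>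

lemma Im_log_bop_bounds:
  fixes T :: "'a::chilbert_space bop"
  assumes T: "dissipative T" and inv: "bop_invertible T"
  shows "0 \<le> Im (cinner (bop_apply (log_bop T) x) x)"
    and "Im (cinner (bop_apply (log_bop T) x) x) \<le> pi * (norm x)\<^sup>2"
proof -
  let ?q = "\<lambda>l. cinner (bop_apply (bop_inv (T + l *\<^sub>C 1)) x) x"
  obtain V where V: "\<And>l. Im l > 0 \<Longrightarrow> (V has_field_derivative ?q l) (at l)"
    and l1: "((\<lambda>A. Im (V (Complex 0 (1 / A))) - Im (V (Complex A (1 / A)))) \<longlongrightarrow> Im (cinner (bop_apply (log_bop T) x) x)) at_top"
    and l2: "((\<lambda>A. Im (V (Complex 0 (1 / A))) - Im (V (Complex (- A) (1 / A)))) \<longlongrightarrow> Im (cinner (bop_apply (log_bop T) x) x) - pi * (norm x)\<^sup>2) at_top"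
    using log_bop_rotated[OF T inv] by blast
  have neg: "Im (?q l) \<le> 0" if "Im l > 0" for l
    using T that unfolding Im_resolvent_form[OF T that] dissipative_def by (smt (verit) mult_nonneg_nonneg zero_le_power2)
  have mono: "Im (V (Complex t a)) \<le> Im (V (Complex s a))" if "s \<le> t" "a > 0" for s t a
    using Im_along_horizontal[OF V that(2)] neg[of "Complex _ a"] that by (intro DERIV_nonpos_imp_nonincreasing[OF that(1)]) auto
  show "0 \<le> Im (cinner (bop_apply (log_bop T) x) x)"
    by (rule tendsto_lowerbound[OF l1])
      (use eventually_gt_at_top[of 0] in eventually_elim, use mono in auto)
  have "Im (cinner (bop_apply (log_bop T) x) x) - pi * (norm x)\<^sup>2 \<le> 0"
    by (rule tendsto_upperbound[OF l2])
      (use eventually_gt_at_top[of 0] in eventually_elim, use mono in auto)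
  then show "Im (cinner (bop_apply (log_bop T) x) x) \<le> pi * (norm x)\<^sup>2" by simp
qed

text \<open>When \<open>Re T \<ge> \<delta>\<close>, the resolvent at \<open>s + ia\<close> with \<open>s \<ge> 0\<close> has norm at most \<open>1/(\<delta> + s)\<close>, and
  \<open>-Im q\<close> is at most \<open>(\<parallel>Im T\<parallel> + a)/(\<delta> + s)\<^sup>2\<close>, whose integral over \<open>s \<ge> 0\<close> is \<open>(\<parallel>Im T\<parallel> + a)/\<delta>\<close>.\<close>

lemma Im_log_bop_le_of_Re_bound:
  fixes T :: "'a::chilbert_space bop"
  assumes T: "dissipative T" and inv: "bop_invertible T" and d: "\<delta> > 0"
    and re: "\<And>x. \<delta> * (norm x)\<^sup>2 \<le> Re (cinner (bop_apply T x) x)"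
    and im: "\<And>x. Im (cinner (bop_apply T x) x) \<le> k * (norm x)\<^sup>2"
  shows "Im (cinner (bop_apply (log_bop T) x) x) \<le> \<bar>k\<bar> / \<delta> * (norm x)\<^sup>2"
proof -
  let ?q = "\<lambda>l. cinner (bop_apply (bop_inv (T + l *\<^sub>C 1)) x) x"
  obtain V where V: "\<And>l. Im l > 0 \<Longrightarrow> (V has_field_derivative ?q l) (at l)"
    and l1: "((\<lambda>A. Im (V (Complex 0 (1 / A))) - Im (V (Complex A (1 / A)))) \<longlongrightarrow> Im (cinner (bop_apply (log_bop T) x) x)) at_top"
    using log_bop_rotated[OF T inv] by blast
  have qb: "- Im (?q (Complex s a)) \<le> (\<bar>k\<bar> + a) * (norm x)\<^sup>2 / (\<delta> + s)\<^sup>2" if a: "a > 0" and s: "s \<ge> 0" for s a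
  proof -
    define l where "l = Complex s a"
    have l: "Im l > 0" "Re l = s" using a by (simp_all add: l_def)
    define y where "y = bop_apply (bop_inv (T + l *\<^sub>C 1)) x"
    have "(\<delta> + s) * (norm y)\<^sup>2 \<le> Re (cinner (bop_apply T y + l *\<^sub>C y) y)"
      using re[of y] l by (simp add: cinner_simps cinner_self distrib_right flip: of_real_power)
    also have "\<dots> \<le> norm x * norm y"
      using resolvent_form(1)[OF T l(1), of x] complex_Re_le_cmod cauchy_schwarz order_trans unfolding y_def by metis
    finally have "((\<delta> + s) * norm y) * norm y \<le> norm x * norm y" by (simp add: power2_eq_square)
    then have "(\<delta> + s) * norm y \<le> norm x"
      by (cases "y = 0") (auto simp: mult_le_cancel_right)
    then have "norm y \<le> norm x / (\<delta> + s)" using d s by (simp add: field_simps)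
    then have ny: "(norm y)\<^sup>2 \<le> (norm x)\<^sup>2 / (\<delta> + s)\<^sup>2"
      using power_mono[of "norm y" "norm x / (\<delta> + s)" 2] by (simp add: power_divide)
    have "- Im (?q l) = Im (cinner (bop_apply T y) y) + a * (norm y)\<^sup>2"
      unfolding Im_resolvent_form[OF T l(1)] y_def by (simp add: l_def)
    also have "\<dots> \<le> (\<bar>k\<bar> + a) * (norm y)\<^sup>2"
      using im[of y] mult_right_mono[OF abs_ge_self[of k], of "(norm y)\<^sup>2"] by (simp add: distrib_right)
    also have "\<dots> \<le> (\<bar>k\<bar> + a) * ((norm x)\<^sup>2 / (\<delta> + s)\<^sup>2)"
      using a ny by (intro mult_left_mono) auto
    finally show ?thesis by (simp add: l_def)
  qed
  have step: "Im (V (Complex 0 a)) - Im (V (Complex A a)) \<le> (\<bar>k\<bar> + a) * (norm x)\<^sup>2 / \<delta>" if a: "a > 0" and A: "A > 0" for a A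
  proof -
    define c where "c = (\<bar>k\<bar> + a) * (norm x)\<^sup>2"
    have c: "c \<ge> 0" using a by (simp add: c_def)
    have "Im (V (Complex 0 a)) - c / (\<delta> + 0) \<le> Im (V (Complex A a)) - c / (\<delta> + A)"
    proof (rule DERIV_nonneg_imp_nondecreasing[where f = "\<lambda>s. Im (V (Complex s a)) - c / (\<delta> + s)"])
      fix s assume "0 \<le> s" "s \<le> A"
      then have "((\<lambda>s. c / (\<delta> + s)) has_real_derivative - c / (\<delta> + s)\<^sup>2) (at s)"
        using d by (auto intro!: derivative_eq_intros simp: power2_eq_square)
      from DERIV_diff[OF Im_along_horizontal[OF V a] this]
      have "((\<lambda>s. Im (V (Complex s a)) - c / (\<delta> + s)) has_real_derivative Im (?q (Complex s a)) + c / (\<delta> + s)\<^sup>2) (at s)"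
        by simp
      moreover have "0 \<le> Im (?q (Complex s a)) + c / (\<delta> + s)\<^sup>2"
        using qb[OF a \<open>0 \<le> s\<close>] by (simp add: c_def)
      ultimately show "\<exists>y. ((\<lambda>s. Im (V (Complex s a)) - c / (\<delta> + s)) has_real_derivative y) (at s) \<and> 0 \<le> y"
        by blast
    qed (use A in simp)
    moreover have "0 \<le> c / (\<delta> + A)" using c d A by simp
    ultimately show ?thesis by (simp add: c_def)
  qed
  have "Im (cinner (bop_apply (log_bop T) x) x) \<le> (\<bar>k\<bar> + 0) * (norm x)\<^sup>2 / \<delta>"
  proof (rule tendsto_le[OF _ _ l1])
    show "((\<lambda>A. (\<bar>k\<bar> + 1 / A) * (norm x)\<^sup>2 / \<delta>) \<longlongrightarrow> (\<bar>k\<bar> + 0) * (norm x)\<^sup>2 / \<delta>) at_top"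
      using d by (intro tendsto_intros) (real_asymp | simp)+
    show "\<forall>\<^sub>F A in at_top. Im (V (Complex 0 (1 / A))) - Im (V (Complex A (1 / A))) \<le> (\<bar>k\<bar> + 1 / A) * (norm x)\<^sup>2 / \<delta>"
      using eventually_gt_at_top[of 0] by eventually_elim (simp add: step)
  qed simp
  then show ?thesis by simp
qed

section \<open>The Cauchy distribution and Fourier series on the boundary of the disc\<close>

text \<open>Normalised arc length on the unit circle, transported to the real line by \<open>half_plane_map \<i>\<close>.\<close>

definition cauchy_distribution :: "real measure"
  where "cauchy_distribution = density lborel (\<lambda>t. ennreal (1 / (pi * (1 + t\<^sup>2))))"

text \<open>The point of the unit circle that \<open>half_plane_map \<i>\<close> sends to \<open>t\<close>.\<close>

definition bdry :: "real \<Rightarrow> complex"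
  where "bdry t = (of_real t - \<i>) / (of_real t + \<i>)"

lemma of_real_plus_i_nonzero: "complex_of_real t + \<i> \<noteq> 0" "complex_of_real t - \<i> \<noteq> 0"
  by (auto simp: complex_eq_iff)

lemma norm_bdry [simp]: "cmod (bdry t) = 1"
proof -
  have "cmod (of_real t - \<i>) = cmod (of_real t + \<i>)" by (simp add: cmod_def)
  then show ?thesis using of_real_plus_i_nonzero by (simp add: bdry_def norm_divide)
qed

lemma bdry_mult_cnj [simp]: "bdry t * cnj (bdry t) = 1"
  using complex_norm_square[of "bdry t"] by simp

lemma half_plane_map_bdry: "bdry t \<noteq> 1" "half_plane_map \<i> (bdry t) = of_real t"
proof -
  have 1: "1 - bdry t = 2 * \<i> / (of_real t + \<i>)"
    using of_real_plus_i_nonzero[of t] by (simp add: bdry_def field_simps)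
  then show "bdry t \<noteq> 1" using of_real_plus_i_nonzero[of t] by auto
  have 2: "\<i> + \<i> * bdry t = 2 * \<i> * of_real t / (of_real t + \<i>)"
    using of_real_plus_i_nonzero[of t] by (simp add: bdry_def field_simps)
  have "half_plane_map \<i> (bdry t) = (\<i> + \<i> * bdry t) / (1 - bdry t)"
    by (simp add: half_plane_map_def)
  also have "\<dots> = of_real t"
    unfolding 1 2 using of_real_plus_i_nonzero(1)[of t] by simp
  finally show "half_plane_map \<i> (bdry t) = of_real t" .
qed

lemma continuous_on_bdry: "continuous_on A bdry"
  unfolding bdry_def by (intro continuous_intros) (simp add: of_real_plus_i_nonzero)

lemma borel_measurable_bdry [measurable]: "bdry \<in> borel_measurable borel"
  by (intro borel_measurable_continuous_onI continuous_on_bdry)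

lemma borel_measurable_cnj [measurable (raw), simp]:
  "f \<in> borel_measurable M \<Longrightarrow> (\<lambda>x. cnj (f x)) \<in> borel_measurable M"
  by (erule measurable_compose) (intro borel_measurable_continuous_onI continuous_on_cnj continuous_on_id)

lemma cauchy_density_pos: "0 < pi * (1 + t\<^sup>2)"
  by (simp add: add_pos_nonneg)

lemma cauchy_density_nonneg [simp]: "0 \<le> 1 / (pi * (1 + t\<^sup>2))"
  by (simp add: add_nonneg_nonneg)

lemma cauchy_density_integral:
  "integrable lborel (\<lambda>t. 1 / (pi * (1 + t\<^sup>2)))" "(\<integral>t. 1 / (pi * (1 + t\<^sup>2)) \<partial>lborel) = 1"
proof -
  have d: "((\<lambda>t. arctan t / pi) has_real_derivative 1 / (pi * (1 + t\<^sup>2))) (at t)" for t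
    using DERIV_cdivide[OF DERIV_arctan[of t], of pi] by (simp add: inverse_eq_divide mult.commute)
  have c: "isCont (\<lambda>t. 1 / (pi * (1 + t\<^sup>2))) t" for t :: real
    using cauchy_density_pos[of t] by (intro continuous_intros) auto
  have A: "(((\<lambda>t. arctan t / pi) \<circ> real_of_ereal) \<longlongrightarrow> - (1 / 2)) (at_right (- \<infinity>))"
    unfolding ereal_tendsto_simps by real_asymp
  have B: "(((\<lambda>t. arctan t / pi) \<circ> real_of_ereal) \<longlongrightarrow> 1 / 2) (at_left \<infinity>)"
    unfolding ereal_tendsto_simps by real_asymp
  have "- \<infinity> < (\<infinity> :: ereal)" by simp
  note FTC = interval_integral_FTC_nonneg[OF this d c _ A B]
  show "integrable lborel (\<lambda>t. 1 / (pi * (1 + t\<^sup>2)))"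
    using FTC(1) by (simp add: set_integrable_def)
  show "(\<integral>t. 1 / (pi * (1 + t\<^sup>2)) \<partial>lborel) = 1"
    using FTC(2) by (simp add: interval_lebesgue_integral_def set_lebesgue_integral_def)
qed

lemma sets_cauchy_distribution [simp, measurable_cong]: "sets cauchy_distribution = sets borel"
  by (simp add: cauchy_distribution_def)

lemma space_cauchy_distribution [simp]: "space cauchy_distribution = UNIV"
  by (simp add: cauchy_distribution_def)

lemma borel_measurable_cauchy_distribution [simp]:
  "borel_measurable cauchy_distribution = borel_measurable borel"
  by (rule measurable_cong_sets) auto

lemma emeasure_cauchy_distribution: "emeasure cauchy_distribution UNIV = 1"
  using nn_integral_eq_integral[OF cauchy_density_integral(1)] cauchy_density_integral(2)
  by (simp add: cauchy_distribution_def emeasure_density)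

interpretation cauchy_distribution: finite_measure cauchy_distribution
  by (rule finite_measureI) (simp add: emeasure_cauchy_distribution)

lemma measure_cauchy_distribution [simp]: "measure cauchy_distribution UNIV = 1"
  by (simp add: measure_def emeasure_cauchy_distribution)

lemma AE_cauchy_distribution: "(AE t in cauchy_distribution. P t) \<longleftrightarrow> (AE t in lborel. P t)"
proof -
  have "0 < ennreal (1 / (pi * (1 + t\<^sup>2)))" for t :: real
    by (simp add: add_pos_nonneg)
  then show ?thesis unfolding cauchy_distribution_def by (subst AE_density) auto
qed

lemma integrable_cauchy_distribution_bounded:
  fixes f :: "real \<Rightarrow> 'b::{banach, second_countable_topology}"
  assumes "f \<in> borel_measurable borel" "\<And>t. norm (f t) \<le> B"
  shows "integrable cauchy_distribution f"
  by (rule cauchy_distribution.integrable_const_bound[where B = B]) (use assms in auto)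

lemma integral_cauchy_distribution:
  fixes f :: "real \<Rightarrow> complex"
  assumes "f \<in> borel_measurable borel" "\<And>t. norm (f t) \<le> B"
  shows "has_bochner_integral lborel (\<lambda>t. f t / of_real (pi * (1 + t\<^sup>2))) (\<integral>t. f t \<partial>cauchy_distribution)"
proof -
  have i: "integrable cauchy_distribution f" by (rule integrable_cauchy_distribution_bounded) fact+
  have eq: "(1 / (pi * (1 + t\<^sup>2))) *\<^sub>R f t = f t / of_real (pi * (1 + t\<^sup>2))" for t
    by (simp add: scaleR_conv_of_real)
  show ?thesis
    using i assms(1) unfolding has_bochner_integral_iff cauchy_distribution_def
    by (subst (asm) integrable_density, simp_all, subst integral_density) (simp_all add: eq)
qed

text \<open>For \<open>n \<ge> 1\<close> the \<open>n\<close>-th moment vanishes because \<open>bdry\<^sup>n / (1 + t\<^sup>2)\<close> is the derivative of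
  \<open>bdry\<^sup>n / (2in)\<close>, and \<open>bdry\<close> has the same limit \<open>1\<close> at both ends of the line.\<close>

lemma integral_bdry_power:
  "(\<integral>t. bdry t ^ n \<partial>cauchy_distribution) = (if n = 0 then 1 else 0)"
proof (cases "n = 0")
  case False
  define F where "F = (\<lambda>t. bdry t ^ n / (2 * \<i> * of_nat n * of_real pi))"
  define f where "f = (\<lambda>t. bdry t ^ n / of_real (pi * (1 + t\<^sup>2)))"
  have d: "(F has_vector_derivative f t) (at t)" for t
  proof -
    define w where "w = complex_of_real t"
    have nz: "w + \<i> \<noteq> 0" "w - \<i> \<noteq> 0" unfolding w_def by (rule of_real_plus_i_nonzero)+
    have sq: "of_real (1 + t\<^sup>2) = (w + \<i>) * (w - \<i>)"
      by (simp add: w_def algebra_simps power2_eq_square)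
    have "((\<lambda>z. (z - \<i>) / (z + \<i>)) has_field_derivative 2 * \<i> / (w + \<i>)\<^sup>2) (at w)"
      using nz by (auto intro!: derivative_eq_intros simp: power2_eq_square algebra_simps)
    from DERIV_cdivide[OF DERIV_power[OF this, of n], of "2 * \<i> * of_nat n * of_real pi"]
    have D: "((\<lambda>z. ((z - \<i>) / (z + \<i>)) ^ n / (2 * \<i> * of_nat n * of_real pi)) has_field_derivative
      of_nat n * ((w - \<i>) / (w + \<i>)) ^ (n - 1) * (2 * \<i> / (w + \<i>)\<^sup>2) / (2 * \<i> * of_nat n * of_real pi)) (at w)"
      by (simp add: mult_ac)
    have "((w - \<i>) / (w + \<i>)) ^ n = ((w - \<i>) / (w + \<i>)) * ((w - \<i>) / (w + \<i>)) ^ (n - 1)"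
      using False by (cases n) auto
    then have "of_nat n * ((w - \<i>) / (w + \<i>)) ^ (n - 1) * (2 * \<i> / (w + \<i>)\<^sup>2) / (2 * \<i> * of_nat n * of_real pi) = f t"
      unfolding f_def of_real_mult sq bdry_def w_def[symmetric] using False nz
      by (simp add: power2_eq_square)
    then have D': "((\<lambda>z. ((z - \<i>) / (z + \<i>)) ^ n / (2 * \<i> * of_nat n * of_real pi)) has_field_derivative f t) (at (of_real t))"
      using D by (simp add: w_def)
    have "(of_real has_vector_derivative (1::complex)) (at t)"
      using bounded_linear.has_vector_derivative[OF bounded_linear_of_real has_vector_derivative_id] by simp
    from field_vector_diff_chain_at[OF this D'] show ?thesis
      by (simp add: F_def bdry_def o_def)
  qed
  have c: "isCont f t" for t
  proof -
    have "complex_of_real (pi * (1 + t\<^sup>2)) \<noteq> 0" for t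
      using cauchy_density_pos[of t] unfolding of_real_eq_0_iff by linarith
    then have "continuous_on UNIV f"
      unfolding f_def by (intro continuous_intros continuous_on_bdry) simp
    then show ?thesis by (simp add: continuous_on_eq_continuous_at)
  qed
  have h: "has_bochner_integral lborel f (\<integral>t. bdry t ^ n \<partial>cauchy_distribution)"
    unfolding f_def by (rule integral_cauchy_distribution[where B = 1]) (simp_all add: norm_power)
  then have i: "set_integrable lborel (einterval (- \<infinity>) \<infinity>) f"
    by (auto simp: set_integrable_def has_bochner_integral_iff)
  have L: "((\<lambda>t. bdry t) \<longlongrightarrow> 1) at_infinity"
  proof -
    have "((\<lambda>t::real. 2 * \<i> / (of_real t + \<i>)) \<longlongrightarrow> 0) at_infinity"
      by (intro tendsto_divide_0[OF tendsto_const] tendsto_add_filterlim_at_infinity'[OF _ tendsto_const])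
        (simp add: filterlim_at_infinity_conv_norm_at_top[of of_real] filterlim_norm_at_top[where 'a = real, unfolded real_norm_def])
    then have "((\<lambda>t::real. 1 - 2 * \<i> / (of_real t + \<i>)) \<longlongrightarrow> 1 - 0) at_infinity" by (intro tendsto_intros)
    moreover have "1 - 2 * \<i> / (of_real t + \<i>) = bdry t" for t
      using of_real_plus_i_nonzero[of t] by (simp add: bdry_def field_simps)
    ultimately show ?thesis by simp
  qed
  have L1: "(bdry \<longlongrightarrow> 1) at_top" "(bdry \<longlongrightarrow> 1) at_bot"
    using L by (auto intro: filterlim_mono at_top_le_at_infinity at_bot_le_at_infinity)
  have A: "((F \<circ> real_of_ereal) \<longlongrightarrow> 1 ^ n / (2 * \<i> * of_nat n * of_real pi)) (at_right (- \<infinity>))"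
    unfolding ereal_tendsto_simps F_def using False by (intro tendsto_intros L1) auto
  have B: "((F \<circ> real_of_ereal) \<longlongrightarrow> 1 ^ n / (2 * \<i> * of_nat n * of_real pi)) (at_left \<infinity>)"
    unfolding ereal_tendsto_simps F_def using False by (intro tendsto_intros L1) auto
  have "- \<infinity> < (\<infinity> :: ereal)" by simp
  from interval_integral_FTC_integrable[OF this d c i A B] have "(LBINT t. f t) = 0"
    by (simp add: interval_lebesgue_integral_def set_lebesgue_integral_def)
  then show ?thesis using h False by (simp add: has_bochner_integral_iff)
qed simp

lemma integral_bdry_power_cnj:
  "(\<integral>t. bdry t ^ n * cnj (bdry t ^ m) \<partial>cauchy_distribution) = (if n = m then 1 else 0)"
proof -
  have *: "(\<integral>t. bdry t ^ n * cnj (bdry t ^ m) \<partial>cauchy_distribution) = (if n = m then 1 else 0)" if "m \<le> n" for n m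
  proof -
    have "bdry t ^ n * cnj (bdry t ^ m) = bdry t ^ (n - m)" for t
    proof -
      have "bdry t ^ n = bdry t ^ (n - m) * bdry t ^ m" using that by (simp flip: power_add)
      then show ?thesis by (simp add: mult.assoc flip: power_mult_distrib)
    qed
    then show ?thesis using that integral_bdry_power[of "n - m"] by simp
  qed
  show ?thesis
  proof (cases "m \<le> n")
    case False
    have "(\<integral>t. cnj (bdry t ^ m * cnj (bdry t ^ n)) \<partial>cauchy_distribution) = 0"
      unfolding Bochner_Integration.integral_cnj using *[of n m] False by simp
    moreover have "(\<lambda>t. cnj (bdry t ^ m * cnj (bdry t ^ n))) = (\<lambda>t. bdry t ^ n * cnj (bdry t ^ m))"
      by (simp add: mult.commute)
    ultimately show ?thesis using False by simp
  qed (rule *)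
qed

lemma
  assumes b: "summable (\<lambda>n. norm (b n))"
  defines "H \<equiv> \<lambda>t. \<Sum>n. b n * bdry t ^ n"
  shows bdry_series_summable: "summable (\<lambda>n. norm (b n * bdry t ^ n))"
    and norm_bdry_series_le: "norm (H t) \<le> (\<Sum>n. norm (b n))"
    and bdry_series_measurable: "H \<in> borel_measurable borel"
proof -
  show *: "summable (\<lambda>n. norm (b n * bdry t ^ n))" for t
    using b by (simp add: norm_mult norm_power)
  show "norm (H t) \<le> (\<Sum>n. norm (b n))"
    unfolding H_def using summable_norm[OF *[of t]] by (simp add: norm_mult norm_power)
  show "H \<in> borel_measurable borel" unfolding H_def by measurable
qed

lemma bdry_series_integral:
  assumes b: "summable (\<lambda>n. norm (b n))" and f: "f \<in> borel_measurable borel" "\<And>t. norm (f t) \<le> B"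
  shows "(\<lambda>n. b n * (\<integral>t. f t * bdry t ^ n \<partial>cauchy_distribution)) sums
    (\<integral>t. f t * (\<Sum>n. b n * bdry t ^ n) \<partial>cauchy_distribution)"
proof -
  note [measurable] = f(1)
  have B: "B \<ge> 0" by (rule order_trans[OF norm_ge_zero f(2)])
  have bd: "norm (f t * (b n * bdry t ^ n)) \<le> B * norm (b n)" for n t
    using mult_right_mono[OF f(2)[of t] norm_ge_zero[of "b n"]] by (simp add: norm_mult norm_power)
  have "(\<lambda>n. \<integral>t. f t * (b n * bdry t ^ n) \<partial>cauchy_distribution) sums
      (\<integral>t. (\<Sum>n. f t * (b n * bdry t ^ n)) \<partial>cauchy_distribution)"
  proof (rule sums_integral)
    show "integrable cauchy_distribution (\<lambda>t. f t * (b n * bdry t ^ n))" for n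
      by (rule integrable_cauchy_distribution_bounded[OF _ bd]) measurable
    have "summable (\<lambda>n. norm (f t * (b n * bdry t ^ n)))" for t
      by (rule summable_comparison_test'[OF summable_mult[OF b, of B], of 0]) (use bd in auto)
    then show "AE t in cauchy_distribution. summable (\<lambda>n. norm (f t * (b n * bdry t ^ n)))" by simp
    show "summable (\<lambda>n. \<integral>t. norm (f t * (b n * bdry t ^ n)) \<partial>cauchy_distribution)"
    proof (rule summable_comparison_test'[OF summable_mult[OF b, of B], of 0])
      fix n
      have "(\<integral>t. norm (f t * (b n * bdry t ^ n)) \<partial>cauchy_distribution) \<le> (\<integral>t. B * norm (b n) \<partial>cauchy_distribution)"
        by (intro integral_mono integrable_cauchy_distribution_bounded[where B = "B * norm (b n)"]) (use bd B in auto)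
      then show "norm (\<integral>t. norm (f t * (b n * bdry t ^ n)) \<partial>cauchy_distribution) \<le> B * norm (b n)"
        by simp
    qed
  qed
  moreover have "(\<Sum>n. f t * (b n * bdry t ^ n)) = f t * (\<Sum>n. b n * bdry t ^ n)" for t
    by (rule suminf_mult) (rule summable_norm_cancel[OF bdry_series_summable[OF b]])
  moreover have "(\<integral>t. f t * (b n * bdry t ^ n) \<partial>cauchy_distribution) = b n * (\<integral>t. f t * bdry t ^ n \<partial>cauchy_distribution)" for n
    by (simp add: mult.left_commute)
  ultimately show ?thesis by simp
qed

lemma
  assumes b: "summable (\<lambda>n. norm (b n))"
  defines "H \<equiv> \<lambda>t. \<Sum>n. b n * bdry t ^ n"
  shows bdry_series_moment: "(\<integral>t. bdry t ^ m * H t \<partial>cauchy_distribution) = (if m = 0 then b 0 else 0)"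
    and bdry_series_coeff: "(\<integral>t. cnj (bdry t ^ m) * H t \<partial>cauchy_distribution) = b m"
proof -
  have "(\<lambda>n. b n * (\<integral>t. bdry t ^ m * bdry t ^ n \<partial>cauchy_distribution)) sums (\<integral>t. bdry t ^ m * H t \<partial>cauchy_distribution)"
    unfolding H_def by (rule bdry_series_integral[OF b, where B = 1]) (simp_all add: norm_power)
  moreover have "b n * (\<integral>t. bdry t ^ m * bdry t ^ n \<partial>cauchy_distribution) = (if n = 0 then if m = 0 then b 0 else 0 else 0)" for n
    using integral_bdry_power[of "m + n"] by (simp add: power_add)
  ultimately have "(\<lambda>n. if n = 0 then if m = 0 then b 0 else 0 else 0) sums (\<integral>t. bdry t ^ m * H t \<partial>cauchy_distribution)" by simp
  moreover have "(\<lambda>n. if n = 0 then if m = 0 then b 0 else 0 else 0) sums (if m = 0 then b 0 else 0)"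
    by (rule sums_single)
  ultimately show "(\<integral>t. bdry t ^ m * H t \<partial>cauchy_distribution) = (if m = 0 then b 0 else 0)"
    by (rule sums_unique2)
  have "(\<lambda>n. b n * (\<integral>t. cnj (bdry t ^ m) * bdry t ^ n \<partial>cauchy_distribution)) sums (\<integral>t. cnj (bdry t ^ m) * H t \<partial>cauchy_distribution)"
    unfolding H_def by (rule bdry_series_integral[OF b, where B = 1]) (simp_all add: norm_power)
  moreover have "b n * (\<integral>t. cnj (bdry t ^ m) * bdry t ^ n \<partial>cauchy_distribution) = (if n = m then b n else 0)" for n
    using integral_bdry_power_cnj[of n m] by (simp add: mult.commute)
  ultimately have "(\<lambda>n. if n = m then b n else 0) sums (\<integral>t. cnj (bdry t ^ m) * H t \<partial>cauchy_distribution)" by simp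
  moreover have "(\<lambda>n. if n = m then b n else 0) sums b m" by (rule sums_single)
  ultimately show "(\<integral>t. cnj (bdry t ^ m) * H t \<partial>cauchy_distribution) = b m" by (rule sums_unique2)
qed

text \<open>Parseval's identity for the imaginary part: \<open>(Im H)\<^sup>2 = (\<bar>H\<bar>\<^sup>2 - Re (H\<^sup>2))/2\<close>, and \<open>H\<^sup>2\<close> has mean
  value \<open>b\<^sub>0\<^sup>2\<close>.\<close>

lemma bdry_series_Im_parseval:
  assumes b: "summable (\<lambda>n. norm (b n))"
  defines "H \<equiv> \<lambda>t. \<Sum>n. b n * bdry t ^ n"
  shows "(\<lambda>n. (cmod (b n))\<^sup>2) sums (2 * (\<integral>t. (Im (H t))\<^sup>2 \<partial>cauchy_distribution) + Re ((b 0)\<^sup>2))"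
proof -
  let ?B = "\<Sum>n. norm (b n)"
  have Hm [measurable]: "H \<in> borel_measurable borel" and Hb: "norm (H t) \<le> ?B" for t
    unfolding H_def by (rule bdry_series_measurable[OF b], rule norm_bdry_series_le[OF b])
  have B: "?B \<ge> 0" by (rule order_trans[OF norm_ge_zero Hb])
  have "(\<lambda>n. b n * (\<integral>t. H t * bdry t ^ n \<partial>cauchy_distribution)) sums (\<integral>t. H t * H t \<partial>cauchy_distribution)"
    unfolding H_def by (rule bdry_series_integral[OF b]) (use Hm Hb in \<open>auto simp: H_def\<close>)
  moreover have "b n * (\<integral>t. H t * bdry t ^ n \<partial>cauchy_distribution) = (if n = 0 then (b 0)\<^sup>2 else 0)" for n
    using bdry_series_moment[OF b, of n] by (simp add: H_def mult.commute power2_eq_square)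
  ultimately have "(\<lambda>n. if n = 0 then (b 0)\<^sup>2 else 0) sums (\<integral>t. H t * H t \<partial>cauchy_distribution)" by simp
  moreover have "(\<lambda>n. if n = 0 then (b 0)\<^sup>2 else 0) sums (b 0)\<^sup>2" by (rule sums_single)
  ultimately have sq: "(\<integral>t. H t * H t \<partial>cauchy_distribution) = (b 0)\<^sup>2" by (rule sums_unique2)
  have "(\<lambda>n. b n * (\<integral>t. cnj (H t) * bdry t ^ n \<partial>cauchy_distribution)) sums (\<integral>t. cnj (H t) * H t \<partial>cauchy_distribution)"
    unfolding H_def by (rule bdry_series_integral[OF b]) (use Hm Hb in \<open>auto simp: H_def\<close>)
  moreover have "b n * (\<integral>t. cnj (H t) * bdry t ^ n \<partial>cauchy_distribution) = of_real ((cmod (b n))\<^sup>2)" for n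
  proof -
    have "(\<integral>t. cnj (H t) * bdry t ^ n \<partial>cauchy_distribution) = (\<integral>t. cnj (cnj (bdry t ^ n) * H t) \<partial>cauchy_distribution)"
      by (simp add: mult.commute)
    also have "\<dots> = cnj (b n)"
      unfolding Bochner_Integration.integral_cnj using bdry_series_coeff[OF b, of n] by (simp add: H_def)
    finally show ?thesis using complex_norm_square[of "b n"] by simp
  qed
  ultimately have "(\<lambda>n. of_real ((cmod (b n))\<^sup>2) :: complex) sums (\<integral>t. cnj (H t) * H t \<partial>cauchy_distribution)" by simp
  then have "(\<lambda>n. (cmod (b n))\<^sup>2) sums Re (\<integral>t. cnj (H t) * H t \<partial>cauchy_distribution)"
    using sums_Re by fastforce
  moreover have "Re (\<integral>t. cnj (H t) * H t \<partial>cauchy_distribution) = 2 * (\<integral>t. (Im (H t))\<^sup>2 \<partial>cauchy_distribution) + Re ((b 0)\<^sup>2)"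
  proof -
    have i1: "integrable cauchy_distribution (\<lambda>t. cnj (H t) * H t)" "integrable cauchy_distribution (\<lambda>t. H t * H t)"
      by (rule integrable_cauchy_distribution_bounded[where B = "?B * ?B"], simp,
          use B in \<open>simp add: norm_mult mult_mono Hb\<close>)+
    have "Re (\<integral>t. cnj (H t) * H t \<partial>cauchy_distribution) - Re ((b 0)\<^sup>2)
        = (\<integral>t. Re (cnj (H t) * H t) - Re (H t * H t) \<partial>cauchy_distribution)"
      unfolding sq[symmetric] using i1 by (simp only: integral_Re Bochner_Integration.integral_diff integrable_Re)
    also have "(\<lambda>t. Re (cnj (H t) * H t) - Re (H t * H t)) = (\<lambda>t. 2 * (Im (H t))\<^sup>2)"
      by (auto simp: power2_eq_square)
    finally show ?thesis by simp
  qed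
  ultimately show ?thesis by simp
qed

lemma schwarz_kernel_expansion:
  assumes w: "norm w < 1" and e: "norm e = 1"
  shows "(\<lambda>n. (if n = 0 then 1 else 2) * w ^ n * cnj e ^ n) sums ((e + w) / (e - w))"
proof -
  have "norm (w * cnj e) < 1" using w e by (simp add: norm_mult)
  then have "(\<lambda>n. 2 * (w * cnj e) ^ n - (if n = 0 then 1 else 0)) sums (2 * (1 / (1 - w * cnj e)) - 1)"
    by (intro sums_diff sums_mult geometric_sums sums_single)
  moreover have "2 * (1 / (1 - w * cnj e)) - 1 = (e + w) / (e - w)"
  proof -
    have ee: "e * cnj e = 1" using complex_norm_square[of e] e by simp
    have ne: "e - w \<noteq> 0" "e \<noteq> 0" using w e by auto
    have "1 - w * cnj e = (e - w) * cnj e" using ee by (simp add: algebra_simps)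
    then have "1 / (1 - w * cnj e) = (e * cnj e) / ((e - w) * cnj e)" by (simp add: ee)
    also have "\<dots> = e / (e - w)" using ne by simp
    finally have "1 / (1 - w * cnj e) = e / (e - w)" .
    show ?thesis unfolding \<open>1 / (1 - w * cnj e) = e / (e - w)\<close>
      using ne by (simp add: field_simps)
  qed
  moreover have "2 * (w * cnj e) ^ n - (if n = 0 then 1 else 0) = (if n = 0 then 1 else 2) * w ^ n * cnj e ^ n" for n
    by (simp add: power_mult_distrib)
  ultimately show ?thesis by (simp only:)
qed

lemma norm_schwarz_kernel_le:
  assumes "norm w < 1"
  shows "norm ((bdry t + w) / (bdry t - w)) \<le> 2 / (1 - norm w)"
proof -
  have "norm (bdry t + w) \<le> 2" using norm_triangle_ineq[of "bdry t" w] assms by simp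
  moreover have "norm (bdry t - w) \<ge> 1 - norm w" using norm_triangle_ineq2[of "bdry t" w] by simp
  ultimately show ?thesis unfolding norm_divide using assms by (intro frac_le) auto
qed

text \<open>The Schwarz integral formula, by comparing Fourier coefficients: the kernel has the coefficients
  \<open>1, 2w, 2w\<^sup>2, \<dots>\<close>, and for \<open>n \<ge> 1\<close> the \<open>n\<close>-th coefficient of \<open>Im H\<close> is \<open>b\<^sub>n/(2i)\<close>.\<close>

lemma bdry_series_schwarz_formula:
  assumes b: "summable (\<lambda>n. norm (b n))" and w: "norm w < 1"
  defines "H \<equiv> \<lambda>t. \<Sum>n. b n * bdry t ^ n"
  shows "(\<lambda>n. b n * w ^ n) sums
    (of_real (Re (b 0)) + \<i> * (\<integral>t. (bdry t + w) / (bdry t - w) * of_real (Im (H t)) \<partial>cauchy_distribution))"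
proof -
  let ?B = "\<Sum>n. norm (b n)"
  have Hm [measurable]: "H \<in> borel_measurable borel" and Hb: "norm (H t) \<le> ?B" for t
    unfolding H_def by (rule bdry_series_measurable[OF b], rule norm_bdry_series_le[OF b])
  define p where "p = (\<lambda>n. (if n = 0 then 1 else 2) * cnj w ^ n)"
  have psum: "summable (\<lambda>n. norm (p n))"
  proof (rule summable_comparison_test'[of "\<lambda>n. 2 * norm w ^ n" 0])
    show "summable (\<lambda>n. 2 * norm w ^ n)" using w by (intro summable_mult summable_geometric) auto
  qed (auto simp: p_def norm_mult norm_power)
  have Imb: "norm (of_real (Im (H t)) :: complex) \<le> ?B" for t
    using order_trans[OF abs_Im_le_cmod Hb] by simp
  have "(\<lambda>n. p n * (\<integral>t. of_real (Im (H t)) * bdry t ^ n \<partial>cauchy_distribution)) sums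
      (\<integral>t. of_real (Im (H t)) * (\<Sum>n. p n * bdry t ^ n) \<partial>cauchy_distribution)"
    by (rule bdry_series_integral[OF psum _ Imb]) measurable
  from sums_cnj[THEN iffD2, OF this]
  have "(\<lambda>n. cnj (p n) * (\<integral>t. of_real (Im (H t)) * cnj (bdry t ^ n) \<partial>cauchy_distribution)) sums
      (\<integral>t. of_real (Im (H t)) * cnj (\<Sum>n. p n * bdry t ^ n) \<partial>cauchy_distribution)"
    by (simp flip: Bochner_Integration.integral_cnj)
  moreover have "cnj (\<Sum>n. p n * bdry t ^ n) = (bdry t + w) / (bdry t - w)" for t
  proof -
    have "cnj (p n * bdry t ^ n) = (if n = 0 then 1 else 2) * w ^ n * cnj (bdry t) ^ n" for n
      by (simp add: p_def)
    then have "(\<lambda>n. cnj (p n * bdry t ^ n)) sums ((bdry t + w) / (bdry t - w))"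
      using schwarz_kernel_expansion[OF w norm_bdry] by (simp only:)
    moreover have "(\<lambda>n. cnj (p n * bdry t ^ n)) sums cnj (\<Sum>n. p n * bdry t ^ n)"
      unfolding sums_cnj by (intro summable_sums summable_norm_cancel[OF bdry_series_summable[OF psum]])
    ultimately show ?thesis by (metis sums_unique2)
  qed
  moreover have "(\<integral>t. of_real (Im (H t)) * cnj (bdry t ^ n) \<partial>cauchy_distribution)
      = (if n = 0 then of_real (Im (b 0)) else b n / (2 * \<i>))" for n
  proof -
    have i: "integrable cauchy_distribution (\<lambda>t. cnj (bdry t ^ n) * H t)" "integrable cauchy_distribution (\<lambda>t. cnj (bdry t ^ n * H t))"
      by (rule integrable_cauchy_distribution_bounded[where B = ?B], simp, use Hb in \<open>simp add: norm_mult norm_power\<close>)+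
    have "(\<lambda>t. of_real (Im (H t)) * cnj (bdry t ^ n)) = (\<lambda>t. (cnj (bdry t ^ n) * H t - cnj (bdry t ^ n * H t)) / (2 * \<i>))"
    proof
      fix t
      have "of_real (Im (H t)) = (H t - cnj (H t)) / (2 * \<i>)"
        by (simp add: complex_eq_iff Re_divide Im_divide)
      then show "of_real (Im (H t)) * cnj (bdry t ^ n) = (cnj (bdry t ^ n) * H t - cnj (bdry t ^ n * H t)) / (2 * \<i>)"
        by (simp add: algebra_simps)
    qed
    then have "(\<integral>t. of_real (Im (H t)) * cnj (bdry t ^ n) \<partial>cauchy_distribution)
        = ((\<integral>t. cnj (bdry t ^ n) * H t \<partial>cauchy_distribution) - (\<integral>t. cnj (bdry t ^ n * H t) \<partial>cauchy_distribution)) / (2 * \<i>)"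
      using Bochner_Integration.integral_diff[OF i] by simp
    also have "\<dots> = (b n - cnj (if n = 0 then b 0 else 0)) / (2 * \<i>)"
      unfolding Bochner_Integration.integral_cnj H_def bdry_series_coeff[OF b] bdry_series_moment[OF b] ..
    also have "\<dots> = (if n = 0 then of_real (Im (b 0)) else b n / (2 * \<i>))"
      by (simp add: complex_eq_iff Re_divide Im_divide)
    finally show ?thesis .
  qed
  ultimately have S: "(\<lambda>n. cnj (p n) * (if n = 0 then of_real (Im (b 0)) else b n / (2 * \<i>))) sums
      (\<integral>t. of_real (Im (H t)) * ((bdry t + w) / (bdry t - w)) \<partial>cauchy_distribution)"
    by (simp only:)
  have "(\<lambda>n. (if n = 0 then of_real (Re (b 0)) else 0) + \<i> * (cnj (p n) * (if n = 0 then of_real (Im (b 0)) else b n / (2 * \<i>)))) sums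
     (of_real (Re (b 0)) + \<i> * (\<integral>t. of_real (Im (H t)) * ((bdry t + w) / (bdry t - w)) \<partial>cauchy_distribution))"
    by (intro sums_add sums_mult S sums_single)
  moreover have "(if n = 0 then of_real (Re (b 0)) else 0) + \<i> * (cnj (p n) * (if n = 0 then of_real (Im (b 0)) else b n / (2 * \<i>))) = b n * w ^ n" for n
    using complex_eq[of "b 0"] by (cases "n = 0") (auto simp: p_def algebra_simps)
  ultimately show ?thesis by (simp add: mult.commute)
qed

section \<open>Boundary values of holomorphic functions with bounded imaginary part\<close>

lemma disc_series:
  assumes g: "g holomorphic_on ball 0 1"
  obtains a where "\<And>w. norm w < 1 \<Longrightarrow> (\<lambda>n. a n * w ^ n) sums g w"
    "\<And>r. 0 \<le> r \<Longrightarrow> r < 1 \<Longrightarrow> summable (\<lambda>n. norm (a n * of_real r ^ n))"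
proof
  define a where "a = (\<lambda>n. (deriv ^^ n) g 0 / fact n)"
  show s: "(\<lambda>n. a n * w ^ n) sums g w" if "norm w < 1" for w
    using holomorphic_power_series[OF g, of w] that by (simp add: a_def)
  show "summable (\<lambda>n. norm (a n * of_real r ^ n))" if "0 \<le> r" "r < 1" for r
  proof -
    define q where "q = (1 + r) / 2"
    have q: "r < q" "q < 1" "0 \<le> q" using that by (auto simp: q_def)
    have "summable (\<lambda>n. a n * of_real q ^ n)" by (rule sums_summable[OF s]) (use q in simp)
    then show ?thesis by (rule powser_insidea) (use q that in simp)
  qed
qed

lemma disc_measurable:
  assumes g: "g holomorphic_on ball 0 1" and r: "0 \<le> r" "r < 1"
  shows "(\<lambda>t. g (of_real r * bdry t)) \<in> borel_measurable borel"
proof (rule borel_measurable_continuous_onI)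
  show "continuous_on UNIV (\<lambda>t. g (of_real r * bdry t))"
    by (rule continuous_on_compose2[OF holomorphic_on_imp_continuous_on[OF g]])
      (use r in \<open>auto intro!: continuous_intros continuous_on_bdry simp: norm_mult\<close>)
qed

lemma disc_schwarz_formula:
  assumes g: "g holomorphic_on ball 0 1" and r: "0 \<le> r" "r < 1" and w: "norm w < 1"
  shows "g (of_real r * w) = of_real (Re (g 0))
    + \<i> * (\<integral>t. (bdry t + w) / (bdry t - w) * of_real (Im (g (of_real r * bdry t))) \<partial>cauchy_distribution)"
proof -
  obtain a where a: "\<And>w. norm w < 1 \<Longrightarrow> (\<lambda>n. a n * w ^ n) sums g w"
    and s: "\<And>r. 0 \<le> r \<Longrightarrow> r < 1 \<Longrightarrow> summable (\<lambda>n. norm (a n * of_real r ^ n))"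
    using disc_series[OF g] by blast
  have ser: "(\<lambda>n. (a n * of_real r ^ n) * v ^ n) sums g (of_real r * v)" if "norm v \<le> 1" for v
  proof -
    have "norm v * r \<le> 1 * r" using that r by (intro mult_right_mono) auto
    then have "norm (of_real r * v) < 1" using r by (simp add: norm_mult mult.commute)
    from a[OF this] show ?thesis by (simp add: power_mult_distrib mult.assoc)
  qed
  have "g 0 = a 0" using sums_unique2[OF a[of 0] powser_sums_zero[of a]] by simp
  moreover have "(\<Sum>n. (a n * of_real r ^ n) * bdry t ^ n) = g (of_real r * bdry t)" for t
    by (rule sums_unique[symmetric], rule ser) simp
  ultimately show ?thesis
    using sums_unique2[OF ser[of w] bdry_series_schwarz_formula[OF s[OF r] w]] w by simp
qed

text \<open>By Parseval's identity the Taylor coefficients are square summable, so that the dilations of \<open>Im g\<close>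
  are a Cauchy family in \<open>L\<^sup>2\<close>.\<close>

lemma disc_Im_L2_cauchy:
  assumes g: "g holomorphic_on ball 0 1" and K: "\<And>w. norm w < 1 \<Longrightarrow> \<bar>Im (g w)\<bar> \<le> K"
  obtains S where "(S \<longlongrightarrow> 0) (at_left 1)"
    "\<And>r s. 0 \<le> r \<Longrightarrow> r < 1 \<Longrightarrow> 0 \<le> s \<Longrightarrow> s < 1 \<Longrightarrow>
      (\<integral>t. (Im (g (of_real r * bdry t)) - Im (g (of_real s * bdry t)))\<^sup>2 \<partial>cauchy_distribution) \<le> S r + S s"
proof -
  obtain a where a: "\<And>w. norm w < 1 \<Longrightarrow> (\<lambda>n. a n * w ^ n) sums g w"
    and s: "\<And>r. 0 \<le> r \<Longrightarrow> r < 1 \<Longrightarrow> summable (\<lambda>n. norm (a n * of_real r ^ n))"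
    using disc_series[OF g] by blast
  have ser: "(\<lambda>n. (a n * of_real r ^ n) * bdry t ^ n) sums g (of_real r * bdry t)" if "0 \<le> r" "r < 1" for r t
  proof -
    have "norm (of_real r * bdry t) < 1" using that by (simp add: norm_mult)
    from a[OF this] show ?thesis by (simp add: power_mult_distrib mult.assoc)
  qed
  have K0: "0 \<le> K" using K[of 0] by simp
  define C where "C = 2 * K\<^sup>2 + \<bar>Re ((a 0)\<^sup>2)\<bar>"
  have partial: "(\<Sum>n<N. (cmod (a n))\<^sup>2 * r ^ (2 * n)) \<le> C" if r: "0 \<le> r" "r < 1" for r N
  proof -
    have sm: "(\<lambda>n. (cmod (a n * of_real r ^ n))\<^sup>2) sums (2 * (\<integral>t. (Im (g (of_real r * bdry t)))\<^sup>2 \<partial>cauchy_distribution) + Re ((a 0)\<^sup>2))"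
      using bdry_series_Im_parseval[OF s[OF r]] sums_unique[OF ser[OF r]] by simp
    have "(\<Sum>n<N. (cmod (a n))\<^sup>2 * r ^ (2 * n)) = (\<Sum>n<N. (cmod (a n * of_real r ^ n))\<^sup>2)"
      using r by (simp add: norm_mult norm_power power_mult_distrib power_mult[symmetric] mult.commute)
    also have "\<dots> \<le> 2 * (\<integral>t. (Im (g (of_real r * bdry t)))\<^sup>2 \<partial>cauchy_distribution) + Re ((a 0)\<^sup>2)"
      using sum_le_suminf[OF sums_summable[OF sm], of "{..<N}"] sums_unique[OF sm] by simp
    also have "(\<integral>t. (Im (g (of_real r * bdry t)))\<^sup>2 \<partial>cauchy_distribution) \<le> (\<integral>t. K\<^sup>2 \<partial>cauchy_distribution)"
    proof (rule integral_mono)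
      have b: "(Im (g (of_real r * bdry t)))\<^sup>2 \<le> K\<^sup>2" for t
        using K[of "of_real r * bdry t"] r K0 by (intro abs_le_square_iff[THEN iffD1]) (simp add: norm_mult)
      show "integrable cauchy_distribution (\<lambda>t. (Im (g (of_real r * bdry t)))\<^sup>2)"
        by (rule integrable_cauchy_distribution_bounded[where B = "K\<^sup>2"])
          (use disc_measurable[OF g r] b in auto)
      show "(Im (g (of_real r * bdry t)))\<^sup>2 \<le> K\<^sup>2" for t by (rule b)
    qed simp
    finally show ?thesis by (simp add: C_def)
  qed
  have sum_a: "summable (\<lambda>n. (cmod (a n))\<^sup>2)"
  proof (rule bounded_imp_summable)
    fix N
    have "(\<Sum>n<Suc N. (cmod (a n))\<^sup>2 * 1 ^ (2 * n)) \<le> C"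
    proof (rule tendsto_upperbound)
      show "((\<lambda>r. \<Sum>n<Suc N. (cmod (a n))\<^sup>2 * r ^ (2 * n)) \<longlongrightarrow> (\<Sum>n<Suc N. (cmod (a n))\<^sup>2 * 1 ^ (2 * n))) (at_left (1::real))"
        by (intro tendsto_intros)
      show "\<forall>\<^sub>F r in at_left (1::real). (\<Sum>n<Suc N. (cmod (a n))\<^sup>2 * r ^ (2 * n)) \<le> C"
        using eventually_at_left_real[of 0 "1::real"] by (auto elim!: eventually_mono intro!: partial simp del: sum.lessThan_Suc)
    qed simp
    then show "(\<Sum>n\<le>N. (cmod (a n))\<^sup>2) \<le> C" by (simp add: lessThan_Suc_atMost)
  qed simp
  define S where "S = (\<lambda>r. \<Sum>n. (cmod (a n))\<^sup>2 * (1 - r ^ n)\<^sup>2)"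
  have Sb: "(cmod (a n))\<^sup>2 * (1 - r ^ n)\<^sup>2 \<le> (cmod (a n))\<^sup>2" if "0 \<le> r" "r < 1" for r n
    using that by (intro mult_left_le) (auto simp: power_le_one abs_square_le_1[symmetric])
  have Ss: "summable (\<lambda>n. (cmod (a n))\<^sup>2 * (1 - r ^ n)\<^sup>2)" if "0 \<le> r" "r < 1" for r
    by (rule summable_comparison_test'[OF sum_a, of 0]) (use Sb that in auto)
  show thesis
  proof (rule that[of S])
    have "((\<lambda>r::real. \<Sum>n. (cmod (a n))\<^sup>2 * (1 - r ^ n)\<^sup>2) \<longlongrightarrow> (\<Sum>n. (cmod (a n))\<^sup>2 * (1 - 1 ^ n)\<^sup>2)) (at_left 1)"
    proof (rule tannerys_theorem[THEN conjunct2, THEN conjunct2])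
      show "((\<lambda>r. (cmod (a n))\<^sup>2 * (1 - r ^ n)\<^sup>2) \<longlongrightarrow> (cmod (a n))\<^sup>2 * (1 - 1 ^ n)\<^sup>2) (at_left (1::real))" for n
        by (intro tendsto_intros)
      have "\<forall>\<^sub>F r in at_left (1::real). r \<in> {0<..<1}" by (rule eventually_at_left_real) simp
      then have "\<forall>\<^sub>F p in at_top \<times>\<^sub>F at_left (1::real). True \<and> snd p \<in> {0<..<1}"
        by (rule eventually_prodI[OF eventually_True])
      then show "\<forall>\<^sub>F (n, r) in at_top \<times>\<^sub>F at_left (1::real). norm ((cmod (a n))\<^sup>2 * (1 - r ^ n)\<^sup>2) \<le> (cmod (a n))\<^sup>2"
        by eventually_elim (use Sb in \<open>auto simp: case_prod_beta\<close>)
    qed (use sum_a in auto)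
    then show "(S \<longlongrightarrow> 0) (at_left 1)" by (simp add: S_def)
  next
    fix r q :: real assume r: "0 \<le> r" "r < 1" and q: "0 \<le> q" "q < 1"
    define b where "b = (\<lambda>n. a n * of_real r ^ n - a n * of_real q ^ n)"
    have bs: "summable (\<lambda>n. norm (b n))"
      by (rule summable_comparison_test'[OF summable_add[OF s[OF r] s[OF q]], of 0])
        (simp add: b_def norm_triangle_ineq4)
    have "(\<Sum>n. b n * bdry t ^ n) = g (of_real r * bdry t) - g (of_real q * bdry t)" for t
      using sums_diff[OF ser[OF r] ser[OF q], of t t] by (intro sums_unique[symmetric]) (simp add: b_def left_diff_distrib)
    moreover have "b 0 = 0" by (simp add: b_def)
    ultimately have P: "(\<lambda>n. (cmod (b n))\<^sup>2) sums
        (2 * (\<integral>t. (Im (g (of_real r * bdry t)) - Im (g (of_real q * bdry t)))\<^sup>2 \<partial>cauchy_distribution))"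
      using bdry_series_Im_parseval[OF bs] by simp
    have bn: "(cmod (b n))\<^sup>2 \<le> 2 * ((cmod (a n))\<^sup>2 * (1 - r ^ n)\<^sup>2) + 2 * ((cmod (a n))\<^sup>2 * (1 - q ^ n)\<^sup>2)" for n
    proof -
      have "b n = a n * of_real (r ^ n - q ^ n)" by (simp add: b_def right_diff_distrib)
      then have "(cmod (b n))\<^sup>2 = (cmod (a n))\<^sup>2 * (r ^ n - q ^ n)\<^sup>2"
        by (simp add: norm_mult power_mult_distrib del: of_real_diff of_real_power)
      also have "(r ^ n - q ^ n)\<^sup>2 \<le> 2 * (1 - r ^ n)\<^sup>2 + 2 * (1 - q ^ n)\<^sup>2"
        using zero_le_power2[of "(1 - r ^ n) + (1 - q ^ n)"] by (simp add: power2_eq_square algebra_simps)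
      finally show ?thesis by (simp add: distrib_left mult_left_mono mult.left_commute)
    qed
    have "2 * (\<integral>t. (Im (g (of_real r * bdry t)) - Im (g (of_real q * bdry t)))\<^sup>2 \<partial>cauchy_distribution)
        = (\<Sum>n. (cmod (b n))\<^sup>2)" by (rule sums_unique[OF P])
    also have "\<dots> \<le> (\<Sum>n. 2 * ((cmod (a n))\<^sup>2 * (1 - r ^ n)\<^sup>2) + 2 * ((cmod (a n))\<^sup>2 * (1 - q ^ n)\<^sup>2))"
      by (rule suminf_le[OF bn sums_summable[OF P]]) (intro summable_add summable_mult Ss r q)
    also have "\<dots> = 2 * S r + 2 * S q"
      using Ss[OF r] Ss[OF q] by (simp add: S_def suminf_add[symmetric] suminf_mult summable_mult)
    finally show "(\<integral>t. (Im (g (of_real r * bdry t)) - Im (g (of_real q * bdry t)))\<^sup>2 \<partial>cauchy_distribution) \<le> S r + S q"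
      by simp
  qed
qed

text \<open>Countably many functions are treated along one common sequence of radii.\<close>

lemma common_radii:
  fixes S :: "nat \<Rightarrow> real \<Rightarrow> real"
  assumes S: "\<And>k. (S k \<longlongrightarrow> 0) (at_left 1)"
  obtains \<rho> where "\<And>m. 0 \<le> \<rho> m" "\<And>m. \<rho> m < 1" "\<rho> \<longlonglongrightarrow> 1" "\<And>k m. k \<le> m \<Longrightarrow> S k (\<rho> m) \<le> (1 / 4) ^ m"
proof -
  have "\<exists>r. 0 \<le> r \<and> r < 1 \<and> 1 - 1 / real (Suc m) < r \<and> (\<forall>k\<le>m. S k r \<le> (1 / 4) ^ m)" for m
  proof -
    have "\<forall>\<^sub>F r in at_left 1. S k r \<le> (1 / 4) ^ m" for k
      using order_tendstoD(2)[OF S, of "(1 / 4) ^ m" k] by (auto elim: eventually_mono)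
    then have e1: "\<forall>\<^sub>F r in at_left 1. \<forall>k\<in>{..m}. S k r \<le> (1 / 4) ^ m"
      by (intro eventually_ball_finite) auto
    have e2: "\<forall>\<^sub>F r in at_left (1::real). r \<in> {1 - 1 / real (Suc m)<..<1}"
      by (rule eventually_at_left_real) auto
    have nn: "0 \<le> 1 - 1 / real (Suc m)" by simp
    have "\<forall>\<^sub>F r in at_left (1::real). 0 \<le> r \<and> r < 1 \<and> 1 - 1 / real (Suc m) < r \<and> (\<forall>k\<le>m. S k r \<le> (1 / 4) ^ m)"
      using e1 e2
    proof eventually_elim
      case (elim r)
      then show ?case using order_trans[OF nn less_imp_le, of r] by auto
    qed
    then show ?thesis
      using eventually_happens'[of "at_left (1::real)"] by (auto simp: trivial_limit_at_left_real)
  qed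
  then obtain \<rho> where \<rho>: "\<And>m. 0 \<le> \<rho> m" "\<And>m. \<rho> m < 1" "\<And>m. 1 - 1 / real (Suc m) < \<rho> m"
    "\<And>m k. k \<le> m \<Longrightarrow> S k (\<rho> m) \<le> (1 / 4) ^ m" by metis
  have "\<rho> \<longlonglongrightarrow> 1"
  proof (rule tendsto_sandwich)
    show "(\<lambda>m. 1 - 1 / real (Suc m)) \<longlonglongrightarrow> 1" by real_asymp
    show "\<forall>\<^sub>F m in sequentially. 1 - 1 / real (Suc m) \<le> \<rho> m" "\<forall>\<^sub>F m in sequentially. \<rho> m \<le> 1"
      using \<rho>(2,3) by (auto intro!: always_eventually less_imp_le)
  qed auto
  then show thesis using that \<rho> by blast
qed

text \<open>The \<open>L\<^sup>2\<close> bounds make the \<open>L\<^sup>1\<close> norms of the increments summable, so that the increments are absolutely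
  summable at almost every point.\<close>

lemma AE_convergent_of_L2_geometric:
  fixes u :: "nat \<Rightarrow> real \<Rightarrow> real"
  assumes [measurable]: "\<And>m. u m \<in> borel_measurable borel" and bd: "\<And>m t. \<bar>u m t\<bar> \<le> K"
    and L2: "\<And>m. k \<le> m \<Longrightarrow> (\<integral>t. (u (Suc m) t - u m t)\<^sup>2 \<partial>cauchy_distribution) \<le> 2 * (1 / 4) ^ m"
  shows "AE t in cauchy_distribution. convergent (\<lambda>m. u m t)"
proof -
  define d where "d = (\<lambda>m t. u (Suc (m + k)) t - u (m + k) t)"
  have db: "\<bar>d m t\<bar> \<le> 2 * K" for m t
    using bd[of "Suc (m + k)" t] bd[of "m + k" t] by (simp add: d_def)
  have dm [measurable]: "d m \<in> borel_measurable borel" for m unfolding d_def by measurable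
  have i1: "integrable cauchy_distribution (\<lambda>t. \<bar>d m t\<bar>)" for m
    by (rule integrable_cauchy_distribution_bounded[where B = "2 * K"]) (use db in auto)
  have i2: "integrable cauchy_distribution (\<lambda>t. (d m t)\<^sup>2)" for m
    by (rule integrable_cauchy_distribution_bounded[where B = "(2 * K)\<^sup>2"])
      (use power_mono[OF db[of m] abs_ge_zero, of _ 2] in auto)
  have L1: "(\<integral>t. \<bar>d m t\<bar> \<partial>cauchy_distribution) \<le> 2 * (1 / 2) ^ m" for m
  proof -
    \<comment> \<open>The weight \<open>2\<^sup>m\<close> balances the two terms of \<open>2\<bar>d\<bar> \<le> 2\<^sup>m d\<^sup>2 + 2\<^sup>-\<^sup>m\<close>.\<close>
    have am: "\<bar>x\<bar> \<le> (2 ^ m * x\<^sup>2 + (1 / 2) ^ m) / 2" for x :: real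
    proof -
      have "0 \<le> (1 / 2) ^ m * (2 ^ m * \<bar>x\<bar> - 1)\<^sup>2" by simp
      also have "\<dots> = ((1 / 2) ^ m * 2 ^ m) * 2 ^ m * x\<^sup>2 - 2 * ((1 / 2) ^ m * 2 ^ m) * \<bar>x\<bar> + (1 / 2) ^ m"
        by (simp add: power2_eq_square algebra_simps)
      also have "(1 / 2) ^ m * 2 ^ m = (1::real)" by (simp flip: power_mult_distrib)
      finally show ?thesis by simp
    qed
    have "(\<integral>t. \<bar>d m t\<bar> \<partial>cauchy_distribution) \<le> (\<integral>t. (2 ^ m * (d m t)\<^sup>2 + (1 / 2) ^ m) / 2 \<partial>cauchy_distribution)"
      by (intro integral_mono i1 am) (use i2 in simp)
    also have "\<dots> = (2 ^ m * (\<integral>t. (d m t)\<^sup>2 \<partial>cauchy_distribution) + (1 / 2) ^ m) / 2"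
      using i2 by simp
    also have "\<dots> \<le> (2 ^ m * (2 * (1 / 4) ^ m) + (1 / 2) ^ m) / 2"
    proof -
      have "(\<integral>t. (d m t)\<^sup>2 \<partial>cauchy_distribution) \<le> 2 * (1 / 4) ^ (m + k)"
        unfolding d_def using L2[of "m + k"] by simp
      also have "\<dots> \<le> 2 * (1 / 4) ^ m" by (simp add: power_add mult_left_le power_le_one)
      finally show ?thesis by (simp add: mult_left_mono)
    qed
    also have "2 ^ m * (2 * (1 / 4) ^ m) = (2::real) * (1 / 2) ^ m"
      by (simp flip: power_mult_distrib)
    also have "(2 * (1 / 2) ^ m + (1 / 2) ^ m) / 2 \<le> (2::real) * (1 / 2) ^ m"
    proof -
      have "(2 * h + h) / 2 \<le> 2 * h" if "0 \<le> h" for h :: real using that by simp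
      from this[of "(1 / 2) ^ m"] show ?thesis by simp
    qed
    finally show ?thesis .
  qed
  have "(\<integral>\<^sup>+t. (\<Sum>m. ennreal \<bar>d m t\<bar>) \<partial>cauchy_distribution) = (\<Sum>m. \<integral>\<^sup>+t. ennreal \<bar>d m t\<bar> \<partial>cauchy_distribution)"
    by (rule nn_integral_suminf) simp
  also have "\<dots> = (\<Sum>m. ennreal (\<integral>t. \<bar>d m t\<bar> \<partial>cauchy_distribution))"
    by (simp add: nn_integral_eq_integral[OF i1])
  also have "\<dots> \<le> (\<Sum>m. ennreal (2 * (1 / 2) ^ m))"
    by (intro suminf_le ennreal_leI L1) auto
  also have "\<dots> = ennreal (\<Sum>m. 2 * (1 / 2) ^ m)"
    by (intro suminf_ennreal2) (auto intro!: summable_mult summable_geometric)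
  also have "\<dots> < \<infinity>" by simp
  finally have "AE t in cauchy_distribution. (\<Sum>m. ennreal \<bar>d m t\<bar>) \<noteq> \<infinity>"
    by (intro nn_integral_PInf_AE) auto
  then show ?thesis
  proof eventually_elim
    case (elim t)
    then have "summable (\<lambda>m. \<bar>d m t\<bar>)" by (intro summable_suminf_not_top) auto
    then have "summable (\<lambda>m. d m t)" by (rule summable_rabs_cancel)
    then have "convergent (\<lambda>n. \<Sum>m<n. d m t)" by (simp add: summable_iff_convergent)
    moreover have "(\<Sum>m<n. d m t) = u (n + k) t - u k t" for n
      using sum_lessThan_telescope[of "\<lambda>m. u (m + k) t" n] by (simp add: d_def)
    ultimately have "convergent (\<lambda>n. u (n + k) t - u k t + u k t)"
      by (intro convergent_add convergent_const) simp
    then show ?case using convergent_ignore_initial_segment[of "\<lambda>m. u m t" k] by simp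
  qed
qed

text \<open>The Schwarz formula for the dilations of \<open>g\<close> passes to the limit by dominated convergence, and
  \<open>i (e + w)/(e - w) = (1 + tz)/(t - z)\<close> for the points \<open>e\<close>, \<open>w\<close> of the disc that correspond to \<open>t\<close>, \<open>z\<close>.\<close>

lemma disc_herglotz_representation:
  assumes g: "g holomorphic_on ball 0 1" and K: "\<And>w. norm w < 1 \<Longrightarrow> \<bar>Im (g w)\<bar> \<le> K"
    and \<rho>: "\<And>m. 0 \<le> \<rho> m" "\<And>m. \<rho> m < 1" "\<rho> \<longlonglongrightarrow> 1"
    and \<phi>: "\<phi> \<in> borel_measurable borel" "\<And>t. \<bar>\<phi> t\<bar> \<le> K"
    and lim: "AE t in lborel. (\<lambda>m. Im (g (of_real (\<rho> m) * bdry t))) \<longlonglongrightarrow> \<phi> t"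
    and z: "Im z > 0"
  shows "has_bochner_integral lborel (\<lambda>t. herglotz_kernel z t * of_real (\<phi> t / pi))
    (g ((z - \<i>) / (z + \<i>)) - of_real (Re (g 0)))"
proof -
  define w where "w = (z - \<i>) / (z + \<i>)"
  have w: "norm w < 1" using half_plane_map_inverse(1)[of \<i> z] z by (simp add: w_def)
  define k where "k = (\<lambda>t. (bdry t + w) / (bdry t - w))"
  have km [measurable]: "k \<in> borel_measurable borel" unfolding k_def by measurable
  have kb: "norm (k t) \<le> 2 / (1 - norm w)" for t unfolding k_def by (rule norm_schwarz_kernel_le[OF w])
  have gm [measurable]: "(\<lambda>t. g (of_real (\<rho> m) * bdry t)) \<in> borel_measurable borel" for m
    by (rule disc_measurable[OF g \<rho>(1,2)])
  note [measurable] = \<phi>(1)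
  let ?C = "2 / (1 - norm w) * K"
  have K0: "0 \<le> K" using K[of 0] by simp
  have bound: "norm (k t * of_real x) \<le> ?C" if "\<bar>x\<bar> \<le> K" for t x
    unfolding norm_mult using w K0 that by (intro mult_mono kb) auto
  have "(\<lambda>m. \<integral>t. k t * of_real (Im (g (of_real (\<rho> m) * bdry t))) \<partial>cauchy_distribution) \<longlonglongrightarrow>
      (\<integral>t. k t * of_real (\<phi> t) \<partial>cauchy_distribution)"
  proof (rule integral_dominated_convergence[where w = "\<lambda>_. ?C"])
    show "AE t in cauchy_distribution. (\<lambda>m. k t * of_real (Im (g (of_real (\<rho> m) * bdry t)))) \<longlonglongrightarrow> k t * of_real (\<phi> t)"
      unfolding AE_cauchy_distribution using lim by eventually_elim (intro tendsto_intros)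
    have "\<bar>Im (g (of_real (\<rho> m) * bdry t))\<bar> \<le> K" for m t
      by (rule K) (use \<rho>(1,2)[of m] in \<open>simp add: norm_mult\<close>)
    then show "AE t in cauchy_distribution. norm (k t * of_real (Im (g (of_real (\<rho> m) * bdry t)))) \<le> ?C" for m
      using bound by (intro AE_I2) auto
  qed auto
  then have L: "(\<lambda>m. of_real (Re (g 0)) + \<i> * (\<integral>t. k t * of_real (Im (g (of_real (\<rho> m) * bdry t))) \<partial>cauchy_distribution))
      \<longlonglongrightarrow> of_real (Re (g 0)) + \<i> * (\<integral>t. k t * of_real (\<phi> t) \<partial>cauchy_distribution)"
    by (intro tendsto_intros)
  have "(\<lambda>m. g (of_real (\<rho> m) * w)) \<longlonglongrightarrow> g (of_real 1 * w)"
  proof (rule isCont_tendsto_compose[where g = g])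
    show "isCont g (of_real 1 * w)"
      using holomorphic_on_imp_continuous_on[OF g] w by (simp add: continuous_on_eq_continuous_at)
    show "(\<lambda>m. of_real (\<rho> m) * w) \<longlonglongrightarrow> of_real 1 * w" by (intro tendsto_intros \<rho>(3))
  qed
  moreover have "g (of_real (\<rho> m) * w) = of_real (Re (g 0)) + \<i> * (\<integral>t. k t * of_real (Im (g (of_real (\<rho> m) * bdry t))) \<partial>cauchy_distribution)" for m
    unfolding k_def by (rule disc_schwarz_formula[OF g \<rho>(1,2) w])
  ultimately have "of_real (Re (g 0)) + \<i> * (\<integral>t. k t * of_real (\<phi> t) \<partial>cauchy_distribution) = g w"
    using LIMSEQ_unique[OF L, of "g w"] by simp
  then have gw: "g w - of_real (Re (g 0)) = \<i> * (\<integral>t. k t * of_real (\<phi> t) \<partial>cauchy_distribution)"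
    by (metis add_diff_cancel_left')
  have "has_bochner_integral lborel (\<lambda>t. k t * of_real (\<phi> t) / of_real (pi * (1 + t\<^sup>2))) (\<integral>t. k t * of_real (\<phi> t) \<partial>cauchy_distribution)"
    by (rule integral_cauchy_distribution[where B = ?C]) (use bound \<phi>(2) in auto)
  from has_bochner_integral_mult_right[OF this, of \<i>]
  have "has_bochner_integral lborel (\<lambda>t. \<i> * (k t * of_real (\<phi> t) / of_real (pi * (1 + t\<^sup>2)))) (g w - of_real (Re (g 0)))"
    unfolding gw by simp
  moreover have "\<i> * (k t * of_real (\<phi> t) / of_real (pi * (1 + t\<^sup>2))) = herglotz_kernel z t * of_real (\<phi> t / pi)" for t
  proof -
    define x where "x = complex_of_real t"
    have nz: "x + \<i> \<noteq> 0" "x - \<i> \<noteq> 0" "z + \<i> \<noteq> 0" "x - z \<noteq> 0" "1 + x\<^sup>2 \<noteq> 0"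
    proof -
      show "x + \<i> \<noteq> 0" "x - \<i> \<noteq> 0" unfolding x_def by (rule of_real_plus_i_nonzero)+
      then have "(x + \<i>) * (x - \<i>) \<noteq> 0" by simp
      then show "1 + x\<^sup>2 \<noteq> 0" by (simp add: algebra_simps power2_eq_square)
      show "z + \<i> \<noteq> 0" "x - z \<noteq> 0" using z by (auto simp: complex_eq_iff x_def)
    qed
    have p: "bdry t + w = 2 * (1 + x * z) / ((x + \<i>) * (z + \<i>))"
      using nz by (simp add: bdry_def w_def x_def[symmetric] field_simps)
    have m: "bdry t - w = 2 * \<i> * (x - z) / ((x + \<i>) * (z + \<i>))"
      using nz by (simp add: bdry_def w_def x_def[symmetric] field_simps)
    have "\<i> * k t = (1 + x * z) / (x - z)"
      unfolding k_def p m using nz by (simp del: distrib_left_numeral right_diff_distrib_numeral)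
    moreover have "herglotz_kernel z t = (1 + x * z) / (x - z) / (1 + x\<^sup>2)"
      using nz unfolding herglotz_kernel_def by (simp add: x_def[symmetric] field_simps power2_eq_square)
    ultimately have "herglotz_kernel z t = \<i> * k t / (1 + x\<^sup>2)" by simp
    then show ?thesis using nz by (simp add: x_def mult_ac)
  qed
  ultimately show ?thesis by (simp add: w_def)
qed

section \<open>Weak limits and weak integrals of operators\<close>

lemma unit_interval_bop_iff:
  fixes B :: "'a::chilbert_space bop"
  shows "0 \<le> B \<and> B \<le> 1 \<longleftrightarrow> (\<forall>x. Im (cinner (bop_apply B x) x) = 0 \<and> 0 \<le> Re (cinner (bop_apply B x) x)
    \<and> Re (cinner (bop_apply B x) x) \<le> (norm x)\<^sup>2)"
  unfolding less_eq_bop_def by (auto simp: complex_nonneg_Reals_iff cinner_simps)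

lemma unit_interval_bop_norm:
  fixes B :: "'a::chilbert_space bop"
  assumes "0 \<le> B" "B \<le> 1"
  shows "norm B \<le> 2" "B = adj B"
proof -
  have q: "Im (cinner (bop_apply B x) x) = 0" "0 \<le> Re (cinner (bop_apply B x) x)"
    "Re (cinner (bop_apply B x) x) \<le> (norm x)\<^sup>2" for x
    using assms unit_interval_bop_iff[of B] by auto
  then have "cmod (cinner (bop_apply B x) x) \<le> 1 * (norm x)\<^sup>2" for x
    by (simp add: cmod_eq_Re)
  from norm_bop_le_numerical_radius[OF this] show "norm B \<le> 2" by simp
  show "B = adj B" using q(1) by (simp add: self_adjoint_iff_quad)
qed

text \<open>By the uniform bound, convergence of the quadratic forms spreads from a dense set to all vectors, and
  by polarisation to the sesquilinear forms, whose limit is again a bounded form.\<close>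

lemma bop_weak_limit:
  fixes B :: "nat \<Rightarrow> 'a::chilbert_space bop"
  assumes B: "\<And>m. norm (B m) \<le> K"
    and dense: "\<And>x e. e > 0 \<Longrightarrow> \<exists>k. norm (x - d k) < e"
    and conv: "\<And>k. convergent (\<lambda>m. cinner (bop_apply (B m) (d k)) (d k))"
  shows "\<exists>L. \<forall>x y. (\<lambda>m. cinner (bop_apply (B m) x) y) \<longlonglongrightarrow> cinner (bop_apply L x) y"
proof -
  have K: "K \<ge> 0" using B[of 0] norm_ge_zero order_trans by blast
  have formb: "cmod (cinner (bop_apply (B m) x) y) \<le> K * norm x * norm y" for m x y
    by (rule order_trans[OF cmod_form_le]) (intro mult_right_mono B norm_ge_zero)
  have cont: "cmod (cinner (bop_apply (B m) x) x - cinner (bop_apply (B m) y) y) \<le> K * norm (x - y) * (norm x + norm y)" for m x y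
  proof -
    have "cinner (bop_apply (B m) x) x - cinner (bop_apply (B m) y) y
       = cinner (bop_apply (B m) (x - y)) x + cinner (bop_apply (B m) y) (x - y)"
      by (simp add: cinner_simps bop_apply_diff)
    also have "cmod \<dots> \<le> K * norm (x - y) * norm x + K * norm y * norm (x - y)"
      by (rule order_trans[OF norm_triangle_ineq]) (intro add_mono formb)
    finally show ?thesis by (simp add: algebra_simps)
  qed
  have quad: "convergent (\<lambda>m. cinner (bop_apply (B m) x) x)" for x
  proof -
    have "Cauchy (\<lambda>m. cinner (bop_apply (B m) x) x)"
    proof (rule metric_CauchyI)
      fix e :: real assume e: "e > 0"
      define r where "r = min 1 (e / (4 * (K + 1) * (2 * norm x + 1)))"
      have den: "4 * (K + 1) * (2 * norm x + 1) > 0" using K by (intro mult_pos_pos) (auto simp: add_nonneg_pos)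
      have r: "r > 0" using e den by (simp add: r_def)
      obtain k where k: "norm (x - d k) < r" using dense[OF r] by blast
      have nd: "norm (d k) \<le> norm x + 1"
        using norm_triangle_ineq2[of "d k" x] k by (simp add: norm_minus_commute r_def)
      have close: "cmod (cinner (bop_apply (B m) x) x - cinner (bop_apply (B m) (d k)) (d k)) \<le> e / 4" for m
      proof -
        have "K * norm (x - d k) * (norm x + norm (d k)) \<le> (K + 1) * r * (2 * norm x + 1)"
          using k nd K r by (intro mult_mono) auto
        also have "\<dots> \<le> (K + 1) * (e / (4 * (K + 1) * (2 * norm x + 1))) * (2 * norm x + 1)"
          using K by (intro mult_right_mono mult_left_mono) (auto simp: r_def)
        also have "\<dots> = e / 4"
        proof -
          have "K + 1 \<noteq> 0" "2 * norm x + 1 \<noteq> 0" using K by (auto simp: add_nonneg_eq_0_iff)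
          then show ?thesis by (simp add: divide_simps)
        qed
        finally show ?thesis using cont[of m x "d k"] by linarith
      qed
      obtain M where M: "\<And>m n. m \<ge> M \<Longrightarrow> n \<ge> M \<Longrightarrow>
          dist (cinner (bop_apply (B m) (d k)) (d k)) (cinner (bop_apply (B n) (d k)) (d k)) < e / 2"
        using convergent_Cauchy[OF conv[of k]] e unfolding Cauchy_def by (meson half_gt_zero)
      have "dist (cinner (bop_apply (B m) x) x) (cinner (bop_apply (B n) x) x) < e" if "m \<ge> M" "n \<ge> M" for m n
      proof -
        let ?q = "\<lambda>m y. cinner (bop_apply (B m) y) y"
        have "?q m x - ?q n x = (?q m x - ?q m (d k)) + ((?q m (d k) - ?q n (d k)) - (?q n x - ?q n (d k)))" by simp
        also have "cmod \<dots> \<le> cmod (?q m x - ?q m (d k)) + (cmod (?q m (d k) - ?q n (d k)) + cmod (?q n x - ?q n (d k)))"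
          by (intro order_trans[OF norm_triangle_ineq] add_left_mono norm_triangle_ineq4)
        finally show ?thesis
          using close[of m] close[of n] M[OF that] by (simp add: dist_norm)
      qed
      then show "\<exists>M. \<forall>m\<ge>M. \<forall>n\<ge>M. dist (cinner (bop_apply (B m) x) x) (cinner (bop_apply (B n) x) x) < e" by blast
    qed
    then show ?thesis by (simp add: Cauchy_convergent_iff)
  qed
  have form: "convergent (\<lambda>m. cinner (bop_apply (B m) x) y)" for x y
  proof -
    have "convergent (\<lambda>m. (1 / 4) * (4 * cinner (bop_apply (B m) x) y))"
      unfolding polarization
      by (intro convergent_mult convergent_add convergent_diff convergent_const quad)
    then show ?thesis by simp
  qed
  define b where "b = (\<lambda>x y. lim (\<lambda>m. cinner (bop_apply (B m) x) y))"
  have b: "(\<lambda>m. cinner (bop_apply (B m) x) y) \<longlonglongrightarrow> b x y" for x y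
    using form[of x y] by (simp add: b_def convergent_LIMSEQ_iff)
  have "\<exists>L. \<forall>x y. cinner (bop_apply L x) y = b x y"
  proof (rule ex_bop_of_form[where K = K])
    show "b (x + y) z = b x z + b y z" for x y z
      using LIMSEQ_unique[OF b[of "x + y" z]] tendsto_add[OF b[of x z] b[of y z]]
      by (simp add: bop_apply_add cinner_simps)
    show "b x (y + z) = b x y + b x z" for x y z
      using LIMSEQ_unique[OF b[of x "y + z"]] tendsto_add[OF b[of x y] b[of x z]]
      by (simp add: cinner_simps)
    show "b (c *\<^sub>C x) z = c * b x z" for c x z
      using LIMSEQ_unique[OF b[of "c *\<^sub>C x" z]] tendsto_mult[OF tendsto_const b[of x z], of c]
      by (simp add: bop_apply_scaleC cinner_simps)
    show "b x (c *\<^sub>C z) = cnj c * b x z" for c x z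
      using LIMSEQ_unique[OF b[of x "c *\<^sub>C z"]] tendsto_mult[OF tendsto_const b[of x z], of "cnj c"]
      by (simp add: cinner_simps)
    show "cmod (b x y) \<le> K * norm x * norm y" for x y
      by (rule LIMSEQ_le_const2[OF tendsto_norm[OF b]]) (use formb in auto)
  qed
  then show ?thesis using b by metis
qed

text \<open>Convergence at a sequence of vectors is a Borel condition on \<open>t\<close>. Where it fails the limit function is
  set to \<open>0\<close>, so that its measurability and its bounds hold without exceptional points, and at every
  single point it is \<open>0\<close> or a genuine weak limit.\<close>

lemma weak_limit_function:
  fixes B :: "nat \<Rightarrow> real \<Rightarrow> 'a::chilbert_space bop"
  assumes B: "\<And>m t. 0 \<le> B m t \<and> B m t \<le> 1"
    and meas: "\<And>m x. (\<lambda>t. cinner (bop_apply (B m t) x) x) \<in> borel_measurable borel"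
    and dense: "\<And>x e. e > 0 \<Longrightarrow> \<exists>k::nat. norm (x - d k) < e"
    and conv: "\<And>k. AE t in lborel. convergent (\<lambda>m. cinner (bop_apply (B m t) (d k)) (d k))"
  obtains \<Xi> where
    "\<And>x y. (\<lambda>t. cinner (bop_apply (\<Xi> t) x) y) \<in> borel_measurable borel"
    "\<And>t. 0 \<le> \<Xi> t" "\<And>t. \<Xi> t \<le> 1"
    "\<And>t. \<Xi> t = 0 \<or> (\<forall>x y. (\<lambda>m. cinner (bop_apply (B m t) x) y) \<longlonglongrightarrow> cinner (bop_apply (\<Xi> t) x) y)"
    "AE t in lborel. \<forall>x y. (\<lambda>m. cinner (bop_apply (B m t) x) y) \<longlonglongrightarrow> cinner (bop_apply (\<Xi> t) x) y"
proof -
  define E where "E = {t. \<forall>k. Cauchy (\<lambda>m. cinner (bop_apply (B m t) (d k)) (d k))}"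
  have Em: "E \<in> sets borel"
  proof -
    have "{t \<in> space borel. Cauchy (\<lambda>m. cinner (bop_apply (B m t) (d k)) (d k))} \<in> sets borel" for k
      by (rule sets_Collect_Cauchy) (rule meas)
    then have "(\<Inter>k. {t. Cauchy (\<lambda>m. cinner (bop_apply (B m t) (d k)) (d k))}) \<in> sets borel"
      by (intro sets.countable_INT) auto
    then show ?thesis unfolding E_def by (simp add: Collect_all_eq)
  qed
  have "\<exists>L. \<forall>x y. (\<lambda>m. cinner (bop_apply (B m t) x) y) \<longlonglongrightarrow> cinner (bop_apply L x) y" if "t \<in> E" for t
    by (rule bop_weak_limit[where K = 2 and d = d])
      (use that B dense in \<open>auto simp: E_def Cauchy_convergent_iff intro: unit_interval_bop_norm(1)\<close>)
  then obtain L where L: "\<And>t x y. t \<in> E \<Longrightarrow> (\<lambda>m. cinner (bop_apply (B m t) x) y) \<longlonglongrightarrow> cinner (bop_apply (L t) x) y"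
    by metis
  define \<Xi> where "\<Xi> = (\<lambda>t. if t \<in> E then L t else 0)"
  have ind: "(\<lambda>m. indicator E t * cinner (bop_apply (B m t) x) y) \<longlonglongrightarrow> cinner (bop_apply (\<Xi> t) x) y" for t x y
    using L[of t x y] by (auto simp: \<Xi>_def)
  show thesis
  proof (rule that[of \<Xi>])
    fix x y
    show "(\<lambda>t. cinner (bop_apply (\<Xi> t) x) y) \<in> borel_measurable borel"
    proof (rule borel_measurable_LIMSEQ_metric[OF _ ind])
      fix m
      note [measurable] = meas Em
      have "(\<lambda>t. indicator E t * ((1 / 4) * (4 * cinner (bop_apply (B m t) x) y))) \<in> borel_measurable borel"
        unfolding polarization by measurable
      then show "(\<lambda>t. indicator E t * cinner (bop_apply (B m t) x) y) \<in> borel_measurable borel" by simp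
    qed
  next
    fix t
    have "0 \<le> \<Xi> t \<and> \<Xi> t \<le> 1"
      unfolding unit_interval_bop_iff
    proof (intro allI conjI)
      fix x
      have q: "Im (cinner (bop_apply (B m t) x) x) = 0" "0 \<le> Re (cinner (bop_apply (B m t) x) x)"
        "Re (cinner (bop_apply (B m t) x) x) \<le> (norm x)\<^sup>2" for m
        using B[of m t] unit_interval_bop_iff[of "B m t"] by auto
      note li = tendsto_Im[OF ind[of t x x]] and lr = tendsto_Re[OF ind[of t x x]]
      have "(\<lambda>m. Im (indicator E t * cinner (bop_apply (B m t) x) x)) = (\<lambda>m. 0)"
        using q(1) by (auto simp: indicator_def)
      then show "Im (cinner (bop_apply (\<Xi> t) x) x) = 0" using li by (simp add: LIMSEQ_const_iff)
      show "0 \<le> Re (cinner (bop_apply (\<Xi> t) x) x)"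
        by (rule LIMSEQ_le_const[OF lr]) (use q in \<open>auto simp: indicator_def\<close>)
      show "Re (cinner (bop_apply (\<Xi> t) x) x) \<le> (norm x)\<^sup>2"
        by (rule LIMSEQ_le_const2[OF lr]) (use q in \<open>auto simp: indicator_def\<close>)
    qed
    then show "0 \<le> \<Xi> t" "\<Xi> t \<le> 1" by auto
    show "\<Xi> t = 0 \<or> (\<forall>x y. (\<lambda>m. cinner (bop_apply (B m t) x) y) \<longlonglongrightarrow> cinner (bop_apply (\<Xi> t) x) y)"
      using L[of t] by (auto simp: \<Xi>_def)
  next
    have "AE t in lborel. \<forall>k. convergent (\<lambda>m. cinner (bop_apply (B m t) (d k)) (d k))"
      using conv by (simp add: AE_all_countable)
    then show "AE t in lborel. \<forall>x y. (\<lambda>m. cinner (bop_apply (B m t) x) y) \<longlonglongrightarrow> cinner (bop_apply (\<Xi> t) x) y"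
    proof eventually_elim
      case (elim t)
      then have "t \<in> E" by (simp add: E_def Cauchy_convergent_iff)
      then show ?case using L[of t] by (simp add: \<Xi>_def)
    qed
  qed
qed

lemma has_weak_integral_unique:
  assumes "has_weak_integral M F J" "has_weak_integral M F J'"
  shows "J = J'"
proof (rule bop_eq_formI)
  show "cinner (bop_apply J x) y = cinner (bop_apply J' x) y" for x y
    by (rule has_bochner_integral_eq) (use assms in \<open>auto simp: has_weak_integral_def\<close>)
qed

lemma has_weak_integral_quadI:
  fixes F :: "'s \<Rightarrow> 'a::complex_inner bop"
  assumes "\<And>x. has_bochner_integral M (\<lambda>t. cinner (bop_apply (F t) x) x) (cinner (bop_apply J x) x)"
  shows "has_weak_integral M F J"
  unfolding has_weak_integral_def
proof (intro allI)
  fix x y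
  have "has_bochner_integral M (\<lambda>t. (1 / 4) * (4 * cinner (bop_apply (F t) x) y)) ((1 / 4) * (4 * cinner (bop_apply J x) y))"
    unfolding polarization
    by (intro has_bochner_integral_mult_right has_bochner_integral_add has_bochner_integral_diff assms)
  then show "has_bochner_integral M (\<lambda>t. cinner (bop_apply (F t) x) y) (cinner (bop_apply J x) y)" by simp
qed

lemma has_weak_integral_diff:
  "has_weak_integral M F J \<Longrightarrow> has_weak_integral M G L \<Longrightarrow> has_weak_integral M (\<lambda>t. F t - G t) (J - L)"
  unfolding has_weak_integral_def by (simp add: cinner_simps has_bochner_integral_diff)

lemma has_weak_integral_scaleC:
  "has_weak_integral M F J \<Longrightarrow> has_weak_integral M (\<lambda>t. c *\<^sub>C F t) (c *\<^sub>C J)"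
  unfolding has_weak_integral_def by (simp add: cinner_simps has_bochner_integral_mult_right)

lemma has_bochner_integral_cnj:
  assumes "has_bochner_integral M f v"
  shows "has_bochner_integral M (\<lambda>x. cnj (f x)) (cnj v)"
  using has_bochner_integral_bounded_linear[OF bounded_linear_cnj assms] .

lemma has_weak_integral_adj:
  fixes F :: "'s \<Rightarrow> 'a::chilbert_space bop"
  assumes "has_weak_integral M F J"
  shows "has_weak_integral M (\<lambda>t. adj (F t)) (adj J)"
proof (rule has_weak_integral_quadI)
  fix x
  show "has_bochner_integral M (\<lambda>t. cinner (bop_apply (adj (F t)) x) x) (cinner (bop_apply (adj J) x) x)"
    unfolding adj_quad using assms by (intro has_bochner_integral_cnj) (simp add: has_weak_integral_def)
qed

lemma has_weak_integral_lebesgue: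
  assumes "has_weak_integral lborel F J"
  shows "has_weak_integral lebesgue F J"
  unfolding has_weak_integral_def
proof (intro allI)
  fix x y
  have "has_bochner_integral lborel (\<lambda>t. cinner (bop_apply (F t) x) y) (cinner (bop_apply J x) y)"
    using assms by (simp add: has_weak_integral_def)
  moreover from this have "(\<lambda>t. cinner (bop_apply (F t) x) y) \<in> borel_measurable lborel"
    by (auto simp: has_bochner_integral_iff)
  ultimately show "has_bochner_integral lebesgue (\<lambda>t. cinner (bop_apply (F t) x) y) (cinner (bop_apply J x) y)"
    by (simp add: has_bochner_integral_iff integrable_completion integral_completion)
qed

text \<open>The integrals of the scalar forms define a bounded sesquilinear form.\<close>

lemma ex_weak_integral:
  fixes \<Xi> :: "'s \<Rightarrow> 'a::chilbert_space bop"
  assumes meas: "\<And>x y. (\<lambda>t. cinner (bop_apply (\<Xi> t) x) y) \<in> borel_measurable M"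
    and bd: "\<And>t. norm (\<Xi> t) \<le> K" and \<kappa>: "integrable M \<kappa>"
  shows "\<exists>J. has_weak_integral M (\<lambda>t. \<kappa> t *\<^sub>C \<Xi> t) J"
    and "has_weak_integral M (\<lambda>t. \<kappa> t *\<^sub>C \<Xi> t) J \<Longrightarrow> norm J \<le> K * (\<integral>t. cmod (\<kappa> t) \<partial>M)"
proof -
  note [measurable] = meas borel_measurable_integrable[OF \<kappa>]
  have fb: "cmod (\<kappa> t * cinner (bop_apply (\<Xi> t) x) y) \<le> K * norm x * norm y * cmod (\<kappa> t)" for t x y
  proof -
    have "cmod (cinner (bop_apply (\<Xi> t) x) y) \<le> K * norm x * norm y"
      by (rule order_trans[OF cmod_form_le]) (intro mult_right_mono bd norm_ge_zero)
    then show ?thesis by (simp add: norm_mult mult.commute mult_left_mono)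
  qed
  have int: "integrable M (\<lambda>t. \<kappa> t * cinner (bop_apply (\<Xi> t) x) y)" for x y
  proof (rule Bochner_Integration.integrable_bound)
    show "integrable M (\<lambda>t. K * norm x * norm y * cmod (\<kappa> t))" using \<kappa> by simp
    show "AE t in M. norm (\<kappa> t * cinner (bop_apply (\<Xi> t) x) y) \<le> norm (K * norm x * norm y * cmod (\<kappa> t))"
      by (intro AE_I2 order_trans[OF fb]) simp
  qed measurable
  define b where "b = (\<lambda>x y. \<integral>t. \<kappa> t * cinner (bop_apply (\<Xi> t) x) y \<partial>M)"
  have bb: "cmod (b x y) \<le> (K * (\<integral>t. cmod (\<kappa> t) \<partial>M)) * norm x * norm y" for x y
  proof -
    have "cmod (b x y) \<le> (\<integral>t. cmod (\<kappa> t * cinner (bop_apply (\<Xi> t) x) y) \<partial>M)"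
      unfolding b_def by (rule integral_norm_bound)
    also have "\<dots> \<le> (\<integral>t. K * norm x * norm y * cmod (\<kappa> t) \<partial>M)"
      by (intro integral_mono fb integrable_norm int) (use \<kappa> in simp)
    finally show ?thesis by (simp add: mult_ac)
  qed
  have "\<exists>J. \<forall>x y. cinner (bop_apply J x) y = b x y"
  proof (rule ex_bop_of_form[OF _ _ _ _ bb])
    show "b (x + y) z = b x z + b y z" "b x (y + z) = b x y + b x z" for x y z
      by (simp_all add: b_def bop_apply_add cinner_simps distrib_left int)
    show "b (c *\<^sub>C x) z = c * b x z" "b x (c *\<^sub>C z) = cnj c * b x z" for c x z
      by (simp_all add: b_def bop_apply_scaleC cinner_simps mult.left_commute)
  qed
  then obtain J\<^sub>0 where "\<And>x y. cinner (bop_apply J\<^sub>0 x) y = b x y" by blast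
  then have "has_weak_integral M (\<lambda>t. \<kappa> t *\<^sub>C \<Xi> t) J\<^sub>0"
    using int by (simp add: has_weak_integral_def has_bochner_integral_iff cinner_simps b_def)
  then show "\<exists>J. has_weak_integral M (\<lambda>t. \<kappa> t *\<^sub>C \<Xi> t) J" by blast
  assume J: "has_weak_integral M (\<lambda>t. \<kappa> t *\<^sub>C \<Xi> t) J"
  have Jb: "cinner (bop_apply J x) y = b x y" for x y
    using J by (auto simp: has_weak_integral_def has_bochner_integral_iff cinner_simps b_def)
  have "0 \<le> K" using bd norm_ge_zero order_trans by blast
  show "norm J \<le> K * (\<integral>t. cmod (\<kappa> t) \<partial>M)"
  proof (rule norm_bop_le)
    show "0 \<le> K * (\<integral>t. cmod (\<kappa> t) \<partial>M)" using \<open>0 \<le> K\<close> by simp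
    fix x
    have "norm (bop_apply J x) * norm (bop_apply J x) = cmod (b x (bop_apply J x))"
      unfolding Jb[symmetric] by (simp add: cinner_self power2_eq_square norm_mult)
    also note bb
    finally show "norm (bop_apply J x) \<le> K * (\<integral>t. cmod (\<kappa> t) \<partial>M) * norm x"
      using \<open>0 \<le> K\<close> by (cases "bop_apply J x = 0") auto
  qed
qed


section \<open>The logarithm of a Nevanlinna function\<close>

lemma vholomorphic_on_transform:
  assumes "f vholomorphic_on S" "\<And>z. z \<in> S \<Longrightarrow> g z = f z"
  shows "g vholomorphic_on S"
  using assms unfolding vholomorphic_on_def by (meson has_derivative_transform)

lemma nevanlinna_log_upper: "Im z > 0 \<Longrightarrow> nevanlinna_log N z = log_bop (N z)"
  by (simp add: nevanlinna_log_def upper_half_def)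

lemma nevanlinna_log_lower: "Im z < 0 \<Longrightarrow> nevanlinna_log N z = adj (nevanlinna_log N (cnj z))"
  by (simp add: nevanlinna_log_def upper_half_def lower_half_def)

lemma nevanlinna_nevanlinna_log:
  fixes N :: "complex \<Rightarrow> 'a::chilbert_space bop"
  assumes N: "nevanlinna N" and inv: "\<And>z. Im z > 0 \<Longrightarrow> bop_invertible (N z)"
  shows "nevanlinna (nevanlinna_log N)"
  unfolding nevanlinna_def
proof (intro conjI ballI)
  have "(\<lambda>z. log_bop (N z)) vholomorphic_on \<complex>\<^sub>+"
  proof (rule vholomorphic_on_compose[where G = log_bop and N = N])
    show "N vholomorphic_on \<complex>\<^sub>+" using N by (simp add: nevanlinna_def)
    fix z assume "z \<in> \<complex>\<^sub>+"
    then have z: "Im z > 0" by (simp add: upper_half_def)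
    show "\<exists>G'. (log_bop has_derivative G') (at (N z)) \<and> (\<forall>c H. G' (c *\<^sub>C H) = c *\<^sub>C G' H)"
      by (rule has_derivative_log_bop[OF dissipative_axis_resolvent_bound[OF nevanlinna_dissipative[OF N z] inv[OF z]]])
  qed
  then show "nevanlinna_log N vholomorphic_on \<complex>\<^sub>+"
    by (rule vholomorphic_on_transform) (simp add: nevanlinna_log_def)
  fix z
  show "0 \<le> Im_bop (nevanlinna_log N z)" if "z \<in> \<complex>\<^sub>+"
    using that Im_log_bop_bounds(1)[OF nevanlinna_dissipative[OF N] inv]
    by (simp add: Im_bop_ge_0_iff nevanlinna_log_def upper_half_def)
  show "nevanlinna_log N z = adj (nevanlinna_log N (cnj z))" if "z \<in> \<complex>\<^sub>-"
    using that by (intro nevanlinna_log_lower) (simp add: lower_half_def)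
qed

lemma separable_dense_sequence:
  assumes "separable_space (euclidean :: 'a::real_normed_vector topology)"
  obtains d :: "nat \<Rightarrow> 'a::real_normed_vector" where "\<And>x e. e > 0 \<Longrightarrow> \<exists>k. norm (x - d k) < e"
proof -
  obtain C :: "'a set" where C: "countable C" "euclidean closure_of C = UNIV"
    using assms by (auto simp: separable_space_def)
  have dn: "\<exists>y\<in>C. norm (x - y) < e" if "e > 0" for x e
  proof -
    have "x \<in> euclidean closure_of C" using C by simp
    then have "\<forall>T. x \<in> T \<and> openin euclidean T \<longrightarrow> (\<exists>y. y \<in> C \<and> y \<in> T)"
      unfolding in_closure_of by blast
    from this[rule_format, of "ball x e"] have "\<exists>y. y \<in> C \<and> y \<in> ball x e"
      using that by (simp add: open_openin[symmetric])
    then show ?thesis by (auto simp: dist_norm)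
  qed
  have "C \<noteq> {}" using dn[of 1 0] by auto
  then have "range (from_nat_into C) = C" using C(1) by (rule range_from_nat_into)
  then show thesis using dn by (intro that[of "from_nat_into C"]) (metis rangeE)
qed

text \<open>The Herglotz function \<open>\<Xi>\<close> is the weak boundary value of \<open>Im (log N)/\<pi>\<close> along the images of the
  radii of the disc, taken along a sequence of radii that serves a whole dense sequence of vectors.\<close>

lemma nevanlinna_log_boundary_values:
  fixes N :: "complex \<Rightarrow> 'a::chilbert_space bop"
  assumes sep: "separable_space (euclidean :: 'a topology)"
    and N: "nevanlinna N" and inv: "\<And>z. Im z > 0 \<Longrightarrow> bop_invertible (N z)"
  obtains \<Xi> \<rho> where
    "\<And>x y. (\<lambda>t. cinner (bop_apply (\<Xi> t) x) y) \<in> borel_measurable borel"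
    "\<And>t. 0 \<le> \<Xi> t" "\<And>t. \<Xi> t \<le> 1"
    "\<And>m. 0 \<le> \<rho> m" "\<And>m. \<rho> m < 1" "\<rho> \<longlonglongrightarrow> 1"
    "\<And>t. \<Xi> t = 0 \<or> (\<forall>x. (\<lambda>m. Im (cinner (bop_apply (log_bop (N (half_plane_map \<i> (of_real (\<rho> m) * bdry t)))) x) x) / pi)
      \<longlonglongrightarrow> Re (cinner (bop_apply (\<Xi> t) x) x))"
    "\<And>z. Im z > 0 \<Longrightarrow> has_weak_integral lborel (\<lambda>t. herglotz_kernel z t *\<^sub>C \<Xi> t)
      (log_bop (N z) - Re_bop (log_bop (N \<i>)))"
proof -
  define \<Lambda> where "\<Lambda> = (\<lambda>w. log_bop (N (half_plane_map \<i> w)))"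
  define g where "g = (\<lambda>x w. cinner (bop_apply (\<Lambda> w) x) x)"
  have Lhol: "nevanlinna_log N vholomorphic_on \<complex>\<^sub>+"
    using nevanlinna_nevanlinna_log[OF N inv] by (simp add: nevanlinna_def)
  have up: "Im (half_plane_map \<i> w) > 0" if "norm w < 1" for w
    using Im_half_plane_map[OF that, of \<i>] by simp
  have ghol: "g x holomorphic_on ball 0 1" for x
  proof -
    have "((\<lambda>z. cinner (bop_apply (nevanlinna_log N z) x) x) \<circ> half_plane_map \<i>) holomorphic_on ball 0 1"
      by (rule holomorphic_on_compose_gen[OF holomorphic_half_plane_map vholomorphic_on_imp_form_holomorphic[OF Lhol]])
        (use up in \<open>auto simp: upper_half_def\<close>)
    then show ?thesis
      by (rule holomorphic_transform) (use up in \<open>auto simp: g_def \<Lambda>_def nevanlinna_log_upper\<close>)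
  qed
  have Img: "0 \<le> Im (g x w)" "Im (g x w) \<le> pi * (norm x)\<^sup>2" if "norm w < 1" for x w
    using Im_log_bop_bounds[OF nevanlinna_dissipative[OF N up[OF that]] inv[OF up[OF that]], of x]
    by (simp_all add: g_def \<Lambda>_def)
  have gK: "\<bar>Im (g x w)\<bar> \<le> pi * (norm x)\<^sup>2" if "norm w < 1" for x w
    using Img[OF that, of x] by simp
  obtain d :: "nat \<Rightarrow> 'a" where dense: "\<And>x e. e > 0 \<Longrightarrow> \<exists>k. norm (x - d k) < e"
    using separable_dense_sequence[OF sep] by blast
  define D where "D = (\<lambda>k r s. \<integral>t. (Im (g (d k) (of_real r * bdry t)) - Im (g (d k) (of_real s * bdry t)))\<^sup>2 \<partial>cauchy_distribution)"
  have "\<forall>k. \<exists>S. (S \<longlongrightarrow> 0) (at_left 1) \<and> (\<forall>r s. 0 \<le> r \<longrightarrow> r < 1 \<longrightarrow> 0 \<le> s \<longrightarrow> s < 1 \<longrightarrow> D k r s \<le> S r + S s)"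
    unfolding D_def
    by (rule allI, rule disc_Im_L2_cauchy[OF ghol gK], assumption, blast)
  from choice[OF this] obtain S where S: "\<And>k. (S k \<longlongrightarrow> 0) (at_left 1)"
    and SL: "\<And>k r s. 0 \<le> r \<Longrightarrow> r < 1 \<Longrightarrow> 0 \<le> s \<Longrightarrow> s < 1 \<Longrightarrow> D k r s \<le> S k r + S k s"
    by blast
  obtain \<rho> where \<rho>: "\<And>m. 0 \<le> \<rho> m" "\<And>m. \<rho> m < 1" "\<rho> \<longlonglongrightarrow> 1" "\<And>k m. k \<le> m \<Longrightarrow> S k (\<rho> m) \<le> (1 / 4) ^ m"
  proof (rule common_radii[of S, OF S])
    fix \<rho> :: "nat \<Rightarrow> real"
    assume "\<And>m. 0 \<le> \<rho> m" "\<And>m. \<rho> m < 1" "\<rho> \<longlonglongrightarrow> 1" "\<And>k m. k \<le> m \<Longrightarrow> S k (\<rho> m) \<le> (1 / 4) ^ m"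
    then show thesis by (rule that)
  qed
  define p where "p = (\<lambda>m t. of_real (\<rho> m) * bdry t)"
  have pn: "norm (p m t) < 1" for m t using \<rho>(1,2)[of m] by (simp add: p_def norm_mult)
  have gm [measurable]: "(\<lambda>t. g x (p m t)) \<in> borel_measurable borel" for x m
    unfolding p_def by (rule disc_measurable[OF ghol \<rho>(1,2)])
  define B where "B = (\<lambda>m t. of_real (1 / pi) *\<^sub>C Im_bop (\<Lambda> (p m t)))"
  have Bq: "cinner (bop_apply (B m t) x) x = of_real (Im (g x (p m t)) / pi)" for m t x
    by (simp add: B_def cinner_simps Im_bop_quad g_def)
  have B01: "0 \<le> B m t \<and> B m t \<le> 1" for m t
    unfolding unit_interval_bop_iff Bq using Img[OF pn[of m t]] by (simp add: field_simps)
  have conv: "AE t in lborel. convergent (\<lambda>m. cinner (bop_apply (B m t) (d k)) (d k))" for k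
  proof -
    have "AE t in cauchy_distribution. convergent (\<lambda>m. Im (g (d k) (p m t)))"
    proof (rule AE_convergent_of_L2_geometric[where k = k and K = "pi * (norm (d k))\<^sup>2"])
      fix m assume m: "k \<le> m"
      have "(\<integral>t. (Im (g (d k) (p (Suc m) t)) - Im (g (d k) (p m t)))\<^sup>2 \<partial>cauchy_distribution)
          \<le> S k (\<rho> (Suc m)) + S k (\<rho> m)"
        using SL[OF \<rho>(1,2) \<rho>(1,2)] by (simp add: D_def p_def)
      also have "\<dots> \<le> (1 / 4) ^ Suc m + (1 / 4) ^ m"
        using m by (intro add_mono \<rho>(4)) auto
      also have "\<dots> \<le> 2 * (1 / 4) ^ m" by simp
      finally show "(\<integral>t. (Im (g (d k) (p (Suc m) t)) - Im (g (d k) (p m t)))\<^sup>2 \<partial>cauchy_distribution) \<le> 2 * (1 / 4) ^ m" .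
    qed (use gK pn in auto)
    then show ?thesis
      unfolding AE_cauchy_distribution Bq
    proof eventually_elim
      case (elim t)
      then obtain l where "(\<lambda>m. Im (g (d k) (p m t))) \<longlonglongrightarrow> l" by (auto simp: convergent_def)
      then have "(\<lambda>m. complex_of_real (Im (g (d k) (p m t)) / pi)) \<longlonglongrightarrow> of_real (l / pi)"
        by (intro tendsto_intros) auto
      then show ?case by (auto simp: convergent_def)
    qed
  qed
  have Bmeas: "(\<lambda>t. cinner (bop_apply (B m t) x) x) \<in> borel_measurable borel" for m x
    unfolding Bq by measurable
  obtain \<Xi> where \<Xi>: "\<And>x y. (\<lambda>t. cinner (bop_apply (\<Xi> t) x) y) \<in> borel_measurable borel"
    "\<And>t. 0 \<le> \<Xi> t" "\<And>t. \<Xi> t \<le> 1"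
    and dich: "\<And>t. \<Xi> t = 0 \<or> (\<forall>x y. (\<lambda>m. cinner (bop_apply (B m t) x) y) \<longlonglongrightarrow> cinner (bop_apply (\<Xi> t) x) y)"
    and lim: "AE t in lborel. \<forall>x y. (\<lambda>m. cinner (bop_apply (B m t) x) y) \<longlonglongrightarrow> cinner (bop_apply (\<Xi> t) x) y"
  proof (rule weak_limit_function[where B = B, OF B01 Bmeas dense conv])
    fix \<Xi> :: "real \<Rightarrow> 'a bop"
    assume "\<And>x y. (\<lambda>t. cinner (bop_apply (\<Xi> t) x) y) \<in> borel_measurable borel"
      "\<And>t. 0 \<le> \<Xi> t" "\<And>t. \<Xi> t \<le> 1"
      "\<And>t. \<Xi> t = 0 \<or> (\<forall>x y. (\<lambda>m. cinner (bop_apply (B m t) x) y) \<longlonglongrightarrow> cinner (bop_apply (\<Xi> t) x) y)"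
      "AE t in lborel. \<forall>x y. (\<lambda>m. cinner (bop_apply (B m t) x) y) \<longlonglongrightarrow> cinner (bop_apply (\<Xi> t) x) y"
    then show thesis by (rule that)
  qed
  have q: "Im (cinner (bop_apply (\<Xi> t) x) x) = 0" "0 \<le> Re (cinner (bop_apply (\<Xi> t) x) x)"
    "Re (cinner (bop_apply (\<Xi> t) x) x) \<le> (norm x)\<^sup>2" for t x
    using \<Xi>(2,3)[of t] unit_interval_bop_iff[of "\<Xi> t"] by auto
  have Re_lim: "(\<lambda>m. Im (g x (p m t)) / pi) \<longlonglongrightarrow> Re (cinner (bop_apply (\<Xi> t) x) x)"
    if "\<forall>x y. (\<lambda>m. cinner (bop_apply (B m t) x) y) \<longlonglongrightarrow> cinner (bop_apply (\<Xi> t) x) y" for x t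
    using tendsto_Re[OF that[rule_format, of x x]] by (simp add: Bq)
  show thesis
  proof (rule that[of \<Xi> \<rho>])
    fix t
    show "\<Xi> t = 0 \<or> (\<forall>x. (\<lambda>m. Im (cinner (bop_apply (log_bop (N (half_plane_map \<i> (of_real (\<rho> m) * bdry t)))) x) x) / pi)
      \<longlonglongrightarrow> Re (cinner (bop_apply (\<Xi> t) x) x))"
      using dich[of t] Re_lim[of t] by (auto simp: g_def \<Lambda>_def p_def)
  next
    fix z :: complex assume z: "Im z > 0"
    have hz: "half_plane_map \<i> ((z - \<i>) / (z + \<i>)) = z"
      using half_plane_map_inverse(2)[of \<i> z] z by simp
    have h0: "half_plane_map \<i> 0 = \<i>" by (simp add: half_plane_map_def)
    show "has_weak_integral lborel (\<lambda>t. herglotz_kernel z t *\<^sub>C \<Xi> t) (log_bop (N z) - Re_bop (log_bop (N \<i>)))"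
    proof (rule has_weak_integral_quadI)
      fix x
      define \<phi> where "\<phi> = (\<lambda>t. pi * Re (cinner (bop_apply (\<Xi> t) x) x))"
      have "has_bochner_integral lborel (\<lambda>t. herglotz_kernel z t * of_real (\<phi> t / pi))
        (g x ((z - \<i>) / (z + \<i>)) - of_real (Re (g x 0)))"
      proof (rule disc_herglotz_representation[OF ghol gK \<rho>(1-3) _ _ _ z])
        show "\<phi> \<in> borel_measurable borel" unfolding \<phi>_def using \<Xi>(1) by measurable
        show "\<bar>\<phi> t\<bar> \<le> pi * (norm x)\<^sup>2" for t using q[of t x] by (simp add: \<phi>_def abs_mult)
        show "AE t in lborel. (\<lambda>m. Im (g x (of_real (\<rho> m) * bdry t))) \<longlonglongrightarrow> \<phi> t"
          using lim
        proof eventually_elim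
          case (elim t)
          from tendsto_mult[OF tendsto_const[of pi] Re_lim[OF elim, of x]]
          show ?case by (simp add: \<phi>_def p_def)
        qed
      qed
      moreover have "of_real (\<phi> t / pi) = cinner (bop_apply (\<Xi> t) x) x" for t
        using q(1)[of t x] by (simp add: \<phi>_def complex_eq_iff)
      moreover have "g x ((z - \<i>) / (z + \<i>)) - of_real (Re (g x 0))
          = cinner (bop_apply (log_bop (N z) - Re_bop (log_bop (N \<i>))) x) x"
        by (simp add: g_def \<Lambda>_def hz h0 cinner_simps Re_bop_quad)
      ultimately show "has_bochner_integral lborel (\<lambda>t. cinner (bop_apply (herglotz_kernel z t *\<^sub>C \<Xi> t) x) x)
          (cinner (bop_apply (log_bop (N z) - Re_bop (log_bop (N \<i>))) x) x)"
        by (simp only: bop_apply_simps(6) cinner_scaleC_left)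
    qed
  qed (use \<Xi> \<rho> in auto)
qed

section \<open>Analytic continuation across an interval\<close>

text \<open>Vectors at which a nonnegative form is small are nearly annihilated by the operator.\<close>

lemma nonneg_bop_norm_sq_le:
  fixes S :: "'a::complex_inner bop"
  assumes pos: "\<And>x. 0 \<le> Re (cinner (bop_apply S x) x)"
    and sa: "\<And>x y. cinner (bop_apply S x) y = cinner x (bop_apply S y)"
  shows "(norm (bop_apply S x))\<^sup>2 \<le> (norm S + 1) * Re (cinner (bop_apply S x) x)"
proof -
  \<comment> \<open>Positivity of the form at \<open>x - Sx/k\<close>.\<close>
  define k where "k = norm S + 1"
  have k: "k > 0" by (simp add: k_def add_nonneg_pos)
  define y where "y = bop_apply S x"
  have "cinner (bop_apply S (x - (1 / k) *\<^sub>R y)) (x - (1 / k) *\<^sub>R y)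
      = cinner y x - of_real (2 / k) * cinner y y + of_real ((1 / k)\<^sup>2) * cinner (bop_apply S y) y"
    using sa[of y x] by (simp add: bop_apply_diff bop_apply_scaleR cinner_simps power2_eq_square field_simps flip: y_def)
      (simp add: diff_divide_distrib)
  then have "0 \<le> Re (cinner y x) - 2 / k * (norm y)\<^sup>2 + (1 / k)\<^sup>2 * Re (cinner (bop_apply S y) y)"
    using pos[of "x - (1 / k) *\<^sub>R y"] by (simp del: of_real_divide of_real_power)
  moreover have "Re (cinner (bop_apply S y) y) \<le> k * (norm y)\<^sup>2"
  proof -
    have "Re (cinner (bop_apply S y) y) \<le> norm S * norm y * norm y"
      by (rule order_trans[OF complex_Re_le_cmod cmod_form_le])
    also have "\<dots> \<le> k * norm y * norm y" unfolding k_def by (intro mult_right_mono) auto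
    finally show ?thesis by (simp add: power2_eq_square)
  qed
  then have "(1 / k)\<^sup>2 * Re (cinner (bop_apply S y) y) \<le> (1 / k)\<^sup>2 * (k * (norm y)\<^sup>2)"
    by (intro mult_left_mono) auto
  moreover have "(1 / k)\<^sup>2 * (k * (norm y)\<^sup>2) = (norm y)\<^sup>2 / k" using k by (simp add: power2_eq_square)
  moreover have "2 / k * (norm y)\<^sup>2 = (norm y)\<^sup>2 / k + (norm y)\<^sup>2 / k" by simp
  ultimately have "(norm y)\<^sup>2 / k \<le> Re (cinner y x)" by linarith
  then show ?thesis using k by (simp add: field_simps y_def k_def)
qed

text \<open>The infimum \<open>m\<close> of the numerical range belongs to the spectrum: the form of \<open>A - m\<close> is nonnegative and
  takes arbitrarily small values on unit vectors, so \<open>A - m\<close> is not bounded below.\<close>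

lemma self_adjoint_lower_bound_of_spectrum:
  fixes A :: "'a::chilbert_space bop"
  assumes A: "A = adj A" and sp: "spectrum A \<subseteq> of_real ` {\<epsilon><..}" and \<epsilon>: "\<epsilon> > 0"
  obtains \<delta> where "\<delta> > 0" "\<And>x. \<delta> * (norm x)\<^sup>2 \<le> Re (cinner (bop_apply A x) x)"
proof (cases "\<exists>x :: 'a. x \<noteq> 0")
  case False
  then have zero: "x = 0" for x :: 'a by blast
  have "1 * (norm x)\<^sup>2 \<le> Re (cinner (bop_apply A x) x)" for x by (simp add: zero[of x])
  then show thesis using that[of 1] by simp
next
  case True
  then obtain x\<^sub>0 :: 'a where "x\<^sub>0 \<noteq> 0" by blast
  then have x0: "norm (x\<^sub>0 /\<^sub>R norm x\<^sub>0) = 1" by simp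
  define R where "R = (\<lambda>x. Re (cinner (bop_apply A x) x)) ` {x. norm x = 1}"
  have "- norm A \<le> Re (cinner (bop_apply A x) x)" if "norm x = 1" for x
    using abs_Re_le_cmod[of "cinner (bop_apply A x) x"] cmod_form_le[of A x x] that by simp
  then have bdd: "bdd_below R" unfolding R_def by (intro bdd_belowI2[of _ "- norm A"]) auto
  have ne: "R \<noteq> {}" unfolding R_def using x0 by blast
  define m where "m = Inf R"
  have low: "m * (norm x)\<^sup>2 \<le> Re (cinner (bop_apply A x) x)" for x
  proof (cases "x = 0")
    case False
    then have "norm (x /\<^sub>R norm x) = 1" by simp
    then have "m \<le> Re (cinner (bop_apply A (x /\<^sub>R norm x)) (x /\<^sub>R norm x))"
      unfolding m_def by (intro cInf_lower bdd) (auto simp: R_def)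
    also have "\<dots> = Re (cinner (bop_apply A x) x) / (norm x)\<^sup>2"
      using False by (simp add: bop_apply_scaleR cinner_simps power2_eq_square divide_inverse flip: of_real_inverse)
    finally show ?thesis using False by (simp add: field_simps)
  qed simp
  define S where "S = A - of_real m *\<^sub>C 1"
  have S: "Re (cinner (bop_apply S x) x) = Re (cinner (bop_apply A x) x) - m * (norm x)\<^sup>2" for x
    by (simp add: S_def cinner_simps)
  have "\<not> bop_invertible S"
  proof
    assume inv: "bop_invertible S"
    define K where "K = norm (bop_inv S) + 1"
    have K: "K > 0" by (simp add: K_def add_nonneg_pos)
    define e where "e = 1 / (K\<^sup>2 * (norm S + 1))"
    have e: "e > 0" using K by (simp add: e_def add_nonneg_pos)
    obtain x where x: "norm x = 1" "Re (cinner (bop_apply A x) x) < m + e"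
      using cInf_lessD[OF ne, of "m + e"] e by (auto simp: R_def m_def)
    have sa: "cinner (bop_apply S x) y = cinner x (bop_apply S y)" for x y
      using adj_works[of A x y] A by (simp add: S_def cinner_simps)
    have "1 \<le> K * norm (bop_apply S x)"
      using bop_invertible_bounded_below[OF inv, of K x] x by (simp add: K_def)
    then have "1\<^sup>2 \<le> (K * norm (bop_apply S x))\<^sup>2" by (intro power_mono) auto
    also have "\<dots> \<le> K\<^sup>2 * ((norm S + 1) * Re (cinner (bop_apply S x) x))"
      unfolding power_mult_distrib
      by (intro mult_left_mono nonneg_bop_norm_sq_le sa) (use low S in auto)
    also have "\<dots> < K\<^sup>2 * ((norm S + 1) * e)"
      using x K S by (intro mult_strict_left_mono) (auto simp: add_nonneg_pos)
    also have "\<dots> = 1"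
    proof -
      have "norm S + 1 \<noteq> 0" by (simp add: add_nonneg_eq_0_iff)
      then show ?thesis using K by (simp add: e_def)
    qed
    finally show False by simp
  qed
  then have "of_real m \<in> spectrum A" by (simp add: spectrum_def S_def)
  then have "m > \<epsilon>" using sp by auto
  then show thesis using that[of m] low \<epsilon> by simp
qed

text \<open>Near a strictly positive operator \<open>A\<close> the imaginary part of \<open>log T\<close> is controlled by \<open>\<parallel>Im T\<parallel>\<close>, which is
  at most \<open>\<parallel>T - A\<parallel>\<close> as \<open>A\<close> is self-adjoint.\<close>

lemma Im_log_bop_tendsto_0:
  fixes T :: "nat \<Rightarrow> 'a::chilbert_space bop"
  assumes T: "T \<longlonglongrightarrow> A" and diss: "\<And>m. dissipative (T m)" and inv: "\<And>m. bop_invertible (T m)"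
    and A: "A = adj A" and \<delta>: "\<delta> > 0" and low: "\<And>x. \<delta> * (norm x)\<^sup>2 \<le> Re (cinner (bop_apply A x) x)"
  shows "(\<lambda>m. Im (cinner (bop_apply (log_bop (T m)) x) x)) \<longlonglongrightarrow> 0"
proof (rule Lim_null_comparison)
  have lim: "(\<lambda>m. norm (T m - A)) \<longlonglongrightarrow> 0"
    using tendsto_norm[OF tendsto_diff[OF T tendsto_const[of A]]] by simp
  show "(\<lambda>m. norm (T m - A) / (\<delta> / 2) * (norm x)\<^sup>2) \<longlonglongrightarrow> 0"
    using tendsto_mult[OF tendsto_divide[OF lim tendsto_const[of "\<delta> / 2"]] tendsto_const[of "(norm x)\<^sup>2"]] \<delta> by simp
  have "\<forall>\<^sub>F m in sequentially. norm (T m - A) < \<delta> / 2"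
    using order_tendstoD(2)[OF lim, of "\<delta> / 2"] \<delta> by simp
  then show "\<forall>\<^sub>F m in sequentially. norm (Im (cinner (bop_apply (log_bop (T m)) x) x)) \<le> norm (T m - A) / (\<delta> / 2) * (norm x)\<^sup>2"
  proof eventually_elim
    case (elim m)
    have split: "cinner (bop_apply (T m) y) y = cinner (bop_apply A y) y + cinner (bop_apply (T m - A) y) y" for y
      by (simp add: cinner_simps)
    have Re_split: "Re (cinner (bop_apply (T m) y) y) = Re (cinner (bop_apply A y) y) + Re (cinner (bop_apply (T m - A) y) y)"
      and Im_split: "Im (cinner (bop_apply (T m) y) y) = Im (cinner (bop_apply A y) y) + Im (cinner (bop_apply (T m - A) y) y)" for y
      unfolding split[of y] by (simp_all only: plus_complex.sel)
    have b: "cmod (cinner (bop_apply (T m - A) y) y) \<le> norm (T m - A) * (norm y)\<^sup>2" for y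
      using cmod_form_le[of "T m - A" y y] by (simp add: power2_eq_square mult.assoc)
    have re: "\<delta> / 2 * (norm y)\<^sup>2 \<le> Re (cinner (bop_apply (T m) y) y)" for y
    proof -
      have "norm (T m - A) * (norm y)\<^sup>2 \<le> \<delta> / 2 * (norm y)\<^sup>2" using elim by (intro mult_right_mono) auto
      then have "- (\<delta> / 2 * (norm y)\<^sup>2) \<le> Re (cinner (bop_apply (T m - A) y) y)"
        using abs_Re_le_cmod[of "cinner (bop_apply (T m - A) y) y"] b[of y] by linarith
      moreover have "\<delta> * (norm y)\<^sup>2 = \<delta> / 2 * (norm y)\<^sup>2 + \<delta> / 2 * (norm y)\<^sup>2" by simp
      ultimately show ?thesis using low[of y] Re_split[of y] by linarith
    qed
    have im: "Im (cinner (bop_apply (T m) y) y) \<le> norm (T m - A) * (norm y)\<^sup>2" for y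
    proof -
      have "Im (cinner (bop_apply A y) y) = 0" using A unfolding self_adjoint_iff_quad by blast
      then show ?thesis
        using Im_split[of y] abs_Im_le_cmod[of "cinner (bop_apply (T m - A) y) y"] b[of y] by linarith
    qed
    have "Im (cinner (bop_apply (log_bop (T m)) x) x) \<le> \<bar>norm (T m - A)\<bar> / (\<delta> / 2) * (norm x)\<^sup>2"
      by (rule Im_log_bop_le_of_Re_bound[OF diss inv _ re im]) (use \<delta> in simp)
    then show ?case using Im_log_bop_bounds(1)[OF diss inv, of m x] by simp
  qed
qed

lemma continuation_isCont:
  assumes "continuation_by_reflection N I M" "s \<in> I"
  shows "isCont M (of_real s)"
    and "\<forall>\<^sub>F z in at (of_real s). Im z < 0 \<longrightarrow> M z = N z"
    and "\<And>z. Im z > 0 \<Longrightarrow> M z = N z"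
proof -
  obtain \<O> where \<O>: "open \<O>" "of_real s \<in> \<O>" "M vholomorphic_on (\<complex>\<^sub>+ \<union> \<O>)"
    "\<And>z. z \<in> \<complex>\<^sub>+ \<Longrightarrow> M z = N z" "\<And>z. z \<in> \<O> \<inter> \<complex>\<^sub>- \<Longrightarrow> M z = N z"
    using assms unfolding continuation_by_reflection_def by blast
  have "open (\<complex>\<^sub>+ \<union> \<O>)" using \<O>(1) by (intro open_Un) (simp_all add: upper_half_def open_halfspace_Im_gt)
  then have "at (of_real s) within (\<complex>\<^sub>+ \<union> \<O>) = at (of_real s)" using \<O>(2) by (intro at_within_open) auto
  then show "isCont M (of_real s)"
    using \<O>(2,3) unfolding vholomorphic_on_def by (metis UnCI has_derivative_continuous)
  have "\<forall>\<^sub>F z in at (of_real s). z \<in> \<O>" by (rule eventually_at_in_open'[OF \<O>(1,2)])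
  then show "\<forall>\<^sub>F z in at (of_real s). Im z < 0 \<longrightarrow> M z = N z"
    by eventually_elim (use \<O>(5) in \<open>auto simp: lower_half_def\<close>)
  show "M z = N z" if "Im z > 0" for z using \<O>(4) that by (simp add: upper_half_def)
qed

text \<open>On the real axis the continuation is self-adjoint, since its values are limits of \<open>N\<close> both from above
  and, through \<open>N(z) = N(cnj z)\<^sup>*\<close>, from below.\<close>

lemma continuation_self_adjoint:
  fixes N :: "complex \<Rightarrow> 'a::chilbert_space bop"
  assumes N: "nevanlinna N" and M: "continuation_by_reflection N I M" and s: "s \<in> I"
  shows "M (of_real s) = adj (M (of_real s))"
proof -
  note c = continuation_isCont[OF M s]
  define u where "u = (\<lambda>n. Complex s (1 / real (Suc n)))"
  have u: "u \<longlonglongrightarrow> of_real s"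
    using tendsto_Complex[OF tendsto_const[of s] LIMSEQ_inverse_real_of_nat]
    by (simp add: u_def inverse_eq_divide complex_of_real_def)
  have v: "(\<lambda>n. cnj (u n)) \<longlonglongrightarrow> of_real s" using tendsto_cnj[OF u] by simp
  have l1: "(\<lambda>n. adj (M (u n))) \<longlonglongrightarrow> adj (M (of_real s))"
    by (rule bounded_linear.tendsto[OF bounded_linear_adj isCont_tendsto_compose[OF c(1) u]])
  have l2: "(\<lambda>n. M (cnj (u n))) \<longlonglongrightarrow> M (of_real s)"
    by (rule isCont_tendsto_compose[OF c(1) v])
  have "\<forall>\<^sub>F n in sequentially. adj (M (u n)) = M (cnj (u n))"
  proof -
    have "filterlim (\<lambda>n. cnj (u n)) (at (of_real s)) sequentially"
      using v by (intro filterlim_atI) (auto simp: u_def complex_eq_iff)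
    from eventually_compose_filterlim[OF c(2) this]
    show ?thesis
    proof eventually_elim
      case (elim n)
      have "Im (cnj (u n)) < 0" by (simp add: u_def)
      then have "M (cnj (u n)) = N (cnj (u n))" using elim by blast
      also have "\<dots> = adj (N (u n))"
        using N by (simp add: nevanlinna_def lower_half_def u_def)
      also have "N (u n) = M (u n)" using c(3)[of "u n"] by (simp add: u_def)
      finally show ?case by (rule sym)
    qed
  qed
  from LIMSEQ_unique[OF l2 Lim_transform_eventually[OF l1 this]] show ?thesis .
qed

text \<open>\<open>d\<close> bounds from below the distance of \<open>z\<close> to the complement of \<open>I\<close> in the real line, where the
  function \<open>\<Xi>\<close> is supported.\<close>

definition off_distance :: "real set \<Rightarrow> real \<Rightarrow> complex \<Rightarrow> bool"
  where "off_distance I d z \<longleftrightarrow> d > 0 \<and> (\<forall>t. t \<notin> I \<longrightarrow> d \<le> cmod (of_real t - z))"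

lemma off_distance_exists:
  assumes I: "open I" and z: "Im z \<noteq> 0 \<or> Re z \<in> I"
  obtains d where "off_distance I d z"
proof (cases "Im z = 0")
  case True
  then obtain e where e: "e > 0" "ball (Re z) e \<subseteq> I"
    using I z open_contains_ball by blast
  have "e \<le> cmod (of_real t - z)" if "t \<notin> I" for t
  proof -
    have "t \<notin> ball (Re z) e" using e that by blast
    then have "e \<le> \<bar>Re (of_real t - z)\<bar>" by (simp add: dist_real_def abs_minus_commute)
    then show ?thesis using abs_Re_le_cmod order_trans by blast
  qed
  then show thesis using that e(1) unfolding off_distance_def by blast
next
  case False
  have "\<bar>Im z\<bar> \<le> cmod (of_real t - z)" for t
    using abs_Im_le_cmod[of "of_real t - z"] by simp
  then show thesis using that[of "\<bar>Im z\<bar>"] False unfolding off_distance_def by simp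
qed

lemma off_distance_near:
  assumes "off_distance I d z" "norm (w - z) \<le> d / 2"
  shows "off_distance I (d / 2) w"
  unfolding off_distance_def
proof (intro conjI allI impI)
  show "d / 2 > 0" using assms by (simp add: off_distance_def)
  fix t assume "t \<notin> I"
  then have "d \<le> cmod (of_real t - z)" using assms by (simp add: off_distance_def)
  also have "\<dots> \<le> cmod (of_real t - w) + cmod (w - z)"
    using norm_triangle_ineq[of "of_real t - w" "w - z"] by simp
  finally show "d / 2 \<le> cmod (of_real t - w)" using assms(2) by linarith
qed

lemma integrable_inverse_square: "integrable lborel (\<lambda>t::real. c / (1 + t\<^sup>2))"
proof -
  have "(\<lambda>t::real. c / (1 + t\<^sup>2)) = (\<lambda>t. (c * pi) * (1 / (pi * (1 + t\<^sup>2))))" by simp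
  then show ?thesis using cauchy_density_integral(1) by (simp only: integrable_mult_right)
qed

text \<open>The Herglotz kernel without its singularity at a point \<open>z\<close> of \<open>I\<close>.\<close>

definition cut_kernel :: "real set \<Rightarrow> complex \<Rightarrow> real \<Rightarrow> complex"
  where "cut_kernel I z t = indicator (- I) t * herglotz_kernel z t"

definition cut_kernel_deriv :: "real set \<Rightarrow> complex \<Rightarrow> real \<Rightarrow> complex"
  where "cut_kernel_deriv I z t = indicator (- I) t / (of_real t - z)\<^sup>2"

lemma inverse_dist_square_le:
  assumes "off_distance I d z" "t \<notin> I"
  shows "1 / (cmod (of_real t - z))\<^sup>2 \<le> (2 + (1 + 2 * (cmod z)\<^sup>2) / d\<^sup>2) / (1 + t\<^sup>2)"
proof -
  define q where "q = cmod (of_real t - z)"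
  define c where "c = 2 + (1 + 2 * (cmod z)\<^sup>2) / d\<^sup>2"
  have d: "d > 0" "d \<le> q" using assms by (auto simp: off_distance_def q_def)
  have t1: "0 < 1 + t\<^sup>2" by (simp add: add_pos_nonneg)
  have "\<bar>t\<bar> \<le> q + cmod z"
    using norm_triangle_ineq[of "of_real t - z" z] by (simp add: q_def)
  then have "t\<^sup>2 \<le> (q + cmod z)\<^sup>2" by (metis abs_ge_zero power2_abs power_mono)
  also have "\<dots> \<le> 2 * q\<^sup>2 + 2 * (cmod z)\<^sup>2"
    using zero_le_power2[of "q - cmod z"] by (simp add: power2_eq_square algebra_simps)
  finally have "1 + t\<^sup>2 \<le> 2 * q\<^sup>2 + (1 + 2 * (cmod z)\<^sup>2) * 1" by simp
  also have "1 \<le> q\<^sup>2 / d\<^sup>2" using d power_mono[of d q 2] by (simp add: field_simps)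
  then have "2 * q\<^sup>2 + (1 + 2 * (cmod z)\<^sup>2) * 1 \<le> 2 * q\<^sup>2 + (1 + 2 * (cmod z)\<^sup>2) * (q\<^sup>2 / d\<^sup>2)"
    by (intro add_left_mono mult_left_mono) (auto simp: add_nonneg_nonneg)
  also have "\<dots> = (2 + (1 + 2 * (cmod z)\<^sup>2) / d\<^sup>2) * q\<^sup>2" by (simp add: algebra_simps add_divide_distrib)
  finally have "1 + t\<^sup>2 \<le> c * q\<^sup>2" by (simp only: c_def)
  moreover have "q\<^sup>2 > 0" using d by simp
  ultimately show ?thesis unfolding q_def[symmetric] c_def[symmetric]
    using t1 by (simp add: divide_le_eq le_divide_eq)
qed

lemma integrable_cut_kernel:
  assumes I: "open I" and z: "off_distance I d z"
  shows "integrable lborel (cut_kernel I z)"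
proof (rule Bochner_Integration.integrable_bound[OF integrable_inverse_square])
  have [measurable]: "I \<in> sets borel" using I by simp
  show "cut_kernel I z \<in> borel_measurable lborel"
    unfolding cut_kernel_def herglotz_kernel_def by measurable
  show "AE t in lborel. norm (cut_kernel I z t) \<le> norm ((cmod z + cmod (1 + z\<^sup>2) / d) / (1 + t\<^sup>2))"
  proof (rule AE_I2)
    fix t :: real
    have d: "d > 0" using z by (simp add: off_distance_def)
    have t1: "0 < 1 + t\<^sup>2" by (simp add: add_pos_nonneg)
    show "norm (cut_kernel I z t) \<le> norm ((cmod z + cmod (1 + z\<^sup>2) / d) / (1 + t\<^sup>2))"
    proof (cases "t \<in> I")
      case False
      define x where "x = complex_of_real t"
      have dx: "d \<le> cmod (x - z)" using z False by (simp add: off_distance_def x_def)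
      have nz: "x - z \<noteq> 0" "1 + x\<^sup>2 \<noteq> 0"
      proof -
        show "x - z \<noteq> 0" using d dx by auto
        have "1 + x\<^sup>2 = of_real (1 + t\<^sup>2)" by (simp add: x_def)
        then show "1 + x\<^sup>2 \<noteq> 0" using t1 by (metis of_real_eq_0_iff less_irrefl)
      qed
      have "herglotz_kernel z t = (z + (1 + z\<^sup>2) / (x - z)) / (1 + x\<^sup>2)"
        using nz unfolding herglotz_kernel_def by (simp add: x_def[symmetric] field_simps power2_eq_square)
      then have "cmod (herglotz_kernel z t) = cmod (z + (1 + z\<^sup>2) / (x - z)) / (1 + t\<^sup>2)"
      proof -
        have "cmod (1 + x\<^sup>2) = cmod (of_real (1 + t\<^sup>2))" by (simp add: x_def)
        also have "\<dots> = 1 + t\<^sup>2" using t1 unfolding norm_of_real by simp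
        finally show ?thesis using \<open>herglotz_kernel z t = _\<close> by (simp add: norm_divide)
      qed
      also have "\<dots> \<le> (cmod z + cmod (1 + z\<^sup>2) / d) / (1 + t\<^sup>2)"
      proof (intro divide_right_mono order_trans[OF norm_triangle_ineq] add_left_mono)
        show "cmod ((1 + z\<^sup>2) / (x - z)) \<le> cmod (1 + z\<^sup>2) / d"
          unfolding norm_divide using d dx by (intro divide_left_mono mult_pos_pos) auto
      qed (use t1 in auto)
      finally show ?thesis using False d t1 by (simp add: cut_kernel_def)
    qed (simp add: cut_kernel_def)
  qed
qed

lemma integrable_cut_kernel_deriv:
  assumes I: "open I" and z: "off_distance I d z"
  shows "integrable lborel (cut_kernel_deriv I z)"
    and "cmod (cut_kernel_deriv I z t) \<le> (2 + (1 + 2 * (cmod z)\<^sup>2) / d\<^sup>2) / (1 + t\<^sup>2)"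
proof -
  have [measurable]: "I \<in> sets borel" using I by simp
  have t1: "0 < 1 + t\<^sup>2" for t :: real by (simp add: add_pos_nonneg)
  have b: "cmod (cut_kernel_deriv I z t) \<le> (2 + (1 + 2 * (cmod z)\<^sup>2) / d\<^sup>2) / (1 + t\<^sup>2)" for t
    using inverse_dist_square_le[OF z, of t] t1[of t]
    by (cases "t \<in> I") (auto simp: cut_kernel_deriv_def norm_divide norm_power add_nonneg_nonneg)
  then show "cmod (cut_kernel_deriv I z t) \<le> (2 + (1 + 2 * (cmod z)\<^sup>2) / d\<^sup>2) / (1 + t\<^sup>2)" .
  show "integrable lborel (cut_kernel_deriv I z)"
  proof (rule Bochner_Integration.integrable_bound[OF integrable_inverse_square])
    show "cut_kernel_deriv I z \<in> borel_measurable lborel"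
      unfolding cut_kernel_deriv_def by measurable
    show "AE t in lborel. norm (cut_kernel_deriv I z t) \<le> norm ((2 + (1 + 2 * (cmod z)\<^sup>2) / d\<^sup>2) / (1 + t\<^sup>2))"
      by (intro AE_I2 order_trans[OF b]) simp
  qed
qed

lemma cut_kernel_remainder:
  assumes z: "off_distance I d z" and w: "norm (w - z) \<le> d / 2"
  shows "cmod (cut_kernel I w t - cut_kernel I z t - (w - z) * cut_kernel_deriv I z t)
    \<le> (norm (w - z))\<^sup>2 * (2 / d) * cmod (cut_kernel_deriv I z t)"
proof (cases "t \<in> I")
  case False
  have dz: "d > 0" "d \<le> cmod (of_real t - z)" using z False by (auto simp: off_distance_def)
  have dw: "d / 2 \<le> cmod (of_real t - w)" using off_distance_near[OF z w] False by (auto simp: off_distance_def)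
  have nz: "of_real t - z \<noteq> 0" "of_real t - w \<noteq> 0" using dz dw by auto
  have "cut_kernel I w t - cut_kernel I z t - (w - z) * cut_kernel_deriv I z t
      = (w - z)\<^sup>2 * (1 / (of_real t - w)) * cut_kernel_deriv I z t"
  proof -
    have "1 / (x - w) - 1 / (x - z) - (w - z) * (1 / (x - z)\<^sup>2) = (w - z)\<^sup>2 * (1 / (x - w)) * (1 / (x - z)\<^sup>2)"
      if "x - z \<noteq> 0" "x - w \<noteq> 0" for x
      using that by (simp add: divide_simps power2_eq_square) (simp add: algebra_simps)
    from this[OF nz] show ?thesis
      using False by (simp add: cut_kernel_def cut_kernel_deriv_def herglotz_kernel_def)
  qed
  also have "cmod \<dots> \<le> (norm (w - z))\<^sup>2 * (2 / d) * cmod (cut_kernel_deriv I z t)"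
  proof -
    have "1 / cmod (of_real t - w) \<le> 1 / (d / 2)"
      by (rule frac_le) (use dz dw in auto)
    then have "cmod (1 / (of_real t - w)) \<le> 2 / d" by (simp add: norm_divide)
    then show ?thesis unfolding norm_mult norm_power by (intro mult_right_mono mult_left_mono) auto
  qed
  finally show ?thesis .
qed (simp add: cut_kernel_def cut_kernel_deriv_def)

text \<open>Differentiation under the weak integral: the norm of the remainder is at most a constant times the
  \<open>L\<^sup>1\<close> norm of the remainder of the kernel.\<close>

lemma weak_integral_cut_kernel_vholomorphic:
  fixes \<Xi> :: "real \<Rightarrow> 'a::chilbert_space bop"
  assumes I: "open I" and meas: "\<And>x y. (\<lambda>t. cinner (bop_apply (\<Xi> t) x) y) \<in> borel_measurable borel"
    and bd: "\<And>t. norm (\<Xi> t) \<le> K"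
    and W: "\<And>z. Im z \<noteq> 0 \<or> Re z \<in> I \<Longrightarrow> has_weak_integral lborel (\<lambda>t. cut_kernel I z t *\<^sub>C \<Xi> t) (W z)"
  shows "W vholomorphic_on {z. Im z \<noteq> 0 \<or> Re z \<in> I}"
  unfolding vholomorphic_on_def
proof
  fix z assume "z \<in> {z. Im z \<noteq> 0 \<or> Re z \<in> I}"
  then have zI: "Im z \<noteq> 0 \<or> Re z \<in> I" by simp
  then obtain d where z: "off_distance I d z" using off_distance_exists[OF I] by blast
  have meas': "(\<lambda>t. cinner (bop_apply (\<Xi> t) x) y) \<in> borel_measurable lborel" for x y using meas by simp
  obtain D where D: "has_weak_integral lborel (\<lambda>t. cut_kernel_deriv I z t *\<^sub>C \<Xi> t) D"
    using ex_weak_integral(1)[OF meas' bd integrable_cut_kernel_deriv(1)[OF I z]] by blast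
  have K: "0 \<le> K" using bd[of 0] norm_ge_zero order_trans by blast
  define C where "C = K * ((2 / d) * (\<integral>t. cmod (cut_kernel_deriv I z t) \<partial>lborel))"
  have "(W has_derivative (\<lambda>h. h *\<^sub>C D)) (at z)"
  proof (rule has_derivative_quadratic_remainder[OF bounded_linear_scaleC_left, where d = "d / 2" and C = C])
    show "d / 2 > 0" using z by (simp add: off_distance_def)
    fix w assume "norm (w - z) < d / 2"
    then have w: "norm (w - z) \<le> d / 2" by simp
    have wI: "Im w \<noteq> 0 \<or> Re w \<in> I"
    proof (rule ccontr)
      assume "\<not> (Im w \<noteq> 0 \<or> Re w \<in> I)"
      then have "Re w \<notin> I" "of_real (Re w) = w" by (auto simp: complex_eq_iff)
      then show False using off_distance_near[OF z w] by (force simp: off_distance_def)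
    qed
    define \<kappa> where "\<kappa> = (\<lambda>t. cut_kernel I w t - cut_kernel I z t - (w - z) * cut_kernel_deriv I z t)"
    have \<kappa>: "integrable lborel \<kappa>"
      unfolding \<kappa>_def
      using integrable_cut_kernel[OF I off_distance_near[OF z w]] integrable_cut_kernel[OF I z]
        integrable_cut_kernel_deriv(1)[OF I z] by simp
    have "has_weak_integral lborel (\<lambda>t. cut_kernel I w t *\<^sub>C \<Xi> t - cut_kernel I z t *\<^sub>C \<Xi> t
        - (w - z) *\<^sub>C (cut_kernel_deriv I z t *\<^sub>C \<Xi> t)) (W w - W z - (w - z) *\<^sub>C D)"
      by (intro has_weak_integral_diff has_weak_integral_scaleC W wI zI D)
    moreover have "cut_kernel I w t *\<^sub>C \<Xi> t - cut_kernel I z t *\<^sub>C \<Xi> t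
        - (w - z) *\<^sub>C (cut_kernel_deriv I z t *\<^sub>C \<Xi> t) = \<kappa> t *\<^sub>C \<Xi> t" for t
      by (rule bop_eqI)
        (simp add: \<kappa>_def scaleC_scaleC scaleC_minus_left scaleC_add_left diff_conv_add_uminus del: add_uminus_conv_diff)
    ultimately have "has_weak_integral lborel (\<lambda>t. \<kappa> t *\<^sub>C \<Xi> t) (W w - W z - (w - z) *\<^sub>C D)" by simp
    from ex_weak_integral(2)[OF meas' bd \<kappa> this]
    have "norm (W w - W z - (w - z) *\<^sub>C D) \<le> K * (\<integral>t. cmod (\<kappa> t) \<partial>lborel)" .
    also have "\<dots> \<le> K * (\<integral>t. (norm (w - z))\<^sup>2 * (2 / d) * cmod (cut_kernel_deriv I z t) \<partial>lborel)"
    proof (intro mult_left_mono[OF _ K] integral_mono)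
      show "integrable lborel (\<lambda>t. cmod (\<kappa> t))" using \<kappa> by simp
      show "integrable lborel (\<lambda>t. (norm (w - z))\<^sup>2 * (2 / d) * cmod (cut_kernel_deriv I z t))"
        using integrable_cut_kernel_deriv(1)[OF I z] by simp
      show "cmod (\<kappa> t) \<le> (norm (w - z))\<^sup>2 * (2 / d) * cmod (cut_kernel_deriv I z t)" for t
        unfolding \<kappa>_def by (rule cut_kernel_remainder[OF z w])
    qed
    also have "\<dots> = C * (norm (w - z))\<^sup>2" by (simp add: C_def mult_ac)
    finally show "norm (W w - W z - (w - z) *\<^sub>C D) \<le> C * (norm (w - z))\<^sup>2" .
  qed
  then show "\<exists>D. (W has_derivative (\<lambda>h. h *\<^sub>C D)) (at z within {z. Im z \<noteq> 0 \<or> Re z \<in> I})"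
    using has_derivative_at_withinI by blast
qed


section \<open>The integral representation\<close>

lemma cnj_herglotz_kernel: "cnj (herglotz_kernel z t) = herglotz_kernel (cnj z) t"
  by (simp add: herglotz_kernel_def)

theorem theorem3p3:
  fixes N :: "complex \<Rightarrow> 'g::chilbert_space bop"
  assumes "separable_space (euclidean :: 'g topology)"
    and "nevanlinna N"
    and "\<exists>z. z \<notin> \<real> \<and> bop_invertible (N z)"
  shows "(\<forall>z. z \<notin> \<real> \<longrightarrow> bop_invertible (N z)) \<and> nevanlinna (nevanlinna_log N) \<and>
    (\<exists>(\<Xi> :: real \<Rightarrow> 'g bop) C.
      weakly_measurable lebesgue \<Xi> \<and>
      (AE t in lebesgue. \<Xi> t = adj (\<Xi> t) \<and> 0 \<le> \<Xi> t \<and> \<Xi> t \<le> 1) \<and>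
      C = Re_bop (nevanlinna_log N \<i>) \<and> self_adjoint C \<and>
      (\<forall>z. z \<notin> \<real> \<longrightarrow>
        (\<exists>J. has_weak_integral lebesgue (\<lambda>t. herglotz_kernel z t *\<^sub>C \<Xi> t) J \<and>
             nevanlinna_log N z = C + J)) \<and>
      (\<forall>(I :: real set) (\<epsilon> :: real) M.
        open I \<and> is_interval I \<and> continuation_by_reflection N I M \<and>
        0 < \<epsilon> \<and> (\<forall>s\<in>I. spectrum (M (of_real s)) \<subseteq> of_real ` {\<epsilon><..}) \<longrightarrow>
        (\<exists>L. continuation_by_reflection (nevanlinna_log N) I L \<and>
             (\<forall>s\<in>I. \<exists>J. has_weak_integral lebesgue
                           (\<lambda>t. herglotz_kernel (of_real s) t *\<^sub>C \<Xi> t) J \<and>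
                         L (of_real s) = C + J)) \<and>
        (AE t in lebesgue. t \<in> I \<longrightarrow> \<Xi> t = 0)))"
proof -
  note N = assms(2)
  have nonreal: "z \<notin> \<real> \<longleftrightarrow> Im z \<noteq> 0" for z by (simp add: complex_is_Real_iff)
  have invN: "bop_invertible (N z)" if "z \<notin> \<real>" for z
    using assms(3) nevanlinna_invertible[OF N _ _ that] by blast
  have inv: "bop_invertible (N z)" if "Im z > 0" for z using invN that by (simp add: nonreal)
  obtain \<Xi> \<rho> where meas: "\<And>x y. (\<lambda>t. cinner (bop_apply (\<Xi> t) x) y) \<in> borel_measurable borel"
    and \<Xi>01: "\<And>t. 0 \<le> \<Xi> t" "\<And>t. \<Xi> t \<le> 1"
    and \<rho>: "\<And>m. 0 \<le> \<rho> m" "\<And>m. \<rho> m < 1" "\<rho> \<longlonglongrightarrow> 1"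
    and bv: "\<And>t. \<Xi> t = 0 \<or> (\<forall>x. (\<lambda>m. Im (cinner (bop_apply (log_bop (N (half_plane_map \<i> (of_real (\<rho> m) * bdry t)))) x) x) / pi)
      \<longlonglongrightarrow> Re (cinner (bop_apply (\<Xi> t) x) x))"
    and rep: "\<And>z. Im z > 0 \<Longrightarrow> has_weak_integral lborel (\<lambda>t. herglotz_kernel z t *\<^sub>C \<Xi> t)
      (log_bop (N z) - Re_bop (log_bop (N \<i>)))"
    using nevanlinna_log_boundary_values[OF assms(1) N inv] by blast
  note \<Xi>n = unit_interval_bop_norm[OF \<Xi>01]
  define C where "C = Re_bop (nevanlinna_log N \<i>)"
  have Cadj: "C = adj C"
    unfolding C_def self_adjoint_iff_quad by (simp add: Re_bop_quad)
  have Ci: "C = Re_bop (log_bop (N \<i>))" by (simp add: C_def nevanlinna_log_upper)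
  have repr: "has_weak_integral lborel (\<lambda>t. herglotz_kernel z t *\<^sub>C \<Xi> t) (nevanlinna_log N z - C)" if "Im z \<noteq> 0" for z
  proof (cases "Im z > 0")
    case True
    then show ?thesis using rep by (simp add: nevanlinna_log_upper Ci)
  next
    case False
    then have z: "Im z < 0" using that by simp
    have "has_weak_integral lborel (\<lambda>t. herglotz_kernel (cnj z) t *\<^sub>C \<Xi> t) (nevanlinna_log N (cnj z) - C)"
      using rep[of "cnj z"] z by (simp add: nevanlinna_log_upper Ci)
    from has_weak_integral_adj[OF this] show ?thesis
      using nevanlinna_log_lower[OF z, of N] Cadj \<Xi>n(2)
      by (simp add: adj_scaleC adj_diff cnj_herglotz_kernel flip: \<Xi>n(2))
  qed
  have cont: "(\<exists>L. continuation_by_reflection (nevanlinna_log N) I L \<and>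
        (\<forall>s\<in>I. \<exists>J. has_weak_integral lebesgue (\<lambda>t. herglotz_kernel (of_real s) t *\<^sub>C \<Xi> t) J \<and> L (of_real s) = C + J)) \<and>
      (AE t in lebesgue. t \<in> I \<longrightarrow> \<Xi> t = 0)"
    if I: "open I" and M: "continuation_by_reflection N I M" and \<epsilon>: "0 < \<epsilon>"
      and sp: "\<forall>s\<in>I. spectrum (M (of_real s)) \<subseteq> of_real ` {\<epsilon><..}" for I \<epsilon> M
  proof -
    \<comment> \<open>Every point of \<open>I\<close> is covered, not only almost every one: a nonzero \<open>\<Xi> t\<close> is a weak limit of
      \<open>Im (log N)/\<pi>\<close> along points \<open>z m\<close> that tend to \<open>t\<close>, and these values tend to \<open>0\<close>.\<close>
    have zero: "\<Xi> t = 0" if t: "t \<in> I" for t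
    proof (rule ccontr)
      assume nz: "\<Xi> t \<noteq> 0"
      note c = continuation_isCont[OF M t]
      have sa: "M (of_real t) = adj (M (of_real t))" by (rule continuation_self_adjoint[OF N M t])
      obtain \<delta> where \<delta>: "\<delta> > 0" "\<And>x. \<delta> * (norm x)\<^sup>2 \<le> Re (cinner (bop_apply (M (of_real t)) x) x)"
        using self_adjoint_lower_bound_of_spectrum[OF sa _ \<epsilon>] sp t by blast
      define z where "z = (\<lambda>m. half_plane_map \<i> (of_real (\<rho> m) * bdry t))"
      have z: "Im (z m) > 0" for m
        unfolding z_def by (rule Im_half_plane_map) (use \<rho>(1,2)[of m] in \<open>simp_all add: norm_mult\<close>)
      have "(\<lambda>m. of_real (\<rho> m) * bdry t) \<longlonglongrightarrow> of_real 1 * bdry t" by (intro tendsto_intros \<rho>(3))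
      then have "z \<longlonglongrightarrow> half_plane_map \<i> (bdry t)"
        unfolding z_def half_plane_map_def using half_plane_map_bdry(1)[of t] by (intro tendsto_intros) auto
      then have zlim: "z \<longlonglongrightarrow> of_real t" by (simp add: half_plane_map_bdry(2))
      have "(\<lambda>m. M (z m)) \<longlonglongrightarrow> M (of_real t)" by (rule isCont_tendsto_compose[OF c(1) zlim])
      then have Nlim: "(\<lambda>m. N (z m)) \<longlonglongrightarrow> M (of_real t)" using c(3) z by simp
      have "Re (cinner (bop_apply (\<Xi> t) x) x) = 0" for x
      proof (rule LIMSEQ_unique)
        show "(\<lambda>m. Im (cinner (bop_apply (log_bop (N (z m))) x) x) / pi) \<longlonglongrightarrow> Re (cinner (bop_apply (\<Xi> t) x) x)"
          using bv[of t] nz unfolding z_def by blast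
        show "(\<lambda>m. Im (cinner (bop_apply (log_bop (N (z m))) x) x) / pi) \<longlonglongrightarrow> 0"
          using tendsto_divide[OF Im_log_bop_tendsto_0[OF Nlim nevanlinna_dissipative[OF N z] inv[OF z] sa \<delta>, of x] tendsto_const[of pi]]
          by simp
      qed
      moreover have "Im (cinner (bop_apply (\<Xi> t) x) x) = 0" for x
        using \<Xi>n(2)[of t] unfolding self_adjoint_iff_quad by blast
      ultimately have "\<Xi> t = 0"
        by (intro cinner_bop_eq_0_imp_0) (simp add: complex_eq_iff)
      then show False using nz by simp
    qed
    have cut: "cut_kernel I z t *\<^sub>C \<Xi> t = herglotz_kernel z t *\<^sub>C \<Xi> t" for z t
      using zero[of t] by (cases "t \<in> I") (auto simp: cut_kernel_def)
    have meas': "(\<lambda>t. cinner (bop_apply (\<Xi> t) x) y) \<in> borel_measurable lborel" for x y using meas by simp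
    have "\<exists>J. has_weak_integral lborel (\<lambda>t. cut_kernel I z t *\<^sub>C \<Xi> t) J" if z: "Im z \<noteq> 0 \<or> Re z \<in> I" for z
    proof -
      obtain d where "off_distance I d z" using off_distance_exists[OF I z] by blast
      from ex_weak_integral(1)[OF meas' \<Xi>n(1) integrable_cut_kernel[OF I this]] show ?thesis .
    qed
    then obtain W where W: "\<And>z. Im z \<noteq> 0 \<or> Re z \<in> I \<Longrightarrow> has_weak_integral lborel (\<lambda>t. cut_kernel I z t *\<^sub>C \<Xi> t) (W z)"
      by metis
    define L where "L = (\<lambda>z. W z + C)"
    have L_eq: "L z = nevanlinna_log N z" if z: "Im z \<noteq> 0" for z
    proof -
      have "W z = nevanlinna_log N z - C"
        using W[of z] repr[OF z] z unfolding cut by (intro has_weak_integral_unique[of lborel]) auto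
      then show ?thesis by (simp add: L_def)
    qed
    let ?\<O> = "{z. Im z \<noteq> 0 \<or> Re z \<in> I}"
    have "open ?\<O>"
    proof -
      have "?\<O> = {z. Im z < 0} \<union> {z. Im z > 0} \<union> Re -` I" by auto
      moreover have "open (Re -` I)" by (intro continuous_open_vimage continuous_intros I)
      ultimately show ?thesis
        by (simp add: open_Un open_halfspace_Im_lt open_halfspace_Im_gt)
    qed
    moreover have "\<complex>\<^sub>+ \<union> ?\<O> = ?\<O>" by (auto simp: upper_half_def)
    moreover have "L vholomorphic_on ?\<O>"
      unfolding L_def
      by (intro vholomorphic_on_add_const weak_integral_cut_kernel_vholomorphic[OF I meas \<Xi>n(1) W])
    moreover have "complex_of_real ` I \<subseteq> ?\<O>" by auto
    ultimately have "continuation_by_reflection (nevanlinna_log N) I L"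
      unfolding continuation_by_reflection_def
      by (intro exI[of _ ?\<O>]) (auto simp: L_eq upper_half_def lower_half_def)
    moreover have "\<exists>J. has_weak_integral lebesgue (\<lambda>t. herglotz_kernel (of_real s) t *\<^sub>C \<Xi> t) J \<and> L (of_real s) = C + J"
      if s: "s \<in> I" for s
      using has_weak_integral_lebesgue[OF W[of "of_real s"]] s unfolding cut
      by (intro exI[of _ "W (of_real s)"]) (simp add: L_def add.commute)
    ultimately show ?thesis using zero by auto
  qed
  show ?thesis
  proof (intro conjI exI[of _ \<Xi>] exI[of _ C])
    show "\<forall>z. z \<notin> \<real> \<longrightarrow> bop_invertible (N z)" using invN by blast
    show "nevanlinna (nevanlinna_log N)" by (rule nevanlinna_nevanlinna_log[OF N inv])
    show "weakly_measurable lebesgue \<Xi>"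
      unfolding weakly_measurable_def using meas by (auto intro: measurable_completion)
    show "AE t in lebesgue. \<Xi> t = adj (\<Xi> t) \<and> 0 \<le> \<Xi> t \<and> \<Xi> t \<le> 1"
      by (intro AE_I2 conjI \<Xi>n(2) \<Xi>01)
    show "C = Re_bop (nevanlinna_log N \<i>)" by (rule C_def)
    show "self_adjoint C" using Cadj by (simp add: self_adjoint_def)
    show "\<forall>z. z \<notin> \<real> \<longrightarrow> (\<exists>J. has_weak_integral lebesgue (\<lambda>t. herglotz_kernel z t *\<^sub>C \<Xi> t) J \<and>
      nevanlinna_log N z = C + J)"
    proof (intro allI impI)
      fix z :: complex assume "z \<notin> \<real>"
      then show "\<exists>J. has_weak_integral lebesgue (\<lambda>t. herglotz_kernel z t *\<^sub>C \<Xi> t) J \<and> nevanlinna_log N z = C + J"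
        using has_weak_integral_lebesgue[OF repr[of z]]
        by (intro exI[of _ "nevanlinna_log N z - C"]) (simp add: nonreal)
    qed
  qed (use cont in blast)
qed

end
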